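(* Let $j \in \mathbb{N}=\{0,1,2,\dots\}$ and fix $\alpha>0$. Let $A$ be any positive real number, and for $N$ large put $\sigma_A := \frac{1}{2} + \frac{A}{\log_2 N}$. Then, as $N \to \infty$, $$\max_{\substack{\ell\in\mathbb{Z}\\ \sqrt{N} \le \ell \le N}} \big|\zeta^{(j)}(\sigma_A + i\alpha \ell)\big| \ge \exp\bigg( (\lambda(A) + o(1)) \sqrt{\frac{\log N \,\log_3 N}{\log_2 N}} \bigg),$$ where $$\lambda(A) = \frac{1}{\sqrt{2}\,(e-1)\,e^{A}}.$$
   Context: $\zeta$ denotes the Riemann zeta function and $\zeta^{(j)}$ its $j$-th derivative ($\zeta^{(0)}=\zeta$). $\log_k$ denotes the $k$-fold iterated natural logarithm, e.g. $\log_2 N = \log\log N$, $\log_3 N=\log\log\log N$. The term $o(1)$ tends to $0$ as $N\to\infty$. *)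

theory Defs
  imports "HOL-Complex_Analysis.Complex_Analysis"
begin

text \<open>
  The Riemann zeta function is the analytic continuation of its Dirichlet series to
  \<open>\<complex> \<setminus> {1}\<close>. The value at the pole is irrelevant and set to 0, which makes the function unique;
  \<open>is_zeta_ex1\<close> below shows that it exists.
\<close>

definition is_zeta :: "(complex \<Rightarrow> complex) \<Rightarrow> bool" where
  "is_zeta f \<longleftrightarrow>
     f holomorphic_on (- {1}) \<and>
     (\<forall>s. Re s > 1 \<longrightarrow> (\<lambda>n. 1 / of_nat (Suc n) powr s) sums f s) \<and>
     f 1 = 0"

definition zeta :: "complex \<Rightarrow> complex" where
  "zeta = (THE f. is_zeta f)"

definition iter_ln :: "nat \<Rightarrow> real \<Rightarrow> real" where
  "iter_ln k = ln ^^ k"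

definition sigma_pt :: "real \<Rightarrow> real \<Rightarrow> real" where
  "sigma_pt A N = 1 / 2 + A / iter_ln 2 N"

definition lambda_const :: "real \<Rightarrow> real" where
  "lambda_const A = 1 / (sqrt 2 * (exp 1 - 1) * exp A)"


lemma suminf_holomorphic_halfplane:
  fixes f :: "nat \<Rightarrow> complex \<Rightarrow> complex" and b :: real
  assumes hol: "\<And>n. f n holomorphic_on {s. Re s > 1 - b}"
    and C: "continuous_on UNIV C"
    and bound: "\<And>n s. Re s > 1 - b \<Longrightarrow> norm (f n s) \<le> C s * real (Suc n) powr (- Re s - b)"
  shows "(\<lambda>s. \<Sum>n. f n s) holomorphic_on {s. Re s > 1 - b}"
    and "\<And>s. Re s > 1 - b \<Longrightarrow> summable (\<lambda>n. f n s)"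
proof -
  let ?H = "{s. Re s > 1 - b}"
  have summ: "summable (\<lambda>n. c * real (Suc n) powr x)" if "x < -1" for x c
    using that summable_Suc_iff[of "\<lambda>n. real n powr x"] summable_real_powr_iff[of x]
    by (intro summable_mult) auto
  show "summable (\<lambda>n. f n s)" if "Re s > 1 - b" for s
    using bound[OF that]
    by (intro summable_comparison_test'[OF summ[of "- Re s - b" "C s"]]) (use that in auto)
  have op: "open ?H" by (rule open_halfspace_Re_gt)
  show "(\<lambda>s. \<Sum>n. f n s) holomorphic_on ?H"
  proof (rule holomorphic_uniform_sequence[OF op])
    show "(\<lambda>s. \<Sum>i<n. f i s) holomorphic_on ?H" for n
      by (intro holomorphic_intros hol)
    fix x :: complex assume x: "x \<in> ?H"
    define d where "d = (Re x - (1 - b)) / 2"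
    have d: "d > 0" using x by (simp add: d_def)
    have re: "Re y \<ge> 1 - b + d" if "y \<in> cball x d" for y
    proof -
      have "Re x - Re y \<le> norm (x - y)" using complex_Re_le_cmod[of "x - y"] by simp
      also have "\<dots> \<le> d" using that by (simp add: dist_norm)
      finally show ?thesis by (simp add: d_def field_simps)
    qed
    obtain B where B: "\<And>y. y \<in> cball x d \<Longrightarrow> norm (C y) \<le> B"
      using compact_imp_bounded[OF compact_continuous_image
          [OF continuous_on_subset[OF C subset_UNIV] compact_cball[of x d]]]
      unfolding bounded_iff by blast
    have "uniform_limit (cball x d) (\<lambda>n s. \<Sum>i<n. f i s) (\<lambda>s. \<Sum>n. f n s) sequentially"
    proof (rule Weierstrass_m_test)
      show "summable (\<lambda>n. B * real (Suc n) powr (- 1 - d))"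
        using d by (intro summ) simp
      fix n y assume y: "y \<in> cball x d"
      have "norm (f n y) \<le> C y * real (Suc n) powr (- Re y - b)"
        using re[OF y] d by (intro bound) simp
      also have "\<dots> \<le> B * real (Suc n) powr (- 1 - d)"
        using re[OF y] B[OF y]
        by (intro mult_mono powr_mono) (auto intro: order_trans[OF norm_ge_zero])
      finally show "norm (f n y) \<le> B * real (Suc n) powr (- 1 - d)" .
    qed
    moreover have "cball x d \<subseteq> ?H" using re d by force
    ultimately show "\<exists>d>0. cball x d \<subseteq> ?H \<and>
        uniform_limit (cball x d) (\<lambda>n s. \<Sum>i<n. f i s) (\<lambda>s. \<Sum>n. f n s) sequentially"
      using d by blast
  qed
qed

definition dseries :: "complex \<Rightarrow> complex" where
  "dseries s = (\<Sum>n. 1 / of_nat (Suc n) powr s)"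

lemma norm_dseries_term:
  "norm (1 / of_nat (Suc n) powr s :: complex) = real (Suc n) powr (- Re s)"
proof -
  have "norm (of_nat (Suc n) powr s :: complex) = real (Suc n) powr Re s"
    by (subst norm_powr_real_powr) (auto simp del: of_nat_Suc)
  thus ?thesis by (simp only: norm_inverse norm_one powr_minus divide_inverse mult_1)
qed

lemma dseries_holomorphic: "dseries holomorphic_on {s. Re s > 1}"
  and dseries_summable: "Re s > 1 \<Longrightarrow> summable (\<lambda>n. 1 / of_nat (Suc n) powr s :: complex)"
proof -
  have *: "norm (1 / of_nat (Suc n) powr s :: complex) \<le> 1 * real (Suc n) powr (- Re s - 0)" for n s
    by (simp only: norm_dseries_term) simp
  have hol: "(\<lambda>s::complex. 1 / of_nat (Suc n) powr s) holomorphic_on {s. Re s > 1 - 0}" for n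
    by (intro holomorphic_intros) (auto simp del: of_nat_Suc)
  show "dseries holomorphic_on {s. Re s > 1}"
    using suminf_holomorphic_halfplane(1)[OF hol continuous_on_const *]
    by (simp add: dseries_def [abs_def])
  show "summable (\<lambda>n. 1 / of_nat (Suc n) powr s :: complex)" if "Re s > 1"
    using suminf_holomorphic_halfplane(2)[OF hol continuous_on_const *] that by simp
qed

definition ffall :: "nat \<Rightarrow> complex \<Rightarrow> complex" where
  "ffall i s = (\<Prod>k<i. 1 - s - of_nat k)"

definition rem :: "nat \<Rightarrow> nat \<Rightarrow> complex \<Rightarrow> complex" where
  "rem K n s = of_nat (Suc (Suc n)) powr (1 - s)
       - (\<Sum>i\<le>K. ffall i s * of_nat (Suc n) powr (1 - s - of_nat i) / fact i)"

lemma ffall_hol: "ffall i holomorphic_on S"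
  unfolding ffall_def [abs_def] by (intro holomorphic_intros)

lemma rem_bound:
  assumes "Re s > 1 - real K"
  shows "norm (rem K n s) \<le> norm (ffall (Suc K) s) / fact K * real (Suc n) powr (- Re s - real K)"
proof -
  let ?S = "{z. Re z \<ge> real (Suc n)}"
  let ?f = "\<lambda>i z. ffall i s * z powr (1 - s - of_nat i)"
  let ?B = "norm (ffall (Suc K) s) * real (Suc n) powr (- Re s - real K)"
  have "norm (?f 0 (of_nat (Suc (Suc n))) -
      (\<Sum>i\<le>K. ?f i (of_nat (Suc n)) * (of_nat (Suc (Suc n)) - of_nat (Suc n)) ^ i / fact i))
     \<le> ?B * norm (of_nat (Suc (Suc n)) - of_nat (Suc n) :: complex) ^ Suc K / fact K"
  proof (rule complex_Taylor[where S = "closed_segment (of_nat (Suc n)) (of_nat (Suc (Suc n)))"])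
    let ?T = "closed_segment (of_nat (Suc n)) (of_nat (Suc (Suc n))) :: complex set"
    have T: "z \<in> \<real> \<and> Re z \<ge> real (Suc n)" if "z \<in> ?T" for z
    proof -
      obtain u where "z = (1 - u) *\<^sub>R of_nat (Suc n) + u *\<^sub>R of_nat (Suc (Suc n))" "0 \<le> u"
        using \<open>z \<in> ?T\<close> unfolding closed_segment_def by blast
      hence "z = of_real (real (Suc n) + u)" "u \<ge> 0"
        by (simp_all add: scaleR_conv_of_real algebra_simps)
      thus ?thesis by simp
    qed
    show "convex ?T" by simp
    show "of_nat (Suc n) \<in> ?T" "of_nat (Suc (Suc n)) \<in> ?T" by simp_all
    show "(?f i has_field_derivative ?f (Suc i) z) (at z within ?T)" if "z \<in> ?T" for i z
    proof -
      have "z \<notin> \<real>\<^sub>\<le>\<^sub>0" using T[OF that] by (auto simp: complex_nonpos_Reals_iff)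
      hence "(?f i has_field_derivative
          ffall i s * ((1 - s - of_nat i) * z powr (1 - s - of_nat i - 1))) (at z within ?T)"
        by (intro has_field_derivative_at_within[OF DERIV_cmult] has_field_derivative_powr)
      moreover have "ffall i s * ((1 - s - of_nat i) * z powr (1 - s - of_nat i - 1)) = ?f (Suc i) z"
      proof -
        have "1 - s - of_nat i - 1 = 1 - s - of_nat (Suc i)" by simp
        thus ?thesis by (simp only: ffall_def prod.lessThan_Suc mult.assoc)
      qed
      ultimately show ?thesis by (simp only:)
    qed
    show "norm (?f (Suc K) z) \<le> ?B" if "z \<in> ?T" for z
    proof -
      have "norm (z powr (1 - s - of_nat (Suc K))) = Re z powr (- Re s - real K)"
        using T[OF that] by (subst norm_powr_real_powr) auto
      also have "\<dots> \<le> real (Suc n) powr (- Re s - real K)"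
        using T[OF that] assms by (intro powr_mono2') auto
      finally show ?thesis by (simp only: norm_mult) (intro mult_left_mono, auto)
    qed
  qed
  thus ?thesis by (simp add: rem_def ffall_def)
qed

lemma rem_hol: "rem K n holomorphic_on S"
  unfolding rem_def [abs_def]
  by (intro holomorphic_intros ffall_hol) (auto simp del: of_nat_Suc)

lemma rem_suminf_hol: "(\<lambda>s. \<Sum>n. rem K n s) holomorphic_on {s. Re s > 1 - real K}"
proof (rule suminf_holomorphic_halfplane(1)[OF rem_hol _ rem_bound])
  show "continuous_on UNIV (\<lambda>s. norm (ffall (Suc K) s) / fact K)"
    by (intro continuous_intros holomorphic_on_imp_continuous_on ffall_hol) auto
qed

lemma dseries_recursion:
  assumes s: "Re s > 1"
  shows "(s - 1) * dseries s =
    1 + (\<Sum>n. rem (Suc k) n s)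
      - (\<Sum>i=1..k. ffall i s / fact (Suc i) * ((s + of_nat i - 1) * dseries (s + of_nat i)))"
proof -
  have lim: "(\<lambda>n. of_nat (Suc n) powr (1 - s) :: complex) \<longlonglongrightarrow> 0"
  proof (rule tendsto_norm_zero_cancel)
    have "(\<lambda>n. real (Suc n) powr (1 - Re s)) \<longlonglongrightarrow> 0"
      using s by (intro tendsto_neg_powr filterlim_compose[OF filterlim_real_sequentially filterlim_Suc]) auto
    moreover have "norm (of_nat (Suc n) powr (1 - s) :: complex) = real (Suc n) powr (1 - Re s)" for n
      by (subst norm_powr_real_powr) (auto simp del: of_nat_Suc)
    ultimately show "(\<lambda>n. norm (of_nat (Suc n) powr (1 - s) :: complex)) \<longlonglongrightarrow> 0" by simp
  qed
  have tel: "(\<lambda>n. of_nat (Suc (Suc n)) powr (1 - s) - of_nat (Suc n) powr (1 - s) :: complex) sums (0 - 1)"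
    using telescope_sums[OF lim] by simp
  have ds: "(\<lambda>n. of_nat (Suc n) powr (1 - s - of_nat (Suc i)) :: complex) sums dseries (s + of_nat i)" for i
  proof -
    have "(\<lambda>n. 1 / of_nat (Suc n) powr (s + of_nat i) :: complex) sums dseries (s + of_nat i)"
      unfolding dseries_def using s by (intro summable_sums dseries_summable) simp
    moreover have "1 / of_nat (Suc n) powr (s + of_nat i) = (of_nat (Suc n) powr (1 - s - of_nat (Suc i)) :: complex)" for n
    proof -
      have "1 - s - of_nat (Suc i) = - (s + of_nat i)" by simp
      thus ?thesis by (simp only: powr_minus divide_inverse mult_1)
    qed
    ultimately show ?thesis by simp
  qed
  have "rem (Suc k) n s = (of_nat (Suc (Suc n)) powr (1 - s) - of_nat (Suc n) powr (1 - s))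
      - (\<Sum>i\<le>k. ffall (Suc i) s / fact (Suc i) * of_nat (Suc n) powr (1 - s - of_nat (Suc i)))" for n
    unfolding rem_def by (subst sum.atMost_Suc_shift) (simp add: ffall_def del: of_nat_Suc prod.lessThan_Suc fact_Suc)
  hence "(\<lambda>n. rem (Suc k) n s) sums
      ((0 - 1) - (\<Sum>i\<le>k. ffall (Suc i) s / fact (Suc i) * dseries (s + of_nat i)))"
    by (simp only:) (intro sums_diff tel sums_sum sums_mult ds)
  hence "(\<Sum>n. rem (Suc k) n s) =
      - 1 - (\<Sum>i\<le>k. ffall (Suc i) s / fact (Suc i) * dseries (s + of_nat i))"
    by (simp add: sums_iff)
  also have "(\<Sum>i\<le>k. ffall (Suc i) s / fact (Suc i) * dseries (s + of_nat i)) =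
      (1 - s) * dseries s + (\<Sum>i=1..k. ffall (Suc i) s / fact (Suc i) * dseries (s + of_nat i))"
    by (simp add: atMost_atLeast0 sum.atLeast_Suc_atMost ffall_def)
  also have "(\<Sum>i=1..k. ffall (Suc i) s / fact (Suc i) * dseries (s + of_nat i)) =
      - (\<Sum>i=1..k. ffall i s / fact (Suc i) * ((s + of_nat i - 1) * dseries (s + of_nat i)))"
    unfolding sum_negf [symmetric]
  proof (rule sum.cong[OF refl])
    fix i
    have "ffall (Suc i) s = - (ffall i s * (s + of_nat i - 1))"
      by (simp add: ffall_def algebra_simps)
    thus "ffall (Suc i) s / fact (Suc i) * dseries (s + of_nat i) =
        - (ffall i s / fact (Suc i) * ((s + of_nat i - 1) * dseries (s + of_nat i)))"
      by (simp add: mult_ac del: fact_Suc)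
  qed
  finally show ?thesis by (simp add: algebra_simps)
qed

lemma dseries_continuation_step:
  "\<exists>g. g holomorphic_on {s. Re s > 1 - real k} \<and> (\<forall>s. Re s > 1 \<longrightarrow> g s = (s - 1) * dseries s)"
proof (induction k)
  case 0
  show ?case
    by (rule exI[of _ "\<lambda>s. (s - 1) * dseries s"]) (auto intro!: holomorphic_intros dseries_holomorphic)
next
  case (Suc k)
  then obtain g where g: "g holomorphic_on {s. Re s > 1 - real k}"
    and eq: "\<And>s. Re s > 1 \<Longrightarrow> g s = (s - 1) * dseries s" by blast
  define h where "h = (\<lambda>s. 1 + (\<Sum>n. rem (Suc k) n s)
      - (\<Sum>i=1..k. ffall i s / fact (Suc i) * g (s + of_nat i)))"
  have "(g \<circ> (\<lambda>s. s + of_nat i)) holomorphic_on {s. Re s > 1 - real (Suc k)}" if "i \<ge> 1" for i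
    using that
    by (intro holomorphic_on_compose_gen[OF _ g] holomorphic_intros) auto
  hence "h holomorphic_on {s. Re s > 1 - real (Suc k)}"
    unfolding h_def
    by (intro holomorphic_intros rem_suminf_hol ffall_hol) (auto simp: o_def)
  moreover have "h s = (s - 1) * dseries s" if "Re s > 1" for s
    unfolding h_def dseries_recursion[OF that, of k] using that by (simp add: eq)
  ultimately show ?case by blast
qed

lemma dseries_continuation:
  "\<exists>F. F holomorphic_on UNIV \<and> (\<forall>s. Re s > 1 \<longrightarrow> F s = (s - 1) * dseries s)"
proof -
  obtain G where G: "\<And>k. G k holomorphic_on {s. Re s > 1 - real k}"
    and eq: "\<And>k s. Re s > 1 \<Longrightarrow> G k s = (s - 1) * dseries s"
    using dseries_continuation_step by metis
  have mono: "G k s = G l s" if "k \<le> l" "Re s > 1 - real k" for k l s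
  proof (rule analytic_continuation_open[of "{s. Re s > 1}" "{s. Re s > 1 - real k}" "G k" "G l"])
    show "{s. Re s > 1} \<noteq> {}" by (auto intro!: exI[of _ 2])
    show "connected {s. Re s > 1 - real k}" by (intro convex_connected convex_halfspace_Re_gt)
    show "G l holomorphic_on {s. Re s > 1 - real k}"
      by (rule holomorphic_on_subset[OF G]) (use that in auto)
  qed (use that in \<open>auto simp: eq open_halfspace_Re_gt G\<close>)
  define F where "F = (\<lambda>s. G (nat \<lceil>2 - Re s\<rceil>) s)"
  have F: "F s = G k s" if "Re s > 1 - real k" for k s
  proof -
    have "Re s > 1 - real (nat \<lceil>2 - Re s\<rceil>)" by linarith
    thus ?thesis unfolding F_def using mono that by (metis nle_le)
  qed
  have "F holomorphic_on {s. Re s > 1 - real k}" for k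
    using G[of k] by (rule holomorphic_transform) (simp add: F)
  hence "F holomorphic_on (\<Union>k. {s. Re s > 1 - real k})"
    by (intro holomorphic_on_UN_open) (auto simp: open_halfspace_Re_gt)
  moreover have "(\<Union>k. {s. Re s > 1 - real k}) = UNIV"
  proof -
    have "\<exists>k. Re s > 1 - real k" for s
      using reals_Archimedean2[of "1 - Re s"] by (auto simp: algebra_simps)
    thus ?thesis by blast
  qed
  moreover have "F s = (s - 1) * dseries s" if "Re s > 1" for s
    using F[of 0 s] eq[of s 0] that by simp
  ultimately show ?thesis by auto
qed

lemma is_zeta_ex1: "\<exists>!f. is_zeta f"
proof (rule ex_ex1I)
  obtain F where F: "F holomorphic_on UNIV" "\<And>s. Re s > 1 \<Longrightarrow> F s = (s - 1) * dseries s"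
    using dseries_continuation by blast
  define f where "f = (\<lambda>s. if s = 1 then 0 else F s / (s - 1))"
  have "(\<lambda>s. F s / (s - 1)) holomorphic_on (- {1})"
    by (intro holomorphic_intros holomorphic_on_subset[OF F(1)]) auto
  hence "f holomorphic_on (- {1})"
    by (rule holomorphic_transform) (auto simp: f_def)
  moreover have "(\<lambda>n. 1 / of_nat (Suc n) powr s) sums f s" if "Re s > 1" for s
  proof -
    have "s \<noteq> 1" using that by auto
    hence "f s = dseries s" using F(2)[OF that] by (simp add: f_def)
    thus ?thesis using summable_sums[OF dseries_summable[OF that]] by (simp add: dseries_def)
  qed
  ultimately have "is_zeta f" by (simp add: is_zeta_def f_def)
  thus "\<exists>f. is_zeta f" by blast
next
  fix f g assume fg: "is_zeta f" "is_zeta g"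
  show "f = g"
  proof
    fix s
    show "f s = g s"
    proof (cases "s = 1")
      case False
      show ?thesis
      proof (rule analytic_continuation_open[of "{s. Re s > 1}" "- {1}" f g])
        show "{s. Re s > 1} \<noteq> {}" by (auto intro!: exI[of _ 2])
        show "connected (- {1::complex})" by (rule connected_punctured_universe) simp
        show "f z = g z" if "z \<in> {s. Re s > 1}" for z
          using fg that by (auto simp: is_zeta_def intro: sums_unique2)
      qed (use fg False in \<open>auto simp: is_zeta_def open_halfspace_Re_gt\<close>)
    qed (use fg in \<open>simp add: is_zeta_def\<close>)
  qed
qed

lemma is_zeta_zeta: "is_zeta zeta"
  unfolding zeta_def by (rule theI'[OF is_zeta_ex1])

lemma zeta_holomorphic: "zeta holomorphic_on (- {1})"
  and zeta_sums: "Re s > 1 \<Longrightarrow> (\<lambda>n. 1 / of_nat (Suc n) powr s) sums zeta s"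
  using is_zeta_zeta by (auto simp: is_zeta_def)

end

theory Submission
  imports Defs "HOL-Number_Theory.Number_Theory" "HOL-Real_Asymp.Real_Asymp"
begin

text \<open>
  The proof is by the resonance method. For \<open>\<bar>\<ell>\<bar> < N\<close> the derivative \<open>\<zeta>^(j)(\<sigma> + i\<alpha>\<ell>)\<close> is
  replaced by a Dirichlet polynomial of length slightly above \<open>N\<close>, which is averaged against a
  product of two resonators with a Fejer weight. All coefficients and the Fejer kernel are
  nonnegative, so any family of pairs \<open>(m, n)\<close> with \<open>n = mk\<close> gives a lower bound for the average.
  The frequencies \<open>\<alpha> ln n / 2\<pi>\<close> of the resonators matter only modulo 1 and are rounded to a grid of
  width \<open>1 / (8N)\<close>, so that Parseval's identity on the grid bounds the mean square of a resonator
  without any spacing condition.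

  The resonators run over the products of exactly \<open>m\<^sub>j\<close> primes, respectively \<open>m\<^sub>j - D\<^sub>j\<close> primes,
  from each of the blocks \<open>(ln N * exp (j/50), ln N * exp ((j+1)/50)]\<close>, where \<open>m\<^sub>j\<close> is proportional
  to \<open>1 / j\<^sup>2\<close> times the mass \<open>\<Sum> ln p / p\<close> of the block; this needs no more than Mertens' first
  theorem. The factor \<open>e - 1\<close> in \<open>\<lambda>(A)\<close> leaves enough room to take resonators of size
  \<open>N powr (9/40)\<close> only, to treat the terms with \<open>\<bar>\<ell>\<bar> < \<surd>N\<close> by a pointwise bound, and to take \<open>\<epsilon> = 0\<close>.
\<close>

section \<open>Approximation of zeta derivatives by Dirichlet polynomials\<close>

text \<open>Where the parameters come from: write w for log log N and u = j + 1. A block with Q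
  primes near x, of which the resonators use m and m - D, contributes about (sqrt (Q m)
  x^(-sigma))^D / D! to the ratio of main term to mean square. This peaks at D = sqrt (Q m)
  x^(-sigma), where its logarithm is D. With Q about rho x / w, rho being the mass, D is about exp
  (-A) sqrt (rho m / w). The cost is the logarithm of the number of m-subsets, about m u / 50.
  Maximizing the sum of sqrt (rho m) for a fixed sum of m u forces m = c rho / u^2. Total cost and
  gain become c S / 50 and exp (-A) sqrt (c / w) S, where S, the sum of rho / u, is at least about
  (9/10) (ln w) / 50 for j between w^(1/20) and w^(19/20). A cost of (9/40) log N thus yields the
  constant sqrt (9/40 * 9/10) = 0.45 in front of exp (-A), whereas 1 / (sqrt 2 (e - 1)) < 0.42.
  Larger resonators are obstructed by the pointwise errors: these sum to N^(77/100), are multiplied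
  by the resonator size, and must stay below N; indeed 77/100 + 9/40 < 1.\<close>

definition zeta_tail :: "nat \<Rightarrow> complex \<Rightarrow> complex" where
  "zeta_tail M s = zeta s - (\<Sum>n<M. 1 / of_nat (Suc n) powr s)"

lemma zeta_tail_sums:
  assumes "Re s > 1"
  shows "(\<lambda>n. 1 / of_nat (Suc (n + M)) powr s) sums zeta_tail M s"
  unfolding zeta_tail_def by (rule sums_split_initial_segment[OF zeta_sums[OF assms]])

lemma dirichlet_sum_holomorphic: "(\<lambda>s. \<Sum>n<M. 1 / of_nat (Suc n) powr s :: complex) holomorphic_on A"
  by (intro holomorphic_intros) (auto simp del: of_nat_Suc)

lemma zeta_tail_holomorphic: "1 \<notin> A \<Longrightarrow> zeta_tail M holomorphic_on A"
  unfolding zeta_tail_def [abs_def]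
  by (intro holomorphic_on_diff dirichlet_sum_holomorphic holomorphic_on_subset[OF zeta_holomorphic]) auto

lemma ffall_0 [simp]: "ffall 0 s = 1" and ffall_1 [simp]: "ffall (Suc 0) s = 1 - s"
  by (simp_all add: ffall_def)

text \<open>\<open>rem\<close> is the remainder of the Taylor expansion of (n + 2) powr (1 - s)
  about n + 1. Summed over all indices from M on, the terms of order 0 telescope and the term of
  order i >= 1 turns into the zeta tail at s + i - 1.\<close>

lemma rem_sums:
  assumes s: "Re s > 1"
  shows "(\<lambda>n. rem K (n + M) s) sums (- (of_nat (Suc M) powr (1 - s))
     - (\<Sum>i=1..K. ffall i s / fact i * zeta_tail M (s + of_nat i - 1)))"
proof -
  have norm: "norm (of_nat (Suc n) powr (1 - s) :: complex) = real (Suc n) powr (1 - Re s)" for n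
    by (subst norm_powr_real_powr) (auto simp del: of_nat_Suc)
  have "(\<lambda>n. of_nat (Suc n) powr (1 - s) :: complex) \<longlonglongrightarrow> 0"
  proof (rule tendsto_norm_zero_cancel)
    have "(\<lambda>n. real (Suc n) powr (1 - Re s)) \<longlonglongrightarrow> 0"
      using s by (intro tendsto_neg_powr filterlim_compose[OF filterlim_real_sequentially filterlim_Suc]) auto
    thus "(\<lambda>n. norm (of_nat (Suc n) powr (1 - s) :: complex)) \<longlonglongrightarrow> 0" by (simp only: norm)
  qed
  hence "(\<lambda>n. of_nat (Suc (n + M)) powr (1 - s) :: complex) \<longlonglongrightarrow> 0"
    by (rule LIMSEQ_ignore_initial_segment)
  hence tel: "(\<lambda>n. of_nat (Suc (Suc (n + M))) powr (1 - s) - of_nat (Suc (n + M)) powr (1 - s) :: complex)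
     sums (0 - of_nat (Suc M) powr (1 - s))"
    using telescope_sums[of "\<lambda>n. of_nat (Suc (n + M)) powr (1 - s) :: complex" 0] by simp
  have tail: "(\<lambda>n. of_nat (Suc (n + M)) powr (1 - s - of_nat i) :: complex) sums zeta_tail M (s + of_nat i - 1)"
    if "i \<ge> 1" for i
  proof -
    have "1 / of_nat (Suc m) powr (s + of_nat i - 1) = (of_nat (Suc m) powr (1 - s - of_nat i) :: complex)" for m
    proof -
      have "1 - s - of_nat i = - (s + of_nat i - 1)" by simp
      thus ?thesis by (simp only: powr_minus divide_inverse mult_1)
    qed
    moreover have "Re (s + of_nat i - 1) > 1" using s that by simp
    ultimately show ?thesis using zeta_tail_sums[of "s + of_nat i - 1" M] by (simp only:)
  qed
  have "rem K m s = (of_nat (Suc (Suc m)) powr (1 - s) - of_nat (Suc m) powr (1 - s))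
      - (\<Sum>i=1..K. ffall i s / fact i * of_nat (Suc m) powr (1 - s - of_nat i))" for m
    unfolding rem_def atMost_atLeast0 by (subst sum.atLeast_Suc_atMost) (simp_all del: of_nat_Suc)
  hence "(\<lambda>n. rem K (n + M) s) sums ((0 - of_nat (Suc M) powr (1 - s))
      - (\<Sum>i=1..K. ffall i s / fact i * zeta_tail M (s + of_nat i - 1)))"
    by (simp only:) (intro sums_diff tel sums_sum sums_mult tail, simp)
  thus ?thesis by simp
qed

text \<open>Weakened from \<open>Suc (n + M)\<close> to \<open>Suc n\<close> to have the shape that
  \<open>suminf_holomorphic_halfplane\<close> asks for.\<close>

lemma rem_tail_bound:
  assumes "Re s > 1 - real K"
  shows "norm (rem K (n + M) s) \<le> norm (ffall (Suc K) s) / fact K * real (Suc n) powr (- Re s - real K)"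
proof -
  have "real (Suc (n + M)) powr (- Re s - real K) \<le> real (Suc n) powr (- Re s - real K)"
    using assms by (intro powr_mono2') auto
  thus ?thesis
    by (intro order_trans[OF rem_bound[OF assms, of "n + M"]] mult_left_mono) auto
qed

lemma rem_tail_suminf_holomorphic:
  "(\<lambda>s. \<Sum>n. rem K (n + M) s) holomorphic_on {s. Re s > 1 - real K}"
proof (rule suminf_holomorphic_halfplane(1)[OF rem_hol _ rem_tail_bound])
  show "continuous_on UNIV (\<lambda>s. norm (ffall (Suc K) s) / fact K)"
    by (intro continuous_intros holomorphic_on_imp_continuous_on ffall_hol) auto
qed

text \<open>Analytic continuation of \<open>rem_sums\<close>. The restriction to the upper
  half-plane keeps the domain convex, hence connected, and away from the poles s = 2 - i of the
  shifted tails, which are all real.\<close>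

lemma rem_tail_suminf:
  assumes "Re s > 1 - real K" "Im s > 0"
  shows "(\<Sum>n. rem K (n + M) s) = - (of_nat (Suc M) powr (1 - s))
     - (\<Sum>i=1..K. ffall i s / fact i * zeta_tail M (s + of_nat i - 1))"
proof (rule analytic_continuation_open[of "{s. Re s > 1} \<inter> {s. Im s > 0}" "{s. Re s > 1 - real K} \<inter> {s. Im s > 0}"
    "\<lambda>s. \<Sum>n. rem K (n + M) s"])
  show "open ({s. Re s > 1} \<inter> {s. Im s > 0})" "open ({s. Re s > 1 - real K} \<inter> {s. Im s > 0})"
    by (intro open_Int open_halfspace_Re_gt open_halfspace_Im_gt)+
  have "Complex 2 1 \<in> {s. Re s > 1} \<inter> {s. Im s > 0}" by simp
  thus "{s. Re s > 1} \<inter> {s. Im s > 0} \<noteq> {}" by blast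
  show "connected ({s. Re s > 1 - real K} \<inter> {s. Im s > 0})"
    by (intro convex_connected convex_Int convex_halfspace_Re_gt convex_halfspace_Im_gt)
  show "(\<lambda>s. \<Sum>n. rem K (n + M) s) holomorphic_on {s. Re s > 1 - real K} \<inter> {s. Im s > 0}"
    by (rule holomorphic_on_subset[OF rem_tail_suminf_holomorphic]) auto
  have "(\<lambda>s. zeta_tail M (s + of_nat i - 1)) holomorphic_on {s. Re s > 1 - real K} \<inter> {s. Im s > 0}" for i
  proof -
    have "zeta_tail M \<circ> (\<lambda>s. s + of_nat i - 1) holomorphic_on {s. Re s > 1 - real K} \<inter> {s. Im s > 0}"
      by (intro holomorphic_on_compose holomorphic_intros zeta_tail_holomorphic) (auto simp: complex_eq_iff)
    thus ?thesis by (simp add: o_def)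
  qed
  thus "(\<lambda>s. - (of_nat (Suc M) powr (1 - s))
     - (\<Sum>i=1..K. ffall i s / fact i * zeta_tail M (s + of_nat i - 1)))
     holomorphic_on {s. Re s > 1 - real K} \<inter> {s. Im s > 0}"
    by (intro holomorphic_intros ffall_hol) (auto simp del: of_nat_Suc)
  show "(\<Sum>n. rem K (n + M) z) = - (of_nat (Suc M) powr (1 - z))
     - (\<Sum>i=1..K. ffall i z / fact i * zeta_tail M (z + of_nat i - 1))"
    if "z \<in> {s. Re s > 1} \<inter> {s. Im s > 0}" for z
    using rem_sums[of z K M] that by (simp add: sums_iff)
qed (use assms in auto)

text \<open>For y >= M + 1 the factor y powr (2 - a) is at most its value at M + 1, and the
  remaining 1 / y^2 is at most the telescoping difference 2 / y - 2 / (y + 1).\<close>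

lemma tail_powr_sum:
  assumes "a \<ge> 2"
  shows "summable (\<lambda>n. real (Suc (n + M)) powr (- a))"
    and "(\<Sum>n. real (Suc (n + M)) powr (- a)) \<le> 2 * real (Suc M) powr (1 - a)"
proof -
  let ?X = "real (Suc M)"
  define g where "g = (\<lambda>n. ?X powr (2 - a) * (2 / real (Suc (n + M)) - 2 / real (Suc (Suc n + M))))"
  have "(\<lambda>n. 2 / real (Suc (n + M))) \<longlonglongrightarrow> 0"
    by real_asymp
  hence "(\<lambda>n. 2 / real (Suc (n + M)) - 2 / real (Suc (Suc n + M))) sums (2 / real (Suc (0 + M)) - 0)"
    by (rule telescope_sums')
  hence g: "g sums (?X powr (2 - a) * (2 / ?X))"
    unfolding g_def by (intro sums_mult) simp
  have le: "real (Suc (n + M)) powr (- a) \<le> g n" for n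
  proof -
    let ?y = "real (Suc (n + M))"
    have y: "?y \<ge> 1" "?y \<ge> ?X" by simp_all
    have "?y powr (- a) = ?y powr (2 - a) * ?y powr (- 2)" by (simp only: flip: powr_add) simp
    moreover have "?y powr (- 2) = 1 / ?y\<^sup>2"
      using y by (simp only: powr_minus powr_numeral divide_inverse mult_1)
    ultimately have "?y powr (- a) = ?y powr (2 - a) * (1 / ?y\<^sup>2)" by (simp only:)
    also have "\<dots> \<le> ?X powr (2 - a) * (2 / ?y - 2 / (?y + 1))"
    proof (intro mult_mono powr_mono2')
      have "1 / y\<^sup>2 \<le> 2 / y - 2 / (y + 1)" if "y \<ge> 1" for y :: real
      proof -
        have "1 / y\<^sup>2 = 2 / (y * (2 * y))" using that by (simp add: power2_eq_square)
        also have "\<dots> \<le> 2 / (y * (y + 1))" using that by (intro divide_left_mono mult_left_mono mult_pos_pos) auto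
        also have "\<dots> = 2 / y - 2 / (y + 1)" using that by (simp add: field_simps)
        finally show ?thesis .
      qed
      thus "1 / ?y\<^sup>2 \<le> 2 / ?y - 2 / (?y + 1)" using y(1) by blast
    qed (use y assms in auto)
    finally show ?thesis by (simp add: g_def add_ac)
  qed
  show summ: "summable (\<lambda>n. real (Suc (n + M)) powr (- a))"
    by (rule summable_comparison_test'[OF sums_summable[OF g]]) (use le in auto)
  have "(\<Sum>n. real (Suc (n + M)) powr (- a)) \<le> (\<Sum>n. g n)"
    by (intro suminf_le le summ sums_summable[OF g])
  also have "\<dots> = ?X powr ((1 - a) + 1) * (2 / ?X)"
    using sums_unique[OF g] by simp
  also have "\<dots> = 2 * ?X powr (1 - a)"
    by (subst powr_add) (simp del: of_nat_Suc)
  finally show "(\<Sum>n. real (Suc (n + M)) powr (- a)) \<le> 2 * ?X powr (1 - a)" .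
qed

lemma norm_ffall_le:
  assumes "\<And>k. k < i \<Longrightarrow> \<bar>1 - Re s - real k\<bar> \<le> B * Im s" "Im s > 0"
  shows "norm (ffall i s) \<le> ((B + 1) * Im s) ^ i"
proof -
  have "norm (1 - s - of_nat k) \<le> (B + 1) * Im s" if "k < i" for k
    using cmod_le[of "1 - s - of_nat k"] assms(1)[OF that] assms(2) by (simp add: algebra_simps)
  hence "(\<Prod>k<i. norm (1 - s - of_nat k)) \<le> (\<Prod>k<i. (B + 1) * Im s)"
    by (intro prod_mono) auto
  thus ?thesis by (simp add: ffall_def prod_norm)
qed

text \<open>
  In \<open>rem_tail_suminf\<close> the terms with \<open>i \<ge> 2\<close> involve the tail further to the right, so each
  application improves the trivial bound by a factor \<open>Im s / (M + 1)\<close>.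
\<close>
lemma norm_zeta_tail_le:
  "\<exists>C\<ge>0. \<forall>M s. 2 - real d \<le> Re s \<and> Re s \<le> R \<and> 1 \<le> Im s \<and> Im s \<le> real (Suc M) \<longrightarrow>
     norm (zeta_tail M s) \<le> C * real (Suc M) powr (1 - Re s) * (1 / Im s + (Im s / real (Suc M)) ^ d)"
proof (induction d arbitrary: R)
  case 0
  have "norm (zeta_tail M s) \<le> 2 * real (Suc M) powr (1 - Re s) * (1 / Im s + (Im s / real (Suc M)) ^ 0)"
    if s: "2 \<le> Re s" "1 \<le> Im s" for M s
  proof -
    have norm: "norm (1 / of_nat (Suc n) powr s :: complex) = real (Suc n) powr (- Re s)" for n
      by (rule norm_dseries_term)
    have "zeta_tail M s = (\<Sum>n. 1 / of_nat (Suc (n + M)) powr s)"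
      using zeta_tail_sums[of s M] s by (simp add: sums_iff)
    also have "norm \<dots> \<le> (\<Sum>n. real (Suc (n + M)) powr (- Re s))"
      unfolding norm [symmetric]
      by (rule summable_norm) (use tail_powr_sum(1)[OF s(1), of M] in \<open>simp only: norm\<close>)
    also have "\<dots> \<le> 2 * real (Suc M) powr (1 - Re s)" by (rule tail_powr_sum(2)[OF s(1)])
    also have "\<dots> \<le> 2 * real (Suc M) powr (1 - Re s) * (1 / Im s + (Im s / real (Suc M)) ^ 0)"
      using s by (subst mult_le_cancel_left1) auto
    finally show ?thesis .
  qed
  thus ?case by (intro exI[of _ 2]) auto
next
  case (Suc d)
  \<comment> \<open>The order K makes the remainder series converge with exponent Re s + K >= 2. The
    shifts s + i - 1 with 2 <= i <= K lie at least one unit further right, where the induction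
    hypothesis for d applies with \<open>R\<close> enlarged by K.\<close>
  define K where "K = Suc d"
  obtain C where C: "C \<ge> 0" and IH: "\<And>M s. 2 - real d \<le> Re s \<Longrightarrow> Re s \<le> R + real K \<Longrightarrow> 1 \<le> Im s \<Longrightarrow> Im s \<le> real (Suc M) \<Longrightarrow>
     norm (zeta_tail M s) \<le> C * real (Suc M) powr (1 - Re s) * (1 / Im s + (Im s / real (Suc M)) ^ d)"
    using Suc.IH[of "R + real K"] by blast
  define B where "B = \<bar>R\<bar> + 2 * real K + 5"
  define C' where "C' = 1 + 2 * B ^ Suc K + (\<Sum>i=2..K. C * B ^ i)"
  have "C' \<ge> 0" using C by (auto simp: C'_def B_def intro!: add_nonneg_nonneg sum_nonneg)
  moreover have "norm (zeta_tail M s) \<le> C' * real (Suc M) powr (1 - Re s) * (1 / Im s + (Im s / real (Suc M)) ^ Suc d)"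
    if s: "2 - real (Suc d) \<le> Re s" "Re s \<le> R" "1 \<le> Im s" "Im s \<le> real (Suc M)" for M s
  proof -
    define X t q P where "X = real (Suc M)" and "t = Im s" and "q = t / X" and "P = X powr (1 - Re s)"
    define b where "b = 1 / t + q ^ Suc d"
    have X: "X \<ge> 1" and t: "t \<ge> 1" and q: "0 < q" "q \<le> 1" and P: "P > 0"
      using s by (simp_all add: X_def t_def q_def P_def del: of_nat_Suc)
    have b: "b \<ge> 0" "1 / t \<le> b" "q ^ Suc d \<le> b" using t q by (simp_all add: b_def)
    have ff: "norm (ffall i s) \<le> (B * t) ^ i" if "i \<le> Suc K" for i
    proof -
      have "norm (ffall i s) \<le> ((\<bar>R\<bar> + 2 * real K + 4 + 1) * Im s) ^ i"
      proof (rule norm_ffall_le)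
        fix k assume "k < i"
        hence "\<bar>1 - Re s - real k\<bar> \<le> (\<bar>R\<bar> + 2 * real K + 4) * 1" using s that by (simp add: K_def)
        also have "\<dots> \<le> (\<bar>R\<bar> + 2 * real K + 4) * Im s" using s by (intro mult_left_mono) auto
        finally show "\<bar>1 - Re s - real k\<bar> \<le> (\<bar>R\<bar> + 2 * real K + 4) * Im s" .
      qed (use s in auto)
      thus ?thesis by (simp add: B_def t_def add_ac)
    qed
    have Xpow: "X powr (1 - Re s - real m) = P / X ^ m" for m
      using X by (simp add: P_def powr_diff flip: powr_realpow)
    have K: "Re s > 1 - real K" "Re s + real K \<ge> 2" using s by (simp_all add: K_def)
    \<comment> \<open>The summand i = 1 carries the factor \<open>ffall 1 s\<close>, which is 1 - s
      and has norm at least Im s. Isolating it and dividing by Im s produces the bound.\<close>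
    have "(1 - s) * zeta_tail M s = - (of_nat (Suc M) powr (1 - s)) - (\<Sum>n. rem K (n + M) s)
      - (\<Sum>i=2..K. ffall i s / fact i * zeta_tail M (s + of_nat i - 1))"
    proof -
      have "(\<Sum>i=1..K. ffall i s / fact i * zeta_tail M (s + of_nat i - 1)) =
        (1 - s) * zeta_tail M s + (\<Sum>i=2..K. ffall i s / fact i * zeta_tail M (s + of_nat i - 1))"
        by (subst sum.atLeast_Suc_atMost) (simp_all add: K_def numeral_2_eq_2)
      moreover have "Im s > 0" using t by (simp add: t_def)
      ultimately show ?thesis using rem_tail_suminf[OF K(1), of M] by (simp only:) (simp add: algebra_simps)
    qed
    hence eq: "norm (1 - s) * norm (zeta_tail M s) = norm (- (of_nat (Suc M) powr (1 - s)) - (\<Sum>n. rem K (n + M) s)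
      - (\<Sum>i=2..K. ffall i s / fact i * zeta_tail M (s + of_nat i - 1)))" by (simp only: flip: norm_mult)
    have tri: "norm (- a - b - c) \<le> norm a + norm b + norm c" for a b c :: complex
      using norm_triangle_ineq4[of "- a - b" c] norm_triangle_ineq4[of "- a" b] by simp
    have "norm (1 - s) * norm (zeta_tail M s) \<le> norm (of_nat (Suc M) powr (1 - s)) + norm (\<Sum>n. rem K (n + M) s)
      + norm (\<Sum>i=2..K. ffall i s / fact i * zeta_tail M (s + of_nat i - 1))"
      unfolding eq by (rule tri)
    also have "norm (of_nat (Suc M) powr (1 - s)) = P"
      unfolding P_def X_def by (subst norm_powr_real_powr) (auto simp del: of_nat_Suc)
    also have "norm (\<Sum>n. rem K (n + M) s) \<le> t * (2 * B ^ Suc K * P * q ^ Suc d)"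
    proof -
      have summ: "summable (\<lambda>n. (B * t) ^ Suc K * real (Suc (n + M)) powr (- (Re s + real K)))"
        by (intro summable_mult tail_powr_sum K)
      have le: "norm (rem K (n + M) s) \<le> (B * t) ^ Suc K * real (Suc (n + M)) powr (- (Re s + real K))" for n
      proof -
        have "norm (rem K (n + M) s) \<le> norm (ffall (Suc K) s) / fact K * real (Suc (n + M)) powr (- Re s - real K)"
          by (rule rem_bound[OF K(1)])
        also have "norm (ffall (Suc K) s) / fact K \<le> norm (ffall (Suc K) s) / 1"
          by (intro divide_left_mono) (auto simp: fact_ge_1)
        also have "\<dots> \<le> (B * t) ^ Suc K" using ff[of "Suc K"] by simp
        finally show ?thesis by (simp add: mult_right_mono)
      qed
      have "norm (\<Sum>n. rem K (n + M) s) \<le> (\<Sum>n. (B * t) ^ Suc K * real (Suc (n + M)) powr (- (Re s + real K)))"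
        by (rule norm_suminf_le[OF le summ])
      also have "\<dots> = (B * t) ^ Suc K * (\<Sum>n. real (Suc (n + M)) powr (- (Re s + real K)))"
        by (rule suminf_mult[OF tail_powr_sum(1)[OF K(2)]])
      also have "\<dots> \<le> (B * t) ^ Suc K * (2 * real (Suc M) powr (1 - (Re s + real K)))"
        using t by (intro mult_left_mono tail_powr_sum K) (auto simp: B_def)
      also have "\<dots> = t * (2 * B ^ Suc K * P * q ^ Suc d)"
      proof -
        have "real (Suc M) powr (1 - (Re s + real K)) = P / X ^ K"
          using Xpow[of K] by (simp only: X_def diff_diff_eq)
        thus ?thesis by (simp only:) (simp add: K_def q_def power_mult_distrib power_divide)
      qed
      finally show ?thesis .
    qed
    also have "norm (\<Sum>i=2..K. ffall i s / fact i * zeta_tail M (s + of_nat i - 1)) \<le> (\<Sum>i=2..K. t * (C * B ^ i * P * b))"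
    proof (rule sum_norm_le)
      fix i assume i: "i \<in> {2..K}"
      define m where "m = i - 2"
      have m: "i = Suc (Suc m)" using i unfolding m_def atLeastAtMost_iff by linarith
      have "norm (zeta_tail M (s + of_nat i - 1)) \<le> C * (X powr (1 - Re (s + of_nat i - 1)) * (1 / t + q ^ d))"
        using IH[of "s + of_nat i - 1" M] s i by (simp add: X_def t_def q_def K_def mult.assoc del: of_nat_Suc)
      also have "1 - Re (s + of_nat i - 1) = 1 - Re s - real (Suc m)" by (simp add: m)
      finally have Z: "norm (zeta_tail M (s + of_nat i - 1)) \<le> C * (P / X ^ Suc m * (1 / t + q ^ d))"
        by (simp only: Xpow)
      have "norm (ffall i s / fact i) \<le> norm (ffall i s) / 1"
        unfolding norm_divide norm_fact by (intro divide_left_mono) (auto simp: fact_ge_1)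
      hence "norm (ffall i s / fact i) \<le> (B * t) ^ i" using ff[of i] i by simp
      hence "norm (ffall i s / fact i * zeta_tail M (s + of_nat i - 1)) \<le> (B * t) ^ i * (C * (P / X ^ Suc m * (1 / t + q ^ d)))"
        unfolding norm_mult using Z t by (intro mult_mono) (auto simp: B_def)
      also have "\<dots> = t * (C * B ^ i * P * (q ^ Suc m * (1 / t + q ^ d)))"
        by (simp add: m q_def power_mult_distrib power_divide)
      also have "q ^ Suc m * (1 / t + q ^ d) \<le> b"
      proof -
        have "q ^ m \<le> 1" using q by (intro power_le_one) auto
        hence "q ^ Suc m \<le> q" using q by (simp add: mult_left_le)
        hence "q ^ Suc m * (1 / t + q ^ d) \<le> q * (1 / t + q ^ d)" using t q by (intro mult_right_mono) auto
        also have "\<dots> \<le> 1 / t + q ^ Suc d" using t q by (simp add: distrib_left divide_right_mono)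
        finally show ?thesis by (simp add: b_def)
      qed
      finally show "norm (ffall i s / fact i * zeta_tail M (s + of_nat i - 1)) \<le> t * (C * B ^ i * P * b)"
        using t C P by (simp add: mult_left_mono B_def)
    qed
    finally have "norm (1 - s) * norm (zeta_tail M s) \<le>
       P + t * (2 * B ^ Suc K * P * q ^ Suc d) + (\<Sum>i=2..K. t * (C * B ^ i * P * b))" by simp
    moreover have "t \<le> norm (1 - s)"
      using abs_Im_le_cmod[of "1 - s"] t by (simp add: t_def)
    hence "t * norm (zeta_tail M s) \<le> norm (1 - s) * norm (zeta_tail M s)" by (intro mult_right_mono) auto
    moreover have "P \<le> t * (P * b)" using b(2) t P by (simp add: field_simps)
    moreover have "t * (2 * B ^ Suc K * P * q ^ Suc d) \<le> t * (2 * B ^ Suc K * P * b)"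
      using b t P by (intro mult_left_mono) (auto simp: B_def)
    ultimately have "t * norm (zeta_tail M s) \<le> t * (P * b) + t * (2 * B ^ Suc K * P * b) + (\<Sum>i=2..K. t * (C * B ^ i * P * b))"
      by linarith
    also have "\<dots> = t * (C' * P * b)"
      by (simp add: C'_def sum_distrib_left sum_distrib_right algebra_simps)
    finally have "norm (zeta_tail M s) \<le> C' * P * b" using t by simp
    thus ?thesis by (simp only: P_def b_def q_def X_def t_def)
  qed
  ultimately show ?case by blast
qed

section \<open>Passage from the zeta tail to its derivatives\<close>

lemma higher_deriv_dirichlet_term:
  "(deriv ^^ j) (\<lambda>s::complex. 1 / of_nat (Suc n) powr s) = (\<lambda>s. of_real ((- ln (real (Suc n))) ^ j) / of_nat (Suc n) powr s)"
proof (induction j)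
  case (Suc j)
  let ?L = "ln (real (Suc n))"
  have Ln: "Ln (of_nat (Suc n)) = of_real ?L" by (metis Ln_of_nat of_nat_0_less_iff zero_less_Suc)
  have eq: "c / of_nat (Suc n) powr s = c * exp (- s * of_real ?L)" for c s :: complex
    unfolding powr_def Ln by (simp add: exp_minus divide_inverse del: of_nat_Suc)
  have "deriv (\<lambda>s. of_real ((- ?L) ^ j) * exp (- s * of_real ?L)) s = of_real ((- ?L) ^ Suc j) * exp (- s * of_real ?L)" for s
    by (rule DERIV_imp_deriv) (auto intro!: derivative_eq_intros simp del: of_nat_Suc)
  hence deriv: "deriv (\<lambda>s. of_real ((- ?L) ^ j) * exp (- s * of_real ?L)) =
      (\<lambda>s. of_real ((- ?L) ^ Suc j) * exp (- s * of_real ?L))" by (rule ext)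
  show ?case unfolding funpow.simps o_def Suc.IH unfolding eq by (rule deriv)
qed simp

lemma higher_deriv_dirichlet_sum:
  "(deriv ^^ j) (\<lambda>s::complex. \<Sum>n<M. 1 / of_nat (Suc n) powr s) s =
     (\<Sum>n<M. of_real ((- ln (real (Suc n))) ^ j) / of_nat (Suc n) powr s)"
proof (induction M)
  case 0
  have "(deriv ^^ j) (\<lambda>s::complex. 0) = (\<lambda>s. 0)" by (induction j) auto
  thus ?case by simp
next
  case (Suc M)
  have "(deriv ^^ j) (\<lambda>s. (\<Sum>n<M. 1 / of_nat (Suc n) powr s) + 1 / of_nat (Suc M) powr s) s =
     (deriv ^^ j) (\<lambda>s. \<Sum>n<M. 1 / of_nat (Suc n) powr s) s + (deriv ^^ j) (\<lambda>s. 1 / of_nat (Suc M) powr s) s"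
  proof (rule higher_deriv_add[where S = UNIV])
    show "(\<lambda>s::complex. 1 / of_nat (Suc M) powr s) holomorphic_on UNIV"
      by (intro holomorphic_intros) (auto simp del: of_nat_Suc)
  qed (rule dirichlet_sum_holomorphic, auto)
  thus ?case using Suc by (simp add: higher_deriv_dirichlet_term del: of_nat_Suc)
qed

text \<open>Cauchy's inequality on the circle of radius r transfers \<open>norm_zeta_tail_le\<close>
  to every derivative at the price of (M + 1) powr r. The conditions on r and d keep the circle
  inside Re z >= 2 - d. A large d makes the second term negligible as soon as M exceeds t by a small
  power.\<close>

proposition zeta_higher_deriv_approx:
  assumes r: "0 < r" "r \<le> 1 / 2" and d: "d \<ge> 2"
  shows "\<exists>C\<ge>0. \<forall>M \<sigma> t. 1 / 2 \<le> \<sigma> \<and> \<sigma> \<le> 1 \<and> 2 \<le> t \<and> t \<le> real M \<longrightarrow>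
    norm ((deriv ^^ j) zeta (Complex \<sigma> t) - (\<Sum>n<M. of_real ((- ln (real (Suc n))) ^ j) / of_nat (Suc n) powr (Complex \<sigma> t)))
     \<le> C * real (Suc M) powr (1 - \<sigma> + r) * (1 / t + (t / real (Suc M)) ^ d)"
proof -
  obtain C where C: "C \<ge> 0" and bound: "\<And>M s. 2 - real d \<le> Re s \<Longrightarrow> Re s \<le> 2 \<Longrightarrow> 1 \<le> Im s \<Longrightarrow> Im s \<le> real (Suc M) \<Longrightarrow>
     norm (zeta_tail M s) \<le> C * real (Suc M) powr (1 - Re s) * (1 / Im s + (Im s / real (Suc M)) ^ d)"
    using norm_zeta_tail_le[of d 2] by blast
  have "norm ((deriv ^^ j) zeta s - (\<Sum>n<M. of_real ((- ln (real (Suc n))) ^ j) / of_nat (Suc n) powr s))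
     \<le> fact j * C * 2 ^ d / r ^ j * real (Suc M) powr (1 - \<sigma> + r) * (1 / t + (t / real (Suc M)) ^ d)"
    if *: "1 / 2 \<le> \<sigma>" "\<sigma> \<le> 1" "2 \<le> t" "t \<le> real M" and s: "s = Complex \<sigma> t" for M \<sigma> t s
  proof -
    define X where "X = real (Suc M)"
    have X: "X \<ge> 1" "t + 1 \<le> X" using * by (simp_all add: X_def)
    have near: "\<bar>Re z - \<sigma>\<bar> \<le> r" "\<bar>Im z - t\<bar> \<le> r" if "norm (s - z) \<le> r" for z
      using abs_Re_le_cmod[of "s - z"] abs_Im_le_cmod[of "s - z"] that by (auto simp: s abs_minus_commute)
    have nz: "1 \<notin> ball s 1"
      using abs_Im_le_cmod[of "s - 1"] * by (auto simp: s dist_norm)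
    have hol: "zeta_tail M holomorphic_on ball s 1" by (rule zeta_tail_holomorphic[OF nz])
    have "(deriv ^^ j) (\<lambda>s. zeta s - (\<Sum>n<M. 1 / of_nat (Suc n) powr s)) s =
       (deriv ^^ j) zeta s - (deriv ^^ j) (\<lambda>s. \<Sum>n<M. 1 / of_nat (Suc n) powr s) s"
    proof (rule higher_deriv_diff[where S = "ball s 1"])
      show "zeta holomorphic_on ball s 1" using nz by (intro holomorphic_on_subset[OF zeta_holomorphic]) auto
    qed (rule dirichlet_sum_holomorphic, auto)
    hence eq: "(deriv ^^ j) zeta s - (\<Sum>n<M. of_real ((- ln (real (Suc n))) ^ j) / of_nat (Suc n) powr s) =
       (deriv ^^ j) (zeta_tail M) s"
      by (simp only: higher_deriv_dirichlet_sum zeta_tail_def [abs_def])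
    have "norm ((deriv ^^ j) (zeta_tail M) s) \<le> fact j * (C * X powr (1 - \<sigma> + r) * (2 ^ d * (1 / t + (t / X) ^ d))) / r ^ j"
    proof (rule Cauchy_inequality)
      show "zeta_tail M holomorphic_on ball s r" "continuous_on (cball s r) (zeta_tail M)"
        using r by (auto intro!: holomorphic_on_imp_continuous_on holomorphic_on_subset[OF hol])
      fix z assume "norm (s - z) = r"
      hence z: "\<bar>Re z - \<sigma>\<bar> \<le> r" "\<bar>Im z - t\<bar> \<le> r" using near by auto
      have Im: "t / 2 \<le> Im z" "Im z \<le> 2 * t" "1 \<le> Im z" "Im z \<le> X" using z r * X by (simp_all add: abs_if split: if_splits)
      have "norm (zeta_tail M z) \<le> C * X powr (1 - Re z) * (1 / Im z + (Im z / X) ^ d)"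
        using bound[of z M] z r * Im d by (simp add: X_def del: of_nat_Suc)
      also have "\<dots> \<le> C * X powr (1 - \<sigma> + r) * (2 ^ d * (1 / t + (t / X) ^ d))"
      proof (intro mult_mono powr_mono)
        have "1 / Im z \<le> 1 / (t / 2)" using Im * by (intro divide_left_mono) auto
        also have "\<dots> = 2 ^ 1 * (1 / t)" by simp
        also have "\<dots> \<le> 2 ^ d * (1 / t)" using d * by (intro mult_right_mono power_increasing) auto
        finally have "1 / Im z \<le> 2 ^ d * (1 / t)" .
        moreover have "(Im z / X) ^ d \<le> (2 * (t / X)) ^ d"
          using Im X by (intro power_mono) (auto simp: divide_right_mono)
        ultimately show "1 / Im z + (Im z / X) ^ d \<le> 2 ^ d * (1 / t + (t / X) ^ d)"
          by (simp only: power_mult_distrib distrib_left)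
      qed (use C X z Im in auto)
      finally show "norm (zeta_tail M z) \<le> C * X powr (1 - \<sigma> + r) * (2 ^ d * (1 / t + (t / X) ^ d))" .
    qed (use r in auto)
    thus ?thesis unfolding eq X_def by (simp add: mult_ac)
  qed
  thus ?thesis using C r by (intro exI[of _ "fact j * C * 2 ^ d / r ^ j"]) auto
qed

section \<open>Mertens' first theorem\<close>

lemma prod_primes_dvd:
  fixes A :: "nat set"
  assumes "finite A" "\<And>p. p \<in> A \<Longrightarrow> prime p" "\<And>p. p \<in> A \<Longrightarrow> p dvd m"
  shows "\<Prod>A dvd m"
  using assms
proof (induction A rule: finite_induct)
  case (insert p A)
  have "coprime p (\<Prod>A)"
    using insert by (intro prod_coprime_right) (metis insertI1 insertI2 primes_coprime)
  moreover have "p dvd m" "\<Prod>A dvd m" using insert by auto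
  ultimately show ?case using insert by (simp add: divides_mult)
qed auto

definition chebyshev_theta :: "nat \<Rightarrow> real" where
  "chebyshev_theta n = (\<Sum>p | prime p \<and> p \<le> n. ln (real p))"

lemma chebyshev_theta_mono: "m \<le> n \<Longrightarrow> chebyshev_theta m \<le> chebyshev_theta n"
  unfolding chebyshev_theta_def
  by (intro sum_mono2) (auto dest: prime_ge_1_nat)

text \<open>Chebyshev's argument: the primes in (n, 2n] divide the central binomial coefficient,
  which is at most 4^n.\<close>

lemma chebyshev_theta_double: "chebyshev_theta (2 * n) \<le> chebyshev_theta n + ln 4 * real n"
proof -
  let ?A = "{p. prime p \<and> n < p \<and> p \<le> 2 * n}"
  have "p dvd (2 * n choose n)" if "p \<in> ?A" for p
  proof -
    have "p dvd fact (2 * n)" using that by (simp add: prime_dvd_fact_iff)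
    moreover have "fact n * fact (2 * n - n) * (2 * n choose n) = fact (2 * n)"
      by (rule binomial_fact_lemma) simp
    ultimately have "p dvd fact n * fact n * (2 * n choose n)" by (simp add: mult_2)
    moreover have "\<not> p dvd fact n" using that by (simp add: prime_dvd_fact_iff)
    ultimately show ?thesis using that by (auto simp: prime_dvd_mult_iff)
  qed
  hence "\<Prod>?A dvd (2 * n choose n)" by (intro prod_primes_dvd) auto
  hence "\<Prod>?A \<le> (2 * n choose n)" by (intro dvd_imp_le) (simp_all add: zero_less_binomial)
  also have "\<dots> \<le> 2 ^ (2 * n)" by (rule binomial_le_pow2)
  finally have "real (\<Prod>?A) \<le> 4 ^ n" by (simp add: power_mult flip: of_nat_le_iff[where 'a=real])
  moreover have "real (\<Prod>?A) > 0" by (auto intro!: prod_pos prime_gt_0_nat)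
  ultimately have "ln (real (\<Prod>?A)) \<le> ln (4 ^ n)" by (subst ln_le_cancel_iff) auto
  also have "ln (real (\<Prod>?A)) = (\<Sum>p\<in>?A. ln (real p))"
    unfolding of_nat_prod by (subst ln_prod) (auto dest: prime_gt_0_nat)
  finally have le: "(\<Sum>p\<in>?A. ln (real p)) \<le> ln 4 * real n" by (simp add: ln_realpow mult.commute)
  have "{p. prime p \<and> p \<le> 2 * n} = {p. prime p \<and> p \<le> n} \<union> ?A" by auto
  hence "chebyshev_theta (2 * n) = chebyshev_theta n + (\<Sum>p\<in>?A. ln (real p))"
    unfolding chebyshev_theta_def by (simp only:) (rule sum.union_disjoint, auto)
  thus ?thesis using le by simp
qed

text \<open>An odd n = 2m + 1 is rounded up to 2 (m + 1) before it is halved. The factor 2 in the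
  constant pays for this rounding.\<close>

lemma chebyshev_theta_le: "chebyshev_theta n \<le> 2 * ln 4 * real n"
proof (induction n rule: less_induct)
  case (less n)
  consider "n = 0" | "n = 1" | m where "n = 2 * m" "m \<ge> 1" | m where "n = 2 * m + 1" "m \<ge> 1"
  proof (cases "even n")
    case True thus ?thesis using that(1,3) by (metis evenE less_one not_le mult_0_right)
  next
    case False thus ?thesis using that(2,4) by (metis oddE less_one not_le add_0 mult_0_right)
  qed
  thus ?case
  proof cases
    case 1 thus ?thesis by (simp add: chebyshev_theta_def)
  next
    case 2
    have "{p. prime p \<and> p \<le> Suc 0} = {}" by (auto dest: prime_gt_1_nat)
    thus ?thesis unfolding chebyshev_theta_def 2 One_nat_def by (simp only: sum.empty) simp
  next
    case 3
    have "chebyshev_theta n \<le> 2 * ln 4 * real m + ln 4 * real m"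
      unfolding 3(1) using chebyshev_theta_double[of m] less.IH[of m] 3 by linarith
    also have "\<dots> \<le> 2 * ln 4 * real n" using 3 by simp
    finally show ?thesis .
  next
    case 4
    have "chebyshev_theta n \<le> chebyshev_theta (2 * (m + 1))" using 4 by (intro chebyshev_theta_mono) simp
    also have "\<dots> \<le> 2 * ln 4 * real (m + 1) + ln 4 * real (m + 1)"
      using chebyshev_theta_double[of "m + 1"] less.IH[of "m + 1"] 4 by linarith
    also have "\<dots> = ln 4 * (3 * real m + 3)" by (simp add: algebra_simps)
    also have "\<dots> \<le> ln 4 * (2 * real n)" using 4 by (intro mult_left_mono) auto
    finally show ?thesis by simp
  qed
qed

text \<open>Legendre's formula: write each ln m as a divisor sum of \<open>mangoldt\<close>, then
  count the multiples of d up to n.\<close>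

lemma ln_fact_mangoldt: "ln (fact n :: real) = (\<Sum>d=1..n. mangoldt d * real (n div d))"
proof -
  have "ln (fact n :: real) = (\<Sum>m=1..n. ln (real m))"
    unfolding fact_prod of_nat_prod by (subst ln_prod) auto
  also have "\<dots> = (\<Sum>m=1..n. \<Sum>d | d dvd m. mangoldt d)"
    by (intro sum.cong refl) (simp add: mangoldt_sum)
  also have "\<dots> = (\<Sum>m=1..n. \<Sum>d | d \<in> {1..n} \<and> d dvd m. mangoldt d)"
    by (intro sum.cong refl) (auto dest: dvd_imp_le intro!: Nat.gr0I)
  also have "\<dots> = (\<Sum>d=1..n. \<Sum>m | m \<in> {1..n} \<and> d dvd m. mangoldt d)"
    by (rule sum.swap_restrict) auto
  also have "\<dots> = (\<Sum>d=1..n. mangoldt d * real (n div d))"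
  proof (intro sum.cong refl)
    fix d assume d: "d \<in> {1..n}"
    have "{m. m \<in> {1..n} \<and> d dvd m} = (\<lambda>k. d * k) ` {1..n div d}"
    proof safe
      fix m assume "m \<in> {1..n}" "d dvd m"
      then obtain k where "m = d * k" by auto
      with \<open>m \<in> {1..n}\<close> d have "k \<in> {1..n div d}"
        by (auto simp: less_eq_div_iff_mult_less_eq mult.commute intro!: Suc_leI Nat.gr0I)
      thus "m \<in> (*) d ` {1..n div d}" using \<open>m = d * k\<close> by blast
    next
      fix k assume "k \<in> {1..n div d}"
      thus "d * k \<in> {1..n}" using d
        by (auto simp: less_eq_div_iff_mult_less_eq mult.commute)
    qed auto
    moreover have "inj_on ((*) d) {1..n div d}" using d by (auto intro!: inj_onI)
    ultimately have "card {m. m \<in> {1..n} \<and> d dvd m} = n div d" by (simp add: card_image)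
    thus "(\<Sum>m | m \<in> {1..n} \<and> d dvd m. mangoldt d) = mangoldt d * real (n div d)" by simp
  qed
  finally show ?thesis .
qed

text \<open>Upper half of Mertens' theorem. Legendre's formula is restricted to primes, removing the
  floors costs \<open>chebyshev_theta n\<close>, and n! <= n^n.\<close>

lemma sum_ln_prime_le:
  assumes "n \<ge> 1"
  shows "(\<Sum>p | prime p \<and> p \<le> n. ln (real p) / real p) \<le> ln (real n) + 2 * ln 4"
proof -
  let ?P = "{p. prime p \<and> p \<le> n}"
  have sub: "?P \<subseteq> {1..n}" by (auto dest: prime_ge_1_nat)
  have "real n * (\<Sum>p\<in>?P. ln (real p) / real p) - chebyshev_theta n =
     (\<Sum>p\<in>?P. ln (real p) * (real n / real p - 1))"
    by (simp add: chebyshev_theta_def sum_distrib_left algebra_simps sum_subtractf)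
  also have "\<dots> \<le> (\<Sum>p\<in>?P. mangoldt p * real (n div p))"
  proof (rule sum_mono)
    fix p assume p: "p \<in> ?P"
    have "n \<le> (n div p) * p + p"
      using p prime_gt_0_nat[of p] by (metis add_le_cancel_left div_mult_mod_eq less_imp_le mem_Collect_eq mod_less_divisor)
    hence "real n \<le> real (n div p * p + p)" by (simp only: of_nat_le_iff)
    hence "real n \<le> (real (n div p) + 1) * real p" by (simp add: distrib_right)
    hence "real n / real p - 1 \<le> real (n div p)"
      using p prime_gt_0_nat[of p] by (simp add: field_simps)
    moreover have "ln (real p) \<ge> 0" using p prime_ge_1_nat[of p] by simp
    ultimately show "ln (real p) * (real n / real p - 1) \<le> mangoldt p * real (n div p)"
      using p by (simp add: mult_left_mono)
  qed
  also have "\<dots> \<le> (\<Sum>d=1..n. mangoldt d * real (n div d))"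
    using sub by (intro sum_mono2) (auto intro!: mult_nonneg_nonneg mangoldt_nonneg)
  also have "\<dots> = ln (fact n)" by (simp add: ln_fact_mangoldt)
  also have "\<dots> \<le> ln (real n ^ n)"
    using assms fact_le_power[of n, where 'a=real] by (subst ln_le_cancel_iff) auto
  also have "\<dots> = real n * ln (real n)" using assms by (simp add: ln_realpow)
  finally have "real n * (\<Sum>p\<in>?P. ln (real p) / real p) \<le> real n * (ln (real n) + 2 * ln 4)"
    using chebyshev_theta_le[of n] by (simp add: algebra_simps)
  thus ?thesis using assms by simp
qed

text \<open>ln p / (p (p - 1)) is the sum of ln p / p^k over k >= 2, that is, the share of the
  proper prime powers in \<open>sum_ln_prime_ge\<close>.\<close>

lemma sum_ln_over_prime_products_bounded:
  "\<exists>C. \<forall>n. (\<Sum>p | prime p \<and> p \<le> n. ln (real p) / (real p * (real p - 1))) \<le> C"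
proof -
  have summ: "summable (\<lambda>m. ln (real m) / (real m * (real m - 1)))"
  proof (rule summable_comparison_test_bigo)
    show "summable (\<lambda>m. norm (real m powr (-3/2)))"
      by (simp add: summable_real_powr_iff)
    show "(\<lambda>m. ln (real m) / (real m * (real m - 1))) \<in> O(\<lambda>m. real m powr (-3/2))"
      by real_asymp
  qed
  have nonneg: "ln (real m) / (real m * (real m - 1)) \<ge> 0" for m :: nat
    by (cases m; cases "m - 1") auto
  have "(\<Sum>p | prime p \<and> p \<le> n. ln (real p) / (real p * (real p - 1)))
     \<le> (\<Sum>m. ln (real m) / (real m * (real m - 1)))" for n
    by (rule sum_le_suminf[OF summ]) (use nonneg in auto)
  thus ?thesis by blast
qed

text \<open>Lower half of Mertens' theorem. Here the floors in Legendre's formula may simply be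
  dropped, n! >= (n / e)^n, and the proper prime powers contribute a bounded amount.\<close>

lemma sum_ln_prime_ge:
  "\<exists>C. \<forall>n\<ge>1. (\<Sum>p | prime p \<and> p \<le> n. ln (real p) / real p) \<ge> ln (real n) - C"
proof -
  obtain C where C: "\<And>n. (\<Sum>p | prime p \<and> p \<le> n. ln (real p) / (real p * (real p - 1))) \<le> C"
    using sum_ln_over_prime_products_bounded by blast
  have "(\<Sum>p | prime p \<and> p \<le> n. ln (real p) / real p) \<ge> ln (real n) - (C + 1)" if n: "n \<ge> 1" for n
  proof -
    let ?P = "{p. prime p \<and> p \<le> n}"
    have fin: "finite ?P" by simp
    have "real n ^ n / fact n \<le> exp (real n)"
    proof -
      have "(\<Sum>k\<in>{n}. real n ^ k /\<^sub>R fact k) \<le> (\<Sum>k. real n ^ k /\<^sub>R fact k)"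
        by (rule sum_le_suminf[OF summable_exp_generic]) auto
      thus ?thesis by (simp add: exp_def field_simps)
    qed
    hence "ln (real n ^ n / fact n) \<le> ln (exp (real n))" using n by (subst ln_le_cancel_iff) auto
    hence "real n * ln (real n) - real n \<le> ln (fact n)"
      using n by (simp add: ln_div ln_realpow)
    also have "\<dots> = (\<Sum>d=1..n. mangoldt d * real (n div d))" by (rule ln_fact_mangoldt)
    also have "\<dots> \<le> (\<Sum>d=1..n. mangoldt d * (real n / real d))"
      by (intro sum_mono mult_left_mono mangoldt_nonneg of_nat_div_le_of_nat)
    also have "\<dots> = real n * (\<Sum>d=1..n. mangoldt d / real d)"
      by (simp add: sum_distrib_left mult_ac)
    finally have "real n * (ln (real n) - 1) \<le> real n * (\<Sum>d=1..n. mangoldt d / real d)"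
      by (simp add: algebra_simps)
    hence "ln (real n) - 1 \<le> (\<Sum>d=1..n. mangoldt d / real d)" using n by simp
    also have "\<dots> = (\<Sum>d\<in>{d\<in>{1..n}. primepow d}. mangoldt d / real d)"
      by (rule sum.mono_neutral_right) (auto simp: mangoldt_def)
    also have "\<dots> \<le> (\<Sum>(p,k)\<in>?P \<times> {1..n}. ln (real p) / real p ^ k)"
    proof (rule sum_le_included[where i = "\<lambda>(p,k). p ^ k"])
      show "\<forall>y\<in>?P \<times> {1..n}. 0 \<le> (case y of (p, k) \<Rightarrow> ln (real p) / real p ^ k)"
        by (auto dest: prime_ge_1_nat)
      show "\<forall>d\<in>{d\<in>{1..n}. primepow d}. \<exists>y\<in>?P \<times> {1..n}. (case y of (p, k) \<Rightarrow> p ^ k) = d \<and>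
          mangoldt d / real d \<le> (case y of (p, k) \<Rightarrow> ln (real p) / real p ^ k)"
      proof
        fix d assume d: "d \<in> {d\<in>{1..n}. primepow d}"
        then obtain p k where pk: "prime p" "k > 0" "d = p ^ k" by (auto simp: primepow_def)
        have "p \<le> d" using pk prime_ge_1_nat[of p] self_le_power[of p k] by simp
        moreover have "k < d"
        proof -
          have "k < 2 ^ k" by (rule less_exp)
          also have "\<dots> \<le> p ^ k" using pk prime_ge_2_nat[of p] by (intro power_mono) auto
          finally show ?thesis using pk by simp
        qed
        ultimately show "\<exists>y\<in>?P \<times> {1..n}. (case y of (p, k) \<Rightarrow> p ^ k) = d \<and>
          mangoldt d / real d \<le> (case y of (p, k) \<Rightarrow> ln (real p) / real p ^ k)"
          using pk d by (intro bexI[of _ "(p, k)"]) auto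
      qed
    qed auto
    also have "\<dots> = (\<Sum>p\<in>?P. \<Sum>k=1..n. ln (real p) / real p ^ k)"
      by (simp add: sum.cartesian_product)
    also have "\<dots> \<le> (\<Sum>p\<in>?P. ln (real p) / (real p - 1))"
    proof (rule sum_mono)
      fix p assume p: "p \<in> ?P"
      hence p1: "real p > 1" using prime_gt_1_nat by auto
      have "(\<Sum>k=1..n. (1 / real p) ^ k) = (1 / real p) * (\<Sum>k<n. (1 / real p) ^ k)"
        by (simp add: sum.atLeast1_atMost_eq sum_distrib_left)
      also have "\<dots> \<le> (1 / real p) * (1 / (1 - 1 / real p))"
        using p1 by (intro mult_left_mono) (simp_all add: sum_gp_strict divide_right_mono)
      also have "\<dots> = 1 / (real p - 1)" using p1 by (simp add: field_simps)
      finally have "ln (real p) * (\<Sum>k=1..n. (1 / real p) ^ k) \<le> ln (real p) * (1 / (real p - 1))"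
        using p1 by (intro mult_left_mono) auto
      thus "(\<Sum>k=1..n. ln (real p) / real p ^ k) \<le> ln (real p) / (real p - 1)"
        by (simp add: sum_distrib_left power_divide)
    qed
    also have "\<dots> = (\<Sum>p\<in>?P. ln (real p) / real p + ln (real p) / (real p * (real p - 1)))"
    proof (rule sum.cong[OF refl])
      fix p assume "p \<in> ?P"
      hence "real p > 1" using prime_gt_1_nat by auto
      thus "ln (real p) / (real p - 1) = ln (real p) / real p + ln (real p) / (real p * (real p - 1))"
        by (simp add: divide_simps) (simp add: algebra_simps)
    qed
    also have "\<dots> \<le> (\<Sum>p\<in>?P. ln (real p) / real p) + C"
      using C[of n] by (simp add: sum.distrib)
    finally show ?thesis by simp
  qed
  thus ?thesis by blast
qed

lemma sum_ln_prime_interval_ge: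
  obtains C where "C \<ge> 0" and "\<And>x y. 1 \<le> y \<Longrightarrow> y \<le> x \<Longrightarrow>
    (\<Sum>p | prime p \<and> y < real p \<and> real p \<le> x. ln (real p) / real p) \<ge> ln x - ln y - C"
proof -
  obtain C where C: "\<And>n. n \<ge> 1 \<Longrightarrow> (\<Sum>p | prime p \<and> p \<le> n. ln (real p) / real p) \<ge> ln (real n) - C"
    using sum_ln_prime_ge by blast
  \<comment> \<open>In the constant, ln 2 stems from x <= 2 floor x and 2 ln 4 from
    \<open>sum_ln_prime_le\<close>.\<close>
  have "(\<Sum>p | prime p \<and> y < real p \<and> real p \<le> x. ln (real p) / real p)
      \<ge> ln x - ln y - max 0 (C + ln 2 + 2 * ln 4)" if "1 \<le> y" "y \<le> x" for x y :: real
  proof -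
    define m n where "m = nat \<lfloor>y\<rfloor>" and "n = nat \<lfloor>x\<rfloor>"
    have mn: "1 \<le> m" "m \<le> n" "real m \<le> y" "x \<le> 2 * real n"
    proof -
      have "\<lfloor>y\<rfloor> \<ge> 1" "\<lfloor>y\<rfloor> \<le> \<lfloor>x\<rfloor>" using that by (simp_all add: floor_mono)
      moreover have "x < real_of_int \<lfloor>x\<rfloor> + 1" by linarith
      ultimately show "1 \<le> m" "m \<le> n" "real m \<le> y" "x \<le> 2 * real n"
        unfolding m_def n_def by (simp_all, linarith+)
    qed
    have le_n: "real p \<le> x \<longleftrightarrow> p \<le> n" for p unfolding n_def using that by (simp add: le_nat_iff le_floor_iff)
    have le_m: "real p \<le> y \<longleftrightarrow> p \<le> m" for p unfolding m_def using that by (simp add: le_nat_iff le_floor_iff)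
    have eq: "{p. prime p \<and> y < real p \<and> real p \<le> x} = {p. prime p \<and> p \<le> n} - {p. prime p \<and> p \<le> m}"
      using le_n le_m by (auto simp flip: not_le)
    have "(\<Sum>p | prime p \<and> y < real p \<and> real p \<le> x. ln (real p) / real p) =
       (\<Sum>p | prime p \<and> p \<le> n. ln (real p) / real p) - (\<Sum>p | prime p \<and> p \<le> m. ln (real p) / real p)"
      unfolding eq using mn by (intro sum_diff) auto
    moreover have "ln x \<le> ln 2 + ln (real n)"
      using that mn by (subst ln_mult_pos [symmetric]) auto
    moreover have "ln (real m) \<le> ln y" using mn by simp
    ultimately show ?thesis using C[of n] sum_ln_prime_le[of m] mn by linarith
  qed
  thus ?thesis by (intro that[of "max 0 (C + ln 2 + 2 * ln 4)"]) auto
qed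

section \<open>Resonators on a grid\<close>

definition unit_exp :: "real \<Rightarrow> complex" where
  "unit_exp x = cis (2 * pi * x)"

lemma unit_exp_add: "unit_exp (x + y) = unit_exp x * unit_exp y"
  and unit_exp_minus: "unit_exp (- x) = cnj (unit_exp x)"
  and unit_exp_0 [simp]: "unit_exp 0 = 1"
  and norm_unit_exp [simp]: "norm (unit_exp x) = 1"
  by (simp_all add: unit_exp_def cis_mult distrib_left cis_cnj)

lemma unit_exp_mult_nat: "unit_exp (real n * x) = unit_exp x ^ n"
  unfolding unit_exp_def Complex.DeMoivre by (simp add: mult_ac)

lemma unit_exp_int [simp]: "unit_exp (of_int n) = 1"
  unfolding unit_exp_def by (auto simp: complex_eq_iff)

lemma unit_exp_diff: "unit_exp (x - y) = unit_exp x * cnj (unit_exp y)"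
  using unit_exp_add[of x "- y"] by (simp add: unit_exp_minus)

lemma unit_exp_neq_1:
  assumes "0 < \<bar>x\<bar>" "\<bar>x\<bar> < 1"
  shows "unit_exp x \<noteq> 1"
proof
  assume "unit_exp x = 1"
  hence "cos (2 * pi * x) = 1" by (simp add: unit_exp_def complex_eq_iff)
  then obtain n :: int where "2 * pi * x = of_int n * 2 * pi" by (auto simp: cos_one_2pi_int)
  hence "x = of_int n" by simp
  thus False using assms by (cases "n = 0") auto
qed

lemma unit_exp_orthogonality:
  assumes "x < Q" "y < Q"
  shows "(\<Sum>l<Q. unit_exp (real l * ((real x - real y) / real Q))) = (if x = y then of_nat Q else 0)"
proof (cases "x = y")
  case False
  let ?t = "(real x - real y) / real Q"
  have ne: "unit_exp ?t \<noteq> 1"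
    using assms False by (intro unit_exp_neq_1) (auto simp: field_simps abs_if)
  have "real Q * ?t = of_int (int x - int y)" using assms by simp
  hence "unit_exp ?t ^ Q = unit_exp (of_int (int x - int y))"
    by (simp only: flip: unit_exp_mult_nat)
  hence "unit_exp ?t ^ Q = 1" by (simp only: unit_exp_int)
  moreover have "(\<Sum>l<Q. unit_exp (real l * ?t)) = (\<Sum>l<Q. unit_exp ?t ^ l)"
    by (simp only: unit_exp_mult_nat)
  ultimately show ?thesis using ne False by (simp only: sum_gp_strict) simp
qed simp

lemma discrete_parseval:
  fixes r :: "nat \<Rightarrow> complex"
  shows "(\<Sum>l<Q. (norm (\<Sum>x<Q. r x * unit_exp (real l * (real x / real Q))))\<^sup>2) = real Q * (\<Sum>x<Q. (norm (r x))\<^sup>2)"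
proof -
  let ?e = "\<lambda>l x. unit_exp (real l * (real x / real Q))"
  have "complex_of_real (\<Sum>l<Q. (norm (\<Sum>x<Q. r x * ?e l x))\<^sup>2) =
    (\<Sum>l<Q. \<Sum>x<Q. \<Sum>y<Q. r x * cnj (r y) * (?e l x * cnj (?e l y)))"
    by (simp only: of_real_sum complex_norm_square cnj_sum sum_product complex_cnj_mult mult_ac)
  also have "\<dots> = (\<Sum>x<Q. \<Sum>y<Q. \<Sum>l<Q. r x * cnj (r y) * (?e l x * cnj (?e l y)))"
    by (subst sum.swap) (intro sum.cong refl sum.swap)
  also have "\<dots> = (\<Sum>x<Q. \<Sum>y<Q. r x * cnj (r y) * (\<Sum>l<Q. unit_exp (real l * ((real x - real y) / real Q))))"
    by (simp add: sum_distrib_left diff_divide_distrib right_diff_distrib flip: unit_exp_diff)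
  also have "\<dots> = (\<Sum>x<Q. \<Sum>y<Q. if x = y then of_nat Q * (r x * cnj (r x)) else 0)"
    by (intro sum.cong refl, subst unit_exp_orthogonality) auto
  also have "\<dots> = complex_of_real (real Q * (\<Sum>x<Q. (norm (r x))\<^sup>2))"
    by (simp add: complex_norm_square sum_distrib_left del: of_real_power)
  finally show ?thesis by (simp only: of_real_eq_iff)
qed

text \<open>H times the Fejer kernel. Writing it as a sum over differences a - b, as in
  \<open>dirichlet_sq_expand\<close>, stands in for the explicit weights H - |l|.\<close>

definition dirichlet_sq :: "nat \<Rightarrow> real \<Rightarrow> real" where
  "dirichlet_sq H x = (norm (\<Sum>a<H. unit_exp (real a * x)))\<^sup>2"

lemma dirichlet_sq_expand:
  "(\<Sum>a<H. \<Sum>b<H. unit_exp ((real a - real b) * x)) = of_real (dirichlet_sq H x)"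
  unfolding dirichlet_sq_def complex_norm_square cnj_sum sum_product
  by (simp add: left_diff_distrib unit_exp_diff)

text \<open>For every a < H the number a x is within 1/8, hence within 1/6, of an integer. So each
  summand has real part at least cos (pi / 3) = 1/2 and no cancellation occurs.\<close>

lemma dirichlet_sq_ge:
  assumes "\<bar>x - of_int n\<bar> \<le> 1 / (8 * real H)"
  shows "dirichlet_sq H x \<ge> (real H)\<^sup>2 / 4"
proof -
  define d where "d = x - of_int n"
  have "unit_exp (real a * x) = unit_exp (real a * d)" for a
  proof -
    have "real a * x = real a * d + of_int (int a * n)" by (simp add: d_def algebra_simps)
    thus ?thesis by (simp only: unit_exp_add unit_exp_int mult_1_right)
  qed
  moreover have "Re (unit_exp (real a * d)) \<ge> 1 / 2" if "a < H" for a
  proof -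
    have "\<bar>real a * d\<bar> \<le> real H * (1 / (8 * real H))"
      unfolding abs_mult using that assms by (intro mult_mono) (auto simp: d_def)
    hence "\<bar>real a * d\<bar> \<le> 1 / 6" using that by simp
    hence "2 * pi * \<bar>real a * d\<bar> \<le> 2 * pi * (1 / 6)" by (intro mult_left_mono) auto
    hence "cos \<bar>2 * pi * (real a * d)\<bar> \<ge> cos (pi / 3)"
      by (subst cos_mono_le_eq) (auto simp: abs_mult)
    thus ?thesis by (simp add: unit_exp_def cos_60)
  qed
  ultimately have "Re (\<Sum>a<H. unit_exp (real a * x)) \<ge> (\<Sum>a<H. 1 / 2)"
    unfolding Re_sum by (intro sum_mono) simp
  hence "real H / 2 \<le> norm (\<Sum>a<H. unit_exp (real a * x))"
    using complex_Re_le_cmod[of "\<Sum>a<H. unit_exp (real a * x)"] by simp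
  hence "(real H / 2)\<^sup>2 \<le> dirichlet_sq H x" unfolding dirichlet_sq_def by (intro power_mono) auto
  thus ?thesis by (simp add: power_divide)
qed

section \<open>Rounding of the frequencies and the rounded resonators\<close>

definition bin :: "nat \<Rightarrow> real \<Rightarrow> nat" where
  "bin Q x = nat \<lfloor>real Q * frac x\<rfloor>"

lemma bin_less: "Q > 0 \<Longrightarrow> bin Q x < Q"
proof -
  assume "Q > 0"
  hence "real Q * frac x < real Q * 1" by (intro mult_strict_left_mono frac_lt_1) auto
  moreover have "real Q * frac x \<ge> 0" by (simp add: frac_ge_0)
  ultimately show ?thesis unfolding bin_def by (simp add: floor_less_iff nat_less_iff)
qed

lemma bin_approx:
  assumes "Q > 0"
  shows "real (bin Q x) / real Q \<le> frac x" "frac x < real (bin Q x) / real Q + 1 / real Q"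
proof -
  have "real Q * frac x \<ge> 0" by (simp add: frac_ge_0)
  hence "real (bin Q x) = of_int \<lfloor>real Q * frac x\<rfloor>" unfolding bin_def by simp
  hence "real (bin Q x) \<le> real Q * frac x" "real Q * frac x < real (bin Q x) + 1" by linarith+
  thus "real (bin Q x) / real Q \<le> frac x" "frac x < real (bin Q x) / real Q + 1 / real Q"
    using assms by (simp_all add: field_simps)
qed

definition bin_count :: "nat \<Rightarrow> ('a \<Rightarrow> real) \<Rightarrow> 'a set \<Rightarrow> nat \<Rightarrow> nat" where
  "bin_count Q \<phi> U x = card {u\<in>U. bin Q (\<phi> u) = x}"

text \<open>With square roots as coefficients, the squared coefficients that Parseval's identity
  produces are the bin counts, and these add up to \<open>card U\<close>.\<close>

definition resonator :: "nat \<Rightarrow> ('a \<Rightarrow> real) \<Rightarrow> 'a set \<Rightarrow> real \<Rightarrow> complex" where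
  "resonator Q \<phi> U l = (\<Sum>x<Q. of_real (sqrt (real (bin_count Q \<phi> U x))) * unit_exp (l * (real x / real Q)))"

lemma sum_bin_count:
  assumes "finite U" "Q > 0"
  shows "(\<Sum>x<Q. real (bin_count Q \<phi> U x)) = real (card U)"
proof -
  have "card U = (\<Sum>x<Q. card {u\<in>U. bin Q (\<phi> u) = x})"
    using assms bin_less by (subst card_UN_disjoint [symmetric]) (auto intro!: arg_cong[where f = card])
  thus ?thesis by (simp add: bin_count_def)
qed

text \<open>The pointwise bound that will multiply \<open>err\<close>. It rests on sqrt n <= n for
  natural n.\<close>

lemma norm_resonator_le:
  assumes "finite U" "Q > 0"
  shows "norm (resonator Q \<phi> U l) \<le> real (card U)"
proof -
  have "norm (resonator Q \<phi> U l) \<le> (\<Sum>x<Q. sqrt (real (bin_count Q \<phi> U x)))"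
    unfolding resonator_def by (rule sum_norm_le) (simp add: norm_mult)
  also have "\<dots> \<le> (\<Sum>x<Q. real (bin_count Q \<phi> U x))"
  proof (rule sum_mono)
    fix x
    have "real n \<le> (real n)\<^sup>2" for n by (cases n) (auto simp: power2_eq_square algebra_simps)
    thus "sqrt (real (bin_count Q \<phi> U x)) \<le> real (bin_count Q \<phi> U x)"
      by (intro real_le_lsqrt) auto
  qed
  finally show ?thesis using sum_bin_count[OF assms] by simp
qed

text \<open>The range of l is enlarged to the full period of 8H consecutive integers that starts at
  -H, where Parseval's identity is exact. The shift by H only changes the phases of the
  coefficients, and the enlargement costs a constant factor.\<close>

lemma resonator_mean_square:
  assumes "finite U" "H > 0"
  shows "(\<Sum>l\<in>{- int H<..<int H}. (norm (resonator (8 * H) \<phi> U (of_int l)))\<^sup>2) \<le> 8 * real H * real (card U)"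
proof -
  define Q where "Q = 8 * H"
  have Q: "Q > 0" using assms by (simp add: Q_def)
  define r where "r x = of_real (sqrt (real (bin_count Q \<phi> U x))) * unit_exp (- real H * (real x / real Q))" for x
  have eq: "resonator Q \<phi> U (real l - real H) = (\<Sum>x<Q. r x * unit_exp (real l * (real x / real Q)))" for l
    unfolding resonator_def r_def
    by (intro sum.cong refl) (simp add: algebra_simps diff_divide_distrib flip: unit_exp_add)
  have "(\<Sum>l\<in>{- int H<..<int H}. (norm (resonator Q \<phi> U (of_int l)))\<^sup>2)
     \<le> (\<Sum>l<Q. (norm (resonator Q \<phi> U (real l - real H)))\<^sup>2)"
  proof (rule sum_le_included[where i = "\<lambda>l. int l - int H"])
    show "\<forall>x\<in>{- int H<..<int H}. \<exists>y\<in>{..<Q}. int y - int H = x \<and>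
        (norm (resonator Q \<phi> U (of_int x)))\<^sup>2 \<le> (norm (resonator Q \<phi> U (real y - real H)))\<^sup>2"
    proof
      fix x assume "x \<in> {- int H<..<int H}"
      thus "\<exists>y\<in>{..<Q}. int y - int H = x \<and>
        (norm (resonator Q \<phi> U (of_int x)))\<^sup>2 \<le> (norm (resonator Q \<phi> U (real y - real H)))\<^sup>2"
        by (intro bexI[of _ "nat (x + int H)"]) (auto simp: Q_def nat_less_iff)
    qed
  qed auto
  also have "\<dots> = real Q * (\<Sum>x<Q. (norm (r x))\<^sup>2)"
    unfolding eq by (rule discrete_parseval)
  also have "(\<Sum>x<Q. (norm (r x))\<^sup>2) = real (card U)"
    unfolding r_def using sum_bin_count[OF assms(1) Q, of \<phi>] by (simp add: norm_mult)
  finally show ?thesis by (simp add: Q_def)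
qed

section \<open>The resonance inequality\<close>

lemma sum_differences_le:
  fixes g :: "int \<Rightarrow> real"
  assumes "\<And>l. g l \<ge> 0"
  shows "(\<Sum>a<H. \<Sum>b<H. g (int a - int b)) \<le> real H * (\<Sum>l\<in>{- int H<..<int H}. g l)"
proof -
  have "(\<Sum>b<H. g (int a - int b)) \<le> (\<Sum>l\<in>{- int H<..<int H}. g l)" if "a < H" for a
  proof -
    have "(\<Sum>b<H. g (int a - int b)) = (\<Sum>l\<in>(\<lambda>b. int a - int b) ` {..<H}. g l)"
      by (subst sum.reindex) (auto intro!: inj_onI)
    also have "\<dots> \<le> (\<Sum>l\<in>{- int H<..<int H}. g l)"
      using that assms by (intro sum_mono2) auto
    finally show ?thesis .
  qed
  hence "(\<Sum>a<H. \<Sum>b<H. g (int a - int b)) \<le> (\<Sum>a<H. \<Sum>l\<in>{- int H<..<int H}. g l)"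
    by (intro sum_mono) auto
  thus ?thesis by simp
qed

text \<open>
  A pair of bins contains at most \<open>min a b \<le> \<surd>(a b)\<close> pairs of \<open>E\<close>, because each pair is determined
  by either component; this is why the resonator weights are the square roots of the bin counts.
\<close>
lemma card_le_sum_sqrt_bin_counts:
  assumes "finite U0" "finite U1" "E \<subseteq> U0 \<times> U1" "inj_on fst E" "inj_on snd E"
  shows "real (card E) \<le> (\<Sum>(x,y)\<in>(\<lambda>(u,v). (bin Q (\<phi>0 u), bin Q (\<phi>1 v))) ` E.
           sqrt (real (bin_count Q \<phi>0 U0 x)) * sqrt (real (bin_count Q \<phi>1 U1 y)))"
proof -
  let ?f = "\<lambda>(u,v). (bin Q (\<phi>0 u), bin Q (\<phi>1 v))"
  have fin: "finite E" using assms(1-3) by (meson finite_SigmaI finite_subset)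
  have "card E = (\<Sum>z\<in>?f ` E. card {e\<in>E. ?f e = z})"
    using fin by (subst card_UN_disjoint [symmetric]) (auto intro!: arg_cong[where f = card])
  also have "real \<dots> \<le> (\<Sum>(x,y)\<in>?f ` E.
           sqrt (real (bin_count Q \<phi>0 U0 x)) * sqrt (real (bin_count Q \<phi>1 U1 y)))"
    unfolding of_nat_sum
  proof (rule sum_mono, clarify)
    fix x y
    let ?F = "{e\<in>E. ?f e = (x, y)}"
    have "card ?F \<le> bin_count Q \<phi>0 U0 x"
      unfolding bin_count_def using assms
      by (intro card_inj_on_le[where f = fst]) (auto intro: inj_on_subset)
    moreover have "card ?F \<le> bin_count Q \<phi>1 U1 y"
      unfolding bin_count_def using assms
      by (intro card_inj_on_le[where f = snd]) (auto intro: inj_on_subset)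
    ultimately have "sqrt (real (card ?F)) * sqrt (real (card ?F)) \<le>
      sqrt (real (bin_count Q \<phi>0 U0 x)) * sqrt (real (bin_count Q \<phi>1 U1 y))"
      by (intro mult_mono) auto
    thus "real (card ?F) \<le> sqrt (real (bin_count Q \<phi>0 U0 x)) * sqrt (real (bin_count Q \<phi>1 U1 y))"
      by simp
  qed
  finally show ?thesis .
qed

lemma sum_product3:
  fixes A :: "'k \<Rightarrow> 'c :: comm_semiring_0"
  shows "(\<Sum>k\<in>K. A k) * (\<Sum>x\<in>X. B x) * (\<Sum>y\<in>Y. C y) = (\<Sum>k\<in>K. \<Sum>x\<in>X. \<Sum>y\<in>Y. A k * B x * C y)"
proof -
  have "(\<Sum>k\<in>K. A k) * (\<Sum>x\<in>X. B x) * (\<Sum>y\<in>Y. C y) =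
      (\<Sum>k\<in>K. (\<Sum>x\<in>X. A k * B x) * (\<Sum>y\<in>Y. C y))"
    unfolding sum_product[of A K B X] by (rule sum_distrib_right)
  also have "\<dots> = (\<Sum>k\<in>K. \<Sum>x\<in>X. \<Sum>y\<in>Y. A k * B x * C y)"
    by (intro sum.cong refl sum_product)
  finally show ?thesis .
qed

lemma sum_swap2:
  "(\<Sum>a\<in>A. \<Sum>b\<in>B. \<Sum>k\<in>K. f a b k) = (\<Sum>k\<in>K. \<Sum>a\<in>A. \<Sum>b\<in>B. f a b k)"
proof -
  have "(\<Sum>a\<in>A. \<Sum>b\<in>B. \<Sum>k\<in>K. f a b k) = (\<Sum>a\<in>A. \<Sum>k\<in>K. \<Sum>b\<in>B. f a b k)"
    by (intro sum.cong refl sum.swap)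
  also have "\<dots> = (\<Sum>k\<in>K. \<Sum>a\<in>A. \<Sum>b\<in>B. f a b k)" by (rule sum.swap)
  finally show ?thesis .
qed

text \<open>Two estimates of the Fejer-weighted sum \<open>S\<close>. From below: all terms of its
  expansion are nonnegative, and a pair in \<open>E k\<close> yields a phase so close to an integer
  that the kernel is at least H^2 / 4. From above: the part \<open>V\<close> is treated by
  Cauchy-Schwarz and the mean squares, the part \<open>err\<close> by the trivial bound
  \<open>card U * card W\<close>. One factor H cancels.\<close>

proposition resonance_inequality:
  fixes a \<omega> :: "'k \<Rightarrow> real" and \<phi> :: "'a \<Rightarrow> real" and \<psi> :: "'b \<Rightarrow> real" and err :: "nat \<Rightarrow> real"
  assumes fin: "finite K" "finite U" "finite W" and H: "H > 0"
    and a: "\<And>k. k \<in> K \<Longrightarrow> a k \<ge> 0"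
    and E: "\<And>k. k \<in> K \<Longrightarrow> E k \<subseteq> U \<times> W" "\<And>k. k \<in> K \<Longrightarrow> inj_on fst (E k)"
      "\<And>k. k \<in> K \<Longrightarrow> inj_on snd (E k)"
    and phase: "\<And>k u v. k \<in> K \<Longrightarrow> (u, v) \<in> E k \<Longrightarrow> \<psi> v = \<phi> u + \<omega> k"
    and V: "V \<ge> 0" and err: "\<And>l. err l \<ge> 0"
    and bound: "\<And>l. l < H \<Longrightarrow> norm (\<Sum>k\<in>K. of_real (a k) * unit_exp (real l * \<omega> k)) \<le> V + err l"
  shows "real H / 4 * (\<Sum>k\<in>K. a k * real (card (E k))) \<le>
     8 * real H * V * sqrt (real (card U) * real (card W))
       + 2 * real (card U) * real (card W) * (\<Sum>l<H. err l)"
proof -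
  define Q where "Q = 8 * H"
  have Q: "Q > 0" using H by (simp add: Q_def)
  define c0 where "c0 = bin_count Q \<phi> U"
  define c1 where "c1 = bin_count Q \<psi> W"
  define R0 where "R0 = (\<lambda>l::int. resonator Q \<phi> U (of_int l))"
  define R1 where "R1 = (\<lambda>l::int. resonator Q \<psi> W (of_int l))"
  define P where "P = (\<lambda>l::int. \<Sum>k\<in>K. of_real (a k) * unit_exp (of_int l * \<omega> k))"
  define S where "S = (\<Sum>a<H. \<Sum>b<H. P (int a - int b) * R0 (int a - int b) * cnj (R1 (int a - int b)))"
  let ?w = "\<lambda>k x y. a k * (sqrt (real (c0 x)) * sqrt (real (c1 y)))"
  let ?\<theta> = "\<lambda>k x y. \<omega> k + real x / real Q - real y / real Q"
  have prod: "P l * R0 l * cnj (R1 l) = (\<Sum>k\<in>K. \<Sum>x<Q. \<Sum>y<Q. of_real (?w k x y) * unit_exp (of_int l * ?\<theta> k x y))" for l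
    unfolding P_def R0_def R1_def resonator_def c0_def [symmetric] c1_def [symmetric] cnj_sum sum_product3
    by (intro sum.cong refl)
       (simp add: unit_exp_add unit_exp_diff distrib_left right_diff_distrib mult_ac)
  have "S = (\<Sum>k\<in>K. \<Sum>x<Q. \<Sum>y<Q. of_real (?w k x y) * (\<Sum>a<H. \<Sum>b<H. unit_exp ((real a - real b) * ?\<theta> k x y)))"
    unfolding S_def prod sum_distrib_left sum_swap2[of _ K] sum_swap2[of _ "{..<Q}" "{..<H}" "{..<H}"] by simp
  hence S: "S = of_real (\<Sum>k\<in>K. \<Sum>x<Q. \<Sum>y<Q. ?w k x y * dirichlet_sq H (?\<theta> k x y))"
    by (simp add: dirichlet_sq_expand)
  have "(real H)\<^sup>2 / 4 * (\<Sum>k\<in>K. a k * real (card (E k))) \<le>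
      (\<Sum>k\<in>K. \<Sum>x<Q. \<Sum>y<Q. ?w k x y * dirichlet_sq H (?\<theta> k x y))"
    unfolding sum_distrib_left
  proof (rule sum_mono)
    fix k assume k: "k \<in> K"
    let ?B = "(\<lambda>(u,v). (bin Q (\<phi> u), bin Q (\<psi> v))) ` E k"
    have "(real H)\<^sup>2 / 4 * (a k * real (card (E k))) \<le>
       (real H)\<^sup>2 / 4 * (a k * (\<Sum>(x,y)\<in>?B. sqrt (real (c0 x)) * sqrt (real (c1 y))))"
      unfolding c0_def c1_def using a[OF k]
      by (intro mult_left_mono card_le_sum_sqrt_bin_counts E k fin) auto
    also have "\<dots> = (\<Sum>(x,y)\<in>?B. ?w k x y * ((real H)\<^sup>2 / 4))"
      by (simp add: sum_distrib_left case_prod_unfold mult_ac)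
    also have "\<dots> \<le> (\<Sum>(x,y)\<in>?B. ?w k x y * dirichlet_sq H (?\<theta> k x y))"
    proof (rule sum_mono, clarify)
      fix u v assume uv: "(u, v) \<in> E k"
      let ?x = "bin Q (\<phi> u)" and ?y = "bin Q (\<psi> v)"
      \<comment> \<open>Both rounding errors lie in [0, 1/Q), so their difference is less than 1/Q
        in absolute value. The grid has Q = 8H points because \<open>dirichlet_sq_ge\<close>
        tolerates exactly 1/(8H).\<close>
      have "?\<theta> k ?x ?y - of_int (\<lfloor>\<psi> v\<rfloor> - \<lfloor>\<phi> u\<rfloor>) =
         (frac (\<psi> v) - real ?y / real Q) - (frac (\<phi> u) - real ?x / real Q)"
        using phase[OF k uv] by (simp add: frac_def)
      moreover have "1 / real Q = 1 / (8 * real H)" by (simp add: Q_def)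
      ultimately have "\<bar>?\<theta> k ?x ?y - of_int (\<lfloor>\<psi> v\<rfloor> - \<lfloor>\<phi> u\<rfloor>)\<bar> \<le> 1 / (8 * real H)"
        using bin_approx[OF Q, of "\<phi> u"] bin_approx[OF Q, of "\<psi> v"] by linarith
      thus "?w k ?x ?y * ((real H)\<^sup>2 / 4) \<le> ?w k ?x ?y * dirichlet_sq H (?\<theta> k ?x ?y)"
        using a[OF k] by (intro mult_left_mono dirichlet_sq_ge[of _ "\<lfloor>\<psi> v\<rfloor> - \<lfloor>\<phi> u\<rfloor>"]) auto
    qed
    also have "\<dots> \<le> (\<Sum>(x,y)\<in>{..<Q} \<times> {..<Q}. ?w k x y * dirichlet_sq H (?\<theta> k x y))"
      using a[OF k] bin_less[OF Q]
      by (intro sum_mono2) (auto simp: dirichlet_sq_def intro!: mult_nonneg_nonneg)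
    finally show "(real H)\<^sup>2 / 4 * (a k * real (card (E k))) \<le>
        (\<Sum>x<Q. \<Sum>y<Q. ?w k x y * dirichlet_sq H (?\<theta> k x y))"
      by (simp only: sum.cartesian_product)
  qed
  also have "\<dots> = Re S" by (simp add: S)
  also have "\<dots> \<le> norm S" by (rule complex_Re_le_cmod)
  also have "\<dots> \<le> (\<Sum>a<H. \<Sum>b<H. norm (P (int a - int b)) * (norm (R0 (int a - int b)) * norm (R1 (int a - int b))))"
    unfolding S_def by (intro sum_norm_le) (simp add: norm_mult mult.assoc)
  also have "\<dots> \<le> real H * (\<Sum>l\<in>{- int H<..<int H}. norm (P l) * (norm (R0 l) * norm (R1 l)))"
    by (rule sum_differences_le) auto
  finally have "real H * (real H / 4 * (\<Sum>k\<in>K. a k * real (card (E k)))) \<le>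
      real H * (\<Sum>l\<in>{- int H<..<int H}. norm (P l) * (norm (R0 l) * norm (R1 l)))"
    by (simp add: power2_eq_square mult_ac)
  hence "real H / 4 * (\<Sum>k\<in>K. a k * real (card (E k))) \<le>
      (\<Sum>l\<in>{- int H<..<int H}. norm (P l) * (norm (R0 l) * norm (R1 l)))" using H by simp
  also have "\<dots> \<le> (\<Sum>l\<in>{- int H<..<int H}. V * (norm (R0 l) * norm (R1 l))
       + err (nat \<bar>l\<bar>) * (real (card U) * real (card W)))"
  proof (rule sum_mono)
    fix l assume l: "l \<in> {- int H<..<int H}"
    \<comment> \<open>The coefficients are real, so P (- l) is the conjugate of P l, and the bound
      assumed for l >= 0 covers both signs. The same reflection causes the factor 2 in front of the
      sum of \<open>err\<close>.\<close>
    have "norm (P l) = norm (P \<bar>l\<bar>)"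
    proof (cases "l \<ge> 0")
      case False
      have "P \<bar>l\<bar> = cnj (P l)"
        using False unfolding P_def cnj_sum
        by (intro sum.cong refl) (simp flip: unit_exp_minus)
      thus ?thesis by simp
    qed simp
    also have "\<dots> \<le> V + err (nat \<bar>l\<bar>)"
    proof -
      have "nat \<bar>l\<bar> < H" using l by auto
      thus ?thesis using bound[of "nat \<bar>l\<bar>"] by (simp add: P_def)
    qed
    finally have "norm (P l) * (norm (R0 l) * norm (R1 l)) \<le> (V + err (nat \<bar>l\<bar>)) * (norm (R0 l) * norm (R1 l))"
      by (intro mult_right_mono) auto
    also have "\<dots> \<le> V * (norm (R0 l) * norm (R1 l)) + err (nat \<bar>l\<bar>) * (real (card U) * real (card W))"
      unfolding distrib_right R0_def R1_def using fin Q err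
      by (intro add_left_mono mult_left_mono mult_mono norm_resonator_le) auto
    finally show "norm (P l) * (norm (R0 l) * norm (R1 l)) \<le>
      V * (norm (R0 l) * norm (R1 l)) + err (nat \<bar>l\<bar>) * (real (card U) * real (card W))" .
  qed
  also have "\<dots> = V * (\<Sum>l\<in>{- int H<..<int H}. norm (R0 l) * norm (R1 l))
       + real (card U) * real (card W) * (\<Sum>l\<in>{- int H<..<int H}. err (nat \<bar>l\<bar>))"
    by (simp add: sum.distrib sum_distrib_left mult_ac)
  finally have main: "real H / 4 * (\<Sum>k\<in>K. a k * real (card (E k))) \<le> \<dots>" .
  have cs: "(\<Sum>l\<in>{- int H<..<int H}. norm (R0 l) * norm (R1 l)) \<le>
      8 * real H * sqrt (real (card U) * real (card W))"
  proof -
    let ?I = "{- int H<..<int H}"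
    have "(\<Sum>l\<in>?I. norm (R0 l) * norm (R1 l))\<^sup>2 \<le> (\<Sum>l\<in>?I. (norm (R0 l))\<^sup>2) * (\<Sum>l\<in>?I. (norm (R1 l))\<^sup>2)"
      by (rule Cauchy_Schwarz_ineq_sum)
    also have "\<dots> \<le> (8 * real H * real (card U)) * (8 * real H * real (card W))"
      unfolding R0_def R1_def Q_def using fin H by (intro mult_mono resonator_mean_square sum_nonneg) auto
    also have "\<dots> = (8 * real H * sqrt (real (card U) * real (card W)))\<^sup>2"
      by (simp add: power_mult_distrib power2_eq_square)
    finally show ?thesis by (rule power2_le_imp_le) auto
  qed
  have er: "(\<Sum>l\<in>{- int H<..<int H}. err (nat \<bar>l\<bar>)) \<le> 2 * (\<Sum>l<H. err l)"
  proof -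
    have "{- int H<..<int H} = {- int H<..<0} \<union> {0..<int H}" using H by auto
    hence "(\<Sum>l\<in>{- int H<..<int H}. err (nat \<bar>l\<bar>)) =
        (\<Sum>l\<in>{- int H<..<0}. err (nat \<bar>l\<bar>)) + (\<Sum>l\<in>{0..<int H}. err (nat \<bar>l\<bar>))"
      by (simp only:) (rule sum.union_disjoint, auto)
    also have "(\<Sum>l\<in>{- int H<..<0}. err (nat \<bar>l\<bar>)) \<le> (\<Sum>l<H. err l)"
      by (rule sum_le_included[where i = "\<lambda>l. - int l"])
         (auto intro!: err, rule_tac x = "nat (- x)" in bexI, auto)
    also have "(\<Sum>l\<in>{0..<int H}. err (nat \<bar>l\<bar>)) \<le> (\<Sum>l<H. err l)"
      by (rule sum_le_included[where i = int])
         (auto intro!: err, rule_tac x = "nat x" in bexI, auto)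
    finally show ?thesis by simp
  qed
  have "V * (\<Sum>l\<in>{- int H<..<int H}. norm (R0 l) * norm (R1 l))
       + real (card U) * real (card W) * (\<Sum>l\<in>{- int H<..<int H}. err (nat \<bar>l\<bar>)) \<le>
     V * (8 * real H * sqrt (real (card U) * real (card W)))
       + real (card U) * real (card W) * (2 * (\<Sum>l<H. err l))"
    using V by (intro add_mono mult_left_mono cs er) auto
  with main show ?thesis by (simp add: mult_ac)
qed

section \<open>Products of primes from blocks\<close>

text \<open>A squarefree number with exactly \<open>m j\<close> prime factors in block j, encoded by
  its set of prime factors in each block. Extensional functions make the code unique, and
  cardinalities become products of binomial coefficients.\<close>

definition block_sets :: "'i set \<Rightarrow> ('i \<Rightarrow> nat set) \<Rightarrow> ('i \<Rightarrow> nat) \<Rightarrow> ('i \<Rightarrow> nat set) set" where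
  "block_sets J P m = (\<Pi>\<^sub>E j\<in>J. {S. S \<subseteq> P j \<and> card S = m j})"

definition block_prod :: "'i set \<Rightarrow> ('i \<Rightarrow> nat set) \<Rightarrow> nat" where
  "block_prod J S = (\<Prod>j\<in>J. \<Prod>(S j))"

lemma card_block_sets:
  assumes "finite J" "\<And>j. j \<in> J \<Longrightarrow> finite (P j)"
  shows "card (block_sets J P m) = (\<Prod>j\<in>J. card (P j) choose m j)"
  unfolding block_sets_def using assms by (simp add: card_PiE n_subsets)

lemma finite_block_sets:
  assumes "finite J" "\<And>j. j \<in> J \<Longrightarrow> finite (P j)"
  shows "finite (block_sets J P m)"
  unfolding block_sets_def using assms by (intro finite_PiE) auto

locale prime_blocks =
  fixes J :: "'i set" and P :: "'i \<Rightarrow> nat set"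
  assumes finite_J: "finite J"
    and finite_P: "j \<in> J \<Longrightarrow> finite (P j)"
    and prime_P: "j \<in> J \<Longrightarrow> p \<in> P j \<Longrightarrow> prime p"
    and disjoint_P: "i \<in> J \<Longrightarrow> j \<in> J \<Longrightarrow> i \<noteq> j \<Longrightarrow> P i \<inter> P j = {}"
begin

lemma block_setsD:
  assumes "S \<in> block_sets J P m" "j \<in> J"
  shows "S j \<subseteq> P j" "card (S j) = m j" "finite (S j)"
  using assms finite_P[of j] by (auto simp: block_sets_def PiE_iff intro: finite_subset)

lemma dvd_block_prod_iff:
  assumes S: "S \<in> block_sets J P m" and j: "j \<in> J" and p: "p \<in> P j"
  shows "p dvd block_prod J S \<longleftrightarrow> p \<in> S j"
proof
  assume "p \<in> S j"
  hence "p dvd \<Prod>(S j)" using block_setsD[OF S j] by (intro dvd_prodI) auto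
  also have "\<dots> dvd block_prod J S" unfolding block_prod_def by (rule dvd_prodI[OF finite_J j])
  finally show "p dvd block_prod J S" .
next
  assume "p dvd block_prod J S"
  then obtain i where i: "i \<in> J" "p dvd \<Prod>(S i)"
    using prime_P[OF j p] finite_J by (auto simp: block_prod_def prime_dvd_prod_iff)
  then obtain q where q: "q \<in> S i" "p dvd q"
    using prime_P[OF j p] block_setsD[OF S i(1)] by (auto simp: prime_dvd_prod_iff)
  hence "q \<in> P i" using block_setsD[OF S i(1)] by auto
  hence "p = q" using q prime_P[OF j p] prime_P[OF i(1)] primes_dvd_imp_eq by blast
  hence "i = j" using disjoint_P[OF i(1) j] \<open>q \<in> P i\<close> p by blast
  thus "p \<in> S j" using q \<open>p = q\<close> by simp
qed

text \<open>Unique factorization: the family is recovered as the set of those block primes that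
  divide the product. The two families may have different sizes \<open>m\<close> and
  \<open>m'\<close>.\<close>

lemma block_prod_inj:
  assumes "S \<in> block_sets J P m" "S' \<in> block_sets J P m'" "block_prod J S = block_prod J S'"
  shows "S = S'"
proof (rule PiE_ext)
  show "S \<in> (\<Pi>\<^sub>E j\<in>J. Pow (P j))" "S' \<in> (\<Pi>\<^sub>E j\<in>J. Pow (P j))"
    using assms by (auto simp: block_sets_def PiE_iff)
  fix j assume j: "j \<in> J"
  show "S j = S' j"
    using dvd_block_prod_iff[OF assms(1) j] dvd_block_prod_iff[OF assms(2) j] assms(3)
      block_setsD(1)[OF assms(1) j] block_setsD(1)[OF assms(2) j] by auto
qed

lemma block_prod_pos:
  assumes "S \<in> block_sets J P m"
  shows "block_prod J S > 0"
  unfolding block_prod_def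
proof (intro prod_pos)
  fix j p assume "j \<in> J" "p \<in> S j"
  hence "prime p" using block_setsD[OF assms] prime_P by blast
  thus "p > 0" by (rule prime_gt_0_nat)
qed

lemma block_prod_le:
  assumes "T \<in> block_sets J P D" and "\<And>j p. j \<in> J \<Longrightarrow> p \<in> P j \<Longrightarrow> real p \<le> x j"
  shows "real (block_prod J T) \<le> (\<Prod>j\<in>J. x j ^ D j)"
  unfolding block_prod_def of_nat_prod
proof (intro prod_mono conjI)
  fix j assume j: "j \<in> J"
  have "(\<Prod>p\<in>T j. real p) \<le> (\<Prod>p\<in>T j. x j)"
    using block_setsD[OF assms(1) j] assms(2)[OF j] by (intro prod_mono) auto
  thus "(\<Prod>p\<in>T j. real p) \<le> x j ^ D j" using block_setsD[OF assms(1) j] by simp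
qed (auto intro!: prod_nonneg)

text \<open>Guarantees a logarithm of at least 1, so that the power of the logarithm in the
  coefficients of the derivative can be bounded below by 1.\<close>

lemma block_prod_ge_3:
  assumes "T \<in> block_sets J P D" "i \<in> J" "D i \<ge> 1" "\<And>p. p \<in> P i \<Longrightarrow> p \<ge> 3"
  shows "block_prod J T \<ge> 3"
proof -
  obtain p where p: "p \<in> T i" using block_setsD[OF assms(1,2)] assms(3) by fastforce
  hence "p \<in> P i" using block_setsD[OF assms(1,2)] by auto
  hence "p \<ge> 3" "p dvd block_prod J T"
    using assms p dvd_block_prod_iff[OF assms(1,2)] by auto
  moreover have "block_prod J T > 0" by (rule block_prod_pos[OF assms(1)])
  ultimately show ?thesis using dvd_imp_le[of p "block_prod J T"] by linarith
qed

definition quotient_pairs :: "('i \<Rightarrow> nat) \<Rightarrow> ('i \<Rightarrow> nat) \<Rightarrow> nat \<Rightarrow> (('i \<Rightarrow> nat set) \<times> ('i \<Rightarrow> nat set)) set" where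
  "quotient_pairs m D k = {(S0, S1). S0 \<in> block_sets J P (\<lambda>j. m j - D j) \<and> S1 \<in> block_sets J P m \<and>
     block_prod J S1 = block_prod J S0 * k}"

lemma inj_on_quotient_pairs:
  assumes "k > 0"
  shows "inj_on fst (quotient_pairs m D k)" "inj_on snd (quotient_pairs m D k)"
  using assms by (auto simp: quotient_pairs_def intro!: inj_onI dest: block_prod_inj)

text \<open>Removing from a family S a subfamily T with \<open>D j\<close> primes in each block
  gives the pair (S - T, S) with quotient \<open>block_prod J T\<close>. Each S admits a product of
  binomial coefficients of such T, and by unique factorization the quotient and S determine
  T.\<close>

lemma quotient_pairs_count:
  assumes m: "\<And>j. j \<in> J \<Longrightarrow> D j \<le> m j"
    and a: "\<And>n. n < M \<Longrightarrow> a n \<ge> 0" "c \<ge> 0"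
    and c: "\<And>T. T \<in> block_sets J P D \<Longrightarrow> block_prod J T \<le> M \<and> c \<le> a (block_prod J T - 1)"
  shows "c * real (card (block_sets J P m)) * real (\<Prod>j\<in>J. m j choose D j)
     \<le> (\<Sum>n<M. a n * real (card (quotient_pairs m D (Suc n))))"
proof -
  define N where "N = {n. n < M \<and> c \<le> a n}"
  define A where "A = (SIGMA S:block_sets J P m. block_sets J S D)"
  \<comment> \<open>The subtraction of 1 matches the indexing of Dirichlet coefficients, in which
    index n belongs to the integer \<open>Suc n\<close>; it is injective because products are
    positive.\<close>
  define f where "f = (\<lambda>(S, T). (block_prod J T - 1, ((\<lambda>j\<in>J. S j - T j), S)))"
  have fin: "finite (block_sets J P m)" for m using finite_J finite_P by (intro finite_block_sets) auto
  have finE: "finite (quotient_pairs m D k)" for k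
    by (rule finite_subset[OF _ finite_SigmaI[OF fin[of "\<lambda>j. m j - D j"] fin[of m]]])
       (auto simp: quotient_pairs_def)
  have sub: "T \<in> block_sets J P D" if "S \<in> block_sets J P m" "T \<in> block_sets J S D" for S T
    using that unfolding block_sets_def PiE_iff by blast
  have "card A = (\<Sum>S\<in>block_sets J P m. card (block_sets J S D))"
    unfolding A_def using finite_block_sets[OF finite_J block_setsD(3)]
    by (intro card_SigmaI ballI fin)
  also have "\<dots> = (\<Sum>S\<in>block_sets J P m. \<Prod>j\<in>J. m j choose D j)"
  proof (rule sum.cong[OF refl])
    fix S assume S: "S \<in> block_sets J P m"
    show "card (block_sets J S D) = (\<Prod>j\<in>J. m j choose D j)"
      using card_block_sets[OF finite_J block_setsD(3)[OF S]] block_setsD(2)[OF S]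
      by (simp cong: prod.cong)
  qed
  finally have cardA: "card A = card (block_sets J P m) * (\<Prod>j\<in>J. m j choose D j)" by simp
  have "card A \<le> card (SIGMA n:N. quotient_pairs m D (Suc n))"
  proof (rule card_inj_on_le[where f = f])
    show "inj_on f A"
    proof (rule inj_onI, clarify)
      fix S T S' T' assume A: "(S, T) \<in> A" "(S', T') \<in> A" and eq: "f (S, T) = f (S', T')"
      have T: "T \<in> block_sets J P D" "T' \<in> block_sets J P D" using A sub by (auto simp: A_def)
      have "block_prod J T - 1 = block_prod J T' - 1" using eq by (simp add: f_def)
      hence "block_prod J T = block_prod J T'"
        using block_prod_pos[OF T(1)] block_prod_pos[OF T(2)] by linarith
      thus "S = S' \<and> T = T'" using eq block_prod_inj[OF T] by (simp add: f_def)
    qed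
    show "f ` A \<subseteq> (SIGMA n:N. quotient_pairs m D (Suc n))"
    proof (rule image_subsetI)
      fix z assume "z \<in> A"
      then obtain S T where z: "z = (S, T)" and "(S, T) \<in> A" by (cases z) auto
      hence S: "S \<in> block_sets J P m" and TS: "T \<in> block_sets J S D" by (auto simp: A_def)
      have T: "T \<in> block_sets J P D" by (rule sub[OF S TS])
      have TSj: "T j \<subseteq> S j" if "j \<in> J" for j using TS that by (auto simp: block_sets_def PiE_iff)
      have pos: "block_prod J T > 0" by (rule block_prod_pos[OF T])
      have "(\<lambda>j\<in>J. S j - T j) \<in> block_sets J P (\<lambda>j. m j - D j)"
        unfolding block_sets_def PiE_iff
      proof (intro conjI ballI)
        fix j assume j: "j \<in> J"
        have "card (S j - T j) = m j - D j"
          using block_setsD[OF S j] block_setsD[OF T j] TSj[OF j] by (simp add: card_Diff_subset)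
        thus "(\<lambda>j\<in>J. S j - T j) j \<in> {U. U \<subseteq> P j \<and> card U = m j - D j}"
          using j block_setsD(1)[OF S j] by auto
      qed simp
      moreover have "block_prod J S = block_prod J (\<lambda>j\<in>J. S j - T j) * block_prod J T"
        unfolding block_prod_def
      proof (subst prod.distrib [symmetric], rule prod.cong[OF refl])
        fix j assume j: "j \<in> J"
        show "\<Prod>(S j) = \<Prod>((\<lambda>j\<in>J. S j - T j) j) * \<Prod>(T j)"
          using j TSj[OF j] block_setsD(3)[OF S j] by (simp add: prod.subset_diff)
      qed
      moreover have "block_prod J T - 1 \<in> N"
        using c[OF T] pos by (auto simp: N_def)
      ultimately show "f z \<in> (SIGMA n:N. quotient_pairs m D (Suc n))"
        using S pos by (simp add: z f_def quotient_pairs_def del: mult_Suc_right)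
    qed
    show "finite (SIGMA n:N. quotient_pairs m D (Suc n))"
      using finE by (intro finite_SigmaI) (auto simp: N_def)
  qed
  also have "\<dots> = (\<Sum>n\<in>N. card (quotient_pairs m D (Suc n)))"
    by (intro card_SigmaI) (auto simp: N_def finE)
  finally have "real (card A) \<le> (\<Sum>n\<in>N. real (card (quotient_pairs m D (Suc n))))"
    by (simp flip: of_nat_sum)
  hence "c * real (card A) \<le> (\<Sum>n\<in>N. c * real (card (quotient_pairs m D (Suc n))))"
    using a by (simp add: mult_left_mono flip: sum_distrib_left)
  also have "\<dots> \<le> (\<Sum>n\<in>N. a n * real (card (quotient_pairs m D (Suc n))))"
    by (intro sum_mono mult_right_mono) (auto simp: N_def)
  also have "\<dots> \<le> (\<Sum>n<M. a n * real (card (quotient_pairs m D (Suc n))))"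
    using a by (intro sum_mono2) (auto simp: N_def)
  finally show ?thesis by (simp add: cardA mult_ac)
qed

end

section \<open>Choice of the resonator\<close>

definition prime_mass :: "real \<Rightarrow> real \<Rightarrow> real" where
  "prime_mass y x = (\<Sum>p | prime p \<and> y < real p \<and> real p \<le> x. ln (real p) / real p)"

lemma finite_primes_interval [simp]: "finite {p::nat. prime p \<and> y < real p \<and> real p \<le> x}"
  by (rule finite_subset[of _ "{..nat \<lfloor>x\<rfloor>}"]) (auto simp: le_nat_floor)

lemma prime_mass_split:
  assumes "y \<le> x" "x \<le> z"
  shows "prime_mass y z = prime_mass y x + prime_mass x z"
proof -
  have "{p. prime p \<and> y < real p \<and> real p \<le> z} =
     {p. prime p \<and> y < real p \<and> real p \<le> x} \<union> {p. prime p \<and> x < real p \<and> real p \<le> z}"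
    using assms by auto
  thus ?thesis unfolding prime_mass_def by (simp only:) (rule sum.union_disjoint, auto)
qed

text \<open>Partial summation: the weights decrease, so a uniform lower bound for the partial sums
  survives the weighting. The induction carries along the current partial sum, shifted by C to make
  it nonnegative and thus monotone under the change of weight.\<close>

lemma sum_weighted_ge:
  fixes b :: "nat \<Rightarrow> real"
  assumes "C \<ge> 0" "\<And>i. i \<ge> j0 \<Longrightarrow> (\<Sum>j=j0..<i. b j) \<ge> - C" "j0 \<le> i"
  shows "(\<Sum>j=j0..<i. b j / real (j + 1)) \<ge> - C"
proof -
  have "(\<Sum>j=j0..<i. b j / real (j + 1)) \<ge> ((\<Sum>j=j0..<i. b j) + C) / real (i + 1) - C / real (j0 + 1)"
    using assms(3)
  proof (induction i rule: dec_induct)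
    case (step i)
    have "((\<Sum>j=j0..<Suc i. b j) + C) / real (Suc i + 1) \<le> ((\<Sum>j=j0..<Suc i. b j) + C) / real (i + 1)"
      using assms(2)[of "Suc i"] step(1) by (intro divide_left_mono) auto
    also have "\<dots> = ((\<Sum>j=j0..<i. b j) + C) / real (i + 1) + b i / real (i + 1)"
      using step(1) by (simp add: add_divide_distrib)
    finally show ?case using step.IH step(1) by simp
  qed simp
  moreover have "((\<Sum>j=j0..<i. b j) + C) / real (i + 1) \<ge> 0"
    using assms(2)[OF assms(3)] by simp
  moreover have "C / real (j0 + 1) \<le> C" using assms(1) by (simp add: divide_le_eq mult_left_le mult_le_cancel_left1)
  ultimately show ?thesis by linarith
qed

lemma harmonic_ge_ln:
  assumes "j0 \<le> i"
  shows "(\<Sum>j=j0..<i. 1 / real (j + 1)) \<ge> ln (real (i + 1)) - ln (real (j0 + 1))"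
  using assms
proof (induction i rule: dec_induct)
  case (step i)
  have "ln (real (Suc i + 1)) - ln (real (i + 1)) = ln (1 + 1 / real (i + 1))"
  proof -
    have "1 + 1 / real (i + 1) = real (Suc i + 1) / real (i + 1)" by (simp add: field_simps)
    thus ?thesis by (simp only: ln_div) simp
  qed
  also have "\<dots> \<le> 1 / real (i + 1)" by (rule ln_add_one_self_le_self) simp
  finally show ?case using step by simp
qed simp

text \<open>Mertens' theorem describes a union of consecutive blocks up to a bounded error but gives
  no lower bound for a single short block. The masses therefore enter only through this weighted
  sum: the deviations \<rho> j - h have partial sums at least - C, and
  \<open>sum_weighted_ge\<close> applies. It matters that C depends on none of w, h, j0, j1.\<close>

lemma weighted_prime_mass_ge:
  obtains C where "C \<ge> 0" and "\<And>w h j0 j1. w \<ge> 0 \<Longrightarrow> h > 0 \<Longrightarrow> j0 \<le> j1 \<Longrightarrow>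
    (\<Sum>j=j0..<j1. prime_mass (exp (w + h * real j)) (exp (w + h * real (Suc j))) / real (j + 1))
      \<ge> h * (ln (real (j1 + 1)) - ln (real (j0 + 1))) - C"
proof -
  obtain C where C: "C \<ge> 0" and mass: "\<And>x y. 1 \<le> y \<Longrightarrow> y \<le> x \<Longrightarrow> prime_mass y x \<ge> ln x - ln y - C"
    unfolding prime_mass_def using sum_ln_prime_interval_ge by blast
  have "(\<Sum>j=j0..<j1. prime_mass (exp (w + h * real j)) (exp (w + h * real (Suc j))) / real (j + 1))
      \<ge> h * (ln (real (j1 + 1)) - ln (real (j0 + 1))) - C" if w: "w \<ge> 0" and h: "h > 0" and j01: "j0 \<le> j1" for w h j0 j1
  proof -
    define \<rho> where "\<rho> j = prime_mass (exp (w + h * real j)) (exp (w + h * real (Suc j)))" for j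
    have "(\<Sum>j=j0..<i. \<rho> j) = prime_mass (exp (w + h * real j0)) (exp (w + h * real i))" if "j0 \<le> i" for i
      using that
    proof (induction i rule: dec_induct)
      case base
      have "{p. prime p \<and> exp (w + h * real j0) < real p \<and> real p \<le> exp (w + h * real j0)} = {}" by auto
      thus ?case by (simp only: prime_mass_def) simp
    next
      case (step i)
      have "prime_mass (exp (w + h * real j0)) (exp (w + h * real (Suc i))) =
        prime_mass (exp (w + h * real j0)) (exp (w + h * real i)) + \<rho> i"
        unfolding \<rho>_def using step h by (intro prime_mass_split) auto
      thus ?case using step by simp
    qed
    moreover have "prime_mass (exp (w + h * real j0)) (exp (w + h * real i)) \<ge> h * (real i - real j0) - C" if "j0 \<le> i" for i
      using mass[of "exp (w + h * real j0)" "exp (w + h * real i)"] w h that by (simp add: algebra_simps)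
    ultimately have "(\<Sum>j=j0..<i. \<rho> j - h) \<ge> - C" if "j0 \<le> i" for i
      using that by (simp add: sum_subtractf algebra_simps of_nat_diff)
    hence "(\<Sum>j=j0..<j1. (\<rho> j - h) / real (j + 1)) \<ge> - C"
      by (intro sum_weighted_ge C j01)
    moreover have "(\<Sum>j=j0..<j1. (\<rho> j - h) / real (j + 1)) =
       (\<Sum>j=j0..<j1. \<rho> j / real (j + 1)) - h * (\<Sum>j=j0..<j1. 1 / real (j + 1))"
      by (simp add: diff_divide_distrib sum_subtractf sum_distrib_left)
    moreover have "h * (\<Sum>j=j0..<j1. 1 / real (j + 1)) \<ge> h * (ln (real (j1 + 1)) - ln (real (j0 + 1)))"
      using h by (intro mult_left_mono harmonic_ge_ln j01) auto
    ultimately show ?thesis unfolding \<rho>_def by linarith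
  qed
  thus ?thesis using that C by blast
qed

section \<open>Elementary bounds for binomial coefficients and factorials\<close>

lemma binomial_step: "(n choose k) * (n - k) = (n choose Suc k) * Suc k"
  using binomial_absorb_comp[of n k] binomial_absorption[of k n] by (simp only: mult.commute)

text \<open>Each step from k to k + 1 <= m multiplies the binomial coefficient by (Q - k) / (k + 1),
  which is at least (Q - m) / m.\<close>

lemma binomial_ratio_ge:
  assumes "D \<le> m" "m \<le> Q"
  shows "(Q choose (m - D)) * (Q - m) ^ D \<le> (Q choose m) * m ^ D"
  using assms(1)
proof (induction D)
  case (Suc D)
  define k where "k = m - Suc D"
  have k: "m - D = Suc k" "Suc k \<le> Q" using Suc.prems assms by (simp_all add: k_def)
  have "(Q choose k) * (Q - m) ^ Suc D = (Q choose k) * (Q - m) * (Q - m) ^ D" by simp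
  also have "\<dots> \<le> (Q choose k) * (Q - k) * (Q - m) ^ D"
    using Suc.prems by (intro mult_le_mono) (auto simp: k_def)
  also have "(Q choose k) * (Q - k) = (Q choose Suc k) * Suc k"
    by (rule binomial_step)
  also have "(Q choose Suc k) * Suc k * (Q - m) ^ D \<le> m * ((Q choose (m - D)) * (Q - m) ^ D)"
  proof -
    have "(Q choose Suc k) * Suc k * (Q - m) ^ D \<le> (Q choose Suc k) * m * (Q - m) ^ D"
      using Suc.prems by (intro mult_le_mono) (auto simp: k_def)
    thus ?thesis by (simp only: k mult_ac)
  qed
  also have "\<dots> \<le> m * ((Q choose m) * m ^ D)" using Suc by (intro mult_le_mono2) simp
  finally show ?case by (simp add: k_def mult_ac)
qed simp

lemma fact_times_binomial_ge:
  assumes "D \<le> m"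
  shows "(m - D) ^ D \<le> fact D * (m choose D)"
  using assms
proof (induction D)
  case (Suc D)
  have "(m - Suc D) ^ Suc D \<le> (m - D) ^ Suc D" by (intro power_mono) auto
  also have "\<dots> \<le> (m - D) * (fact D * (m choose D))" using Suc by simp
  also have "\<dots> = fact D * ((m choose D) * (m - D))" by simp
  also have "\<dots> = fact (Suc D) * (m choose Suc D)" unfolding binomial_step by (simp add: algebra_simps)
  finally show ?case .
qed simp

text \<open>An elementary substitute for Stirling's formula, D! <= e D (D / e)^D. The induction step
  amounts to (D / (D + 1))^(D + 1) <= 1 / e.\<close>

lemma fact_le_exp:
  assumes "D \<ge> 1"
  shows "fact D \<le> real D ^ (D + 1) * exp (1 - real D)"
  using assms
proof (induction D rule: dec_induct)
  case (step D)
  have D: "real D > 0" using step by simp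
  have "ln (real D / (real D + 1)) \<le> real D / (real D + 1) - 1" using D by (intro ln_le_minus_one) auto
  also have "\<dots> = - (1 / (real D + 1))" using D by (simp add: field_simps)
  finally have "real (D + 1) * ln (real D / (real D + 1)) \<le> - 1"
    using D by (simp add: field_simps)
  hence "exp (real (D + 1) * ln (real D / (real D + 1))) \<le> exp (- 1)" by simp
  also have "exp (real (D + 1) * ln (real D / (real D + 1))) = (real D / (real D + 1)) ^ (D + 1)"
    using D by (subst exp_of_nat_mult) simp
  finally have e: "real D ^ (D + 1) \<le> exp (- 1) * (real D + 1) ^ (D + 1)"
    using D by (simp add: power_divide divide_le_eq)
  have "fact (Suc D) = (real D + 1) * fact D" by simp
  also have "\<dots> \<le> (real D + 1) * (real D ^ (D + 1) * exp (1 - real D))"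
    using step by (intro mult_left_mono) auto
  also have "\<dots> \<le> (real D + 1) * (exp (- 1) * (real D + 1) ^ (D + 1) * exp (1 - real D))"
    using e by (intro mult_left_mono mult_right_mono) auto
  also have "\<dots> = (real D + 1) ^ (Suc D + 1) * (exp (- 1) * exp (1 - real D))" by simp
  also have "exp (- 1) * exp (1 - real D) = exp (1 - real (Suc D))" by (simp flip: exp_add)
  finally show ?case by (simp add: add_ac)
qed simp

lemma binomial_le_exp_power:
  assumes "m \<ge> 1"
  shows "real (Q choose m) \<le> (exp 1 * real Q / real m) ^ m"
proof -
  have "(\<Sum>k\<in>{m}. real m ^ k /\<^sub>R fact k) \<le> (\<Sum>k. real m ^ k /\<^sub>R fact k)"
    by (rule sum_le_suminf[OF summable_exp_generic]) auto
  hence "real m ^ m \<le> exp (real m) * fact m" by (simp add: exp_def field_simps)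
  moreover have "exp (real m) = exp 1 ^ m" using exp_of_nat_mult[of m "1::real"] by simp
  ultimately have 1: "real m ^ m \<le> exp 1 ^ m * fact m" by simp
  have "(Q choose m) * fact m \<le> Q ^ m" by (rule binomial_fact_pow)
  hence 2: "real (Q choose m) * fact m \<le> real Q ^ m"
    by (metis of_nat_fact of_nat_le_iff of_nat_mult of_nat_power)
  have "real (Q choose m) * real m ^ m \<le> real (Q choose m) * (exp 1 ^ m * fact m)"
    using 1 by (intro mult_left_mono) auto
  also have "\<dots> = exp 1 ^ m * (real (Q choose m) * fact m)" by simp
  also have "\<dots> \<le> exp 1 ^ m * real Q ^ m" using 2 by (intro mult_left_mono) auto
  finally show ?thesis using assms by (simp add: power_divide power_mult_distrib field_simps)
qed

text \<open>The left side is at least x^D / D! with x = sqrt ((Q - m) / m) (m - D) z, and the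
  hypothesis on y^2 says y <= x. Since D <= y, this is at least D^D / D!, which
  \<open>fact_le_exp\<close> bounds below by exp (D - 1) / D; finally y < D + 1.\<close>

lemma block_gain_ge:
  fixes y z :: real
  assumes "D \<le> m" "m \<le> Q" "m \<ge> 1" "y \<ge> 1" "D = nat \<lfloor>y\<rfloor>" "z > 0"
    and y: "y\<^sup>2 \<le> (real Q - real m) / real m * (real m - real D)\<^sup>2 * z\<^sup>2"
  shows "sqrt (real (Q choose m) / real (Q choose (m - D))) * real (m choose D) * z ^ D \<ge> exp (y - 2 - ln y)"
proof -
  have fl: "\<lfloor>y\<rfloor> \<ge> 1" using assms(4) by simp
  hence "real D = of_int \<lfloor>y\<rfloor>" using assms(5) by simp
  with fl have D: "D \<ge> 1" "real D \<le> y" "y < real D + 1" using assms(5) by linarith+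
  have pos: "real (Q choose (m - D)) > 0" using assms by (simp add: zero_less_binomial)
  have "real ((Q choose (m - D)) * (Q - m) ^ D) \<le> real ((Q choose m) * m ^ D)"
    using binomial_ratio_ge[OF assms(1,2)] by (simp only: of_nat_le_iff)
  hence "((real Q - real m) / real m) ^ D \<le> real (Q choose m) / real (Q choose (m - D))"
    using assms pos by (simp add: of_nat_diff power_divide divide_simps mult_ac)
  hence 1: "sqrt ((real Q - real m) / real m) ^ D \<le> sqrt (real (Q choose m) / real (Q choose (m - D)))"
    by (metis real_sqrt_le_iff real_sqrt_power)
  have "real ((m - D) ^ D) \<le> real (fact D * (m choose D))"
    using fact_times_binomial_ge[OF assms(1)] by (simp only: of_nat_le_iff)
  hence 2: "(real m - real D) ^ D / fact D \<le> real (m choose D)"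
    using assms(1) by (simp add: of_nat_diff divide_le_eq mult_ac)
  have "y \<le> sqrt ((real Q - real m) / real m * (real m - real D)\<^sup>2 * z\<^sup>2)"
    using y assms(4) by (intro real_le_rsqrt)
  also have "\<dots> = sqrt ((real Q - real m) / real m) * (real m - real D) * z"
    using assms(1,6) by (simp only: real_sqrt_mult real_sqrt_abs abs_of_nonneg of_nat_le_iff diff_ge_0_iff_ge less_imp_le)
  finally have 3: "real D \<le> sqrt ((real Q - real m) / real m) * (real m - real D) * z" using D by linarith
  have "exp (y - 2 - ln y) = exp (y - 2) / y" using assms(4) by (simp add: exp_diff)
  also have "\<dots> \<le> exp (real D - 1) / real D" using D by (intro frac_le) auto
  also have "\<dots> \<le> real D ^ D / fact D"
  proof -
    have "exp (real D - 1) * fact D \<le> exp (real D - 1) * (real D ^ (D + 1) * exp (1 - real D))"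
      by (intro mult_left_mono fact_le_exp D) auto
    also have "\<dots> = real D ^ D * real D * (exp (real D - 1) * exp (1 - real D))" by simp
    also have "exp (real D - 1) * exp (1 - real D) = 1" by (simp flip: exp_add)
    finally show ?thesis using D by (simp add: field_simps)
  qed
  also have "\<dots> \<le> (sqrt ((real Q - real m) / real m) * (real m - real D) * z) ^ D / fact D"
    using 3 by (intro divide_right_mono power_mono) auto
  also have "\<dots> = sqrt ((real Q - real m) / real m) ^ D * ((real m - real D) ^ D / fact D) * z ^ D"
    by (simp add: power_mult_distrib)
  also have "\<dots> \<le> sqrt (real (Q choose m) / real (Q choose (m - D))) * real (m choose D) * z ^ D"
    using assms by (intro mult_right_mono mult_mono 1 2) auto
  finally show ?thesis .
qed

text \<open>The ideal exp (- A) with the losses of a block: \<open>(1 - \<eta>)\<^sup>2\<close> from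
  taking D slightly below its optimum, \<open>exp (- 1 / 100)\<close> as the square root of the
  width exp (1/50) of a block, and the powers of \<open>1 + \<eta>\<close> from replacing L by w,
  once in \<open>z\<close> and once in the prime count.\<close>

definition gain_const :: "real \<Rightarrow> real \<Rightarrow> real" where
  "gain_const \<eta> A = (1 - \<eta>)\<^sup>2 * exp (- 1 / 100) * exp (- A * (1 + \<eta>)) / sqrt (1 + \<eta>)"

text \<open>A single block: \<open>L\<close> is the logarithm of its upper end, \<open>Q\<close> its
  number of primes, \<open>\<rho>\<close> its mass; \<open>mh\<close> and \<open>y\<close> are the
  real values that are rounded to m and D. The conclusions are admissibility, the cost in resonator
  cardinality (each chosen prime costs about ln (Q / m), roughly u / 50), the logarithmic size of
  the quotient, and the gain, which is essentially exp y.\<close>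

lemma block_parameters:
  fixes Q m D :: nat and \<rho> w u L c \<eta> A mh y z :: real
  assumes \<eta>: "0 < \<eta>" "\<eta> \<le> 1 / 300" and A: "A > 0" and w: "w \<ge> 1"
    and u: "1 \<le> u" "u \<le> \<eta> * w" and L: "L = w + u / 50"
    and c: "exp w / w\<^sup>2 \<le> c" "c \<le> 12 * exp w"
    and \<rho>: "1 / w \<le> \<rho>" "\<rho> \<le> 2 * w"
    and Q: "\<rho> * exp (L - 1 / 50) \<le> real Q * L" "real Q \<le> \<rho> * exp L"
    and large: "exp (u / 50 - 1 / 50) \<ge> 24 * w / \<eta>" "exp (\<eta> * u / 50) \<ge> 3 * w ^ 4"
      "exp w \<ge> 8 * w ^ 6 / \<eta>\<^sup>2" "gain_const \<eta> A * exp (w / 2) \<ge> w ^ 4"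
      "10 * w\<^sup>2 * exp (w / 2) \<le> exp w"
    and mh: "mh = c * \<rho> / u\<^sup>2" and m: "m = nat \<lfloor>mh\<rfloor>"
    and z: "z = exp (- (1 / 2 + A / w) * L)"
    and y: "y = (1 - \<eta>)\<^sup>2 * sqrt (real Q * mh) * z" and D: "D = nat \<lfloor>y\<rfloor>"
  shows "1 \<le> D" "D \<le> m" "2 * m \<le> Q"
    and "real (Q choose m) \<le> exp (c * (1 + \<eta>) / 50 * (\<rho> / u))"
    and "real D * L \<le> 2 * w * (sqrt c * (\<rho> / u))"
    and "sqrt (real (Q choose m) / real (Q choose (m - D))) * real (m choose D) * z ^ D
           \<ge> exp (gain_const \<eta> A * sqrt c / sqrt w * (\<rho> / u) - (w + 2))"
proof -
  have uw: "u \<le> w" using u \<eta> w mult_right_mono[of \<eta> 1 w] by linarith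
  have Lw: "w \<le> L" "L \<le> (1 + \<eta>) * w" "L \<le> 2 * w" "L > 0"
    using L u uw w \<eta> by (auto simp: algebra_simps)
  have cpos: "c > 0" and \<rho>pos: "\<rho> > 0" and zpos: "z > 0"
    using c \<rho> w z by (auto intro: less_le_trans[of 0 "exp w / w\<^sup>2"] less_le_trans[of 0 "1 / w"])
  \<comment> \<open>Used twice: to make the rounding of \<open>mh\<close> a relative loss of at most
    \<open>\<eta>\<close>, and to make D small compared with m.\<close>
  have mh_ge: "8 * w / \<eta>\<^sup>2 \<le> mh"
  proof -
    have "8 * w / \<eta>\<^sup>2 = 8 * w ^ 6 / \<eta>\<^sup>2 / w ^ 5" using w by (simp add: eval_nat_numeral)
    also have "\<dots> \<le> exp w / w ^ 5" using large(3) w by (intro divide_right_mono) auto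
    also have "\<dots> = exp w / w\<^sup>2 * (1 / w) / w\<^sup>2" using w by (simp add: eval_nat_numeral)
    also have "\<dots> \<le> c * \<rho> / u\<^sup>2"
      using c \<rho> u uw w cpos \<rho>pos by (intro frac_le mult_mono power_mono) auto
    finally show ?thesis by (simp add: mh)
  qed
  have "1 / \<eta> \<le> 8 * w / \<eta>\<^sup>2"
    using \<eta> w by (simp add: field_simps power2_eq_square)
  hence "1 / \<eta> \<le> mh" using mh_ge by linarith
  hence \<eta>mh: "1 \<le> \<eta> * mh" using \<eta> by (simp add: field_simps)
  hence mhpos: "mh > 0" using \<eta> by (simp add: zero_less_mult_iff) (use \<eta>mh in \<open>smt (verit) mult_nonneg_nonpos\<close>)
  have mh1: "mh \<ge> 1" using \<eta>mh \<eta> mhpos mult_right_mono[of \<eta> 1 mh] by linarith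
  hence "\<lfloor>mh\<rfloor> \<ge> 1" by simp
  hence "real m = of_int \<lfloor>mh\<rfloor>" by (simp add: m)
  hence m_bd: "real m \<le> mh" "mh - 1 \<le> real m" "m \<ge> 1" using \<open>\<lfloor>mh\<rfloor> \<ge> 1\<close> by linarith+
  have m_ge: "(1 - \<eta>) * mh \<le> real m" using m_bd \<eta>mh by (simp add: algebra_simps)
  \<comment> \<open>The block lies beyond exp w by the factor exp (u / 50), which must beat w and
    the constant 12. This is one reason to discard the lowest blocks.\<close>
  have mQ: "real m \<le> \<eta> * real Q"
  proof -
    have "mh \<le> c * \<rho> / 1" unfolding mh using u cpos \<rho>pos by (intro divide_left_mono) auto
    also have "\<dots> \<le> 12 * exp w * \<rho>" using c \<rho>pos by (simp add: mult_right_mono)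
    also have "\<dots> = \<eta> * (\<rho> * (exp w * (24 * w / \<eta>))) / (2 * w)" using \<eta> w by simp
    also have "\<dots> \<le> \<eta> * (\<rho> * (exp w * exp (u / 50 - 1 / 50))) / (2 * w)"
      using large(1) \<eta> \<rho>pos w by (intro divide_right_mono mult_left_mono) auto
    also have "exp w * exp (u / 50 - 1 / 50) = exp (L - 1 / 50)" by (simp add: L flip: exp_add)
    also have "\<eta> * (\<rho> * exp (L - 1 / 50)) / (2 * w) \<le> \<eta> * (real Q * L) / (2 * w)"
      using Q \<eta> w by (intro divide_right_mono mult_left_mono) auto
    also have "\<dots> \<le> \<eta> * (real Q * (2 * w)) / (2 * w)"
      using Lw \<eta> w by (intro divide_right_mono mult_left_mono) auto
    also have "\<dots> = \<eta> * real Q" using w by simp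
    finally show ?thesis using m_bd by linarith
  qed
  have "real m \<le> 1 / 300 * real Q" using mQ \<eta> mult_right_mono[of \<eta> "1/300" "real Q"] by linarith
  thus mQ2: "2 * m \<le> Q" by linarith
  define Y where "Y = sqrt c * (\<rho> / u)"
  have Y: "sqrt (\<rho> * mh) = Y" "Y > 0"
  proof -
    have "\<rho> * mh = c * (\<rho> / u)\<^sup>2" by (simp add: mh power2_eq_square)
    thus "sqrt (\<rho> * mh) = Y" using \<rho>pos u by (simp add: Y_def real_sqrt_mult)
    show "Y > 0" using cpos \<rho>pos u by (simp add: Y_def)
  qed
  have Qm: "real Q > 0" using mQ2 m_bd by linarith
  have zL: "z = exp (- L / 2) * exp (- (A / w) * L)" by (simp add: z algebra_simps flip: exp_add)
  have ypos: "y > 0" using Qm mhpos zpos \<eta> by (simp add: y)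
  have yY: "y \<le> Y"
  proof -
    have "sqrt (real Q * mh) \<le> sqrt (\<rho> * exp L * mh)"
      using Q(2) mhpos by (intro real_sqrt_le_mono mult_right_mono) auto
    also have "\<dots> = sqrt (exp L) * Y" by (simp add: real_sqrt_mult mult_ac flip: Y(1))
    also have "sqrt (exp L) = exp (L / 2)" by (rule real_sqrt_unique) (simp_all flip: exp_double)
    finally have 1: "sqrt (real Q * mh) \<le> exp (L / 2) * Y" .
    have "z \<le> exp (- L / 2) * 1"
      unfolding zL using A w Lw by (intro mult_left_mono) auto
    hence 2: "sqrt (real Q * mh) * z \<le> (exp (L / 2) * Y) * (exp (- L / 2) * 1)"
      using 1 zpos Y(2) by (intro mult_mono) auto
    have "exp (L / 2) * exp (- L / 2) = 1" by (simp flip: exp_add)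
    hence "sqrt (real Q * mh) * z \<le> Y" using 2 by (simp add: mult_ac)
    moreover have "(1 - \<eta>)\<^sup>2 \<le> 1" using \<eta> by (intro power_le_one) auto
    hence "(1 - \<eta>)\<^sup>2 * (sqrt (real Q * mh) * z) \<le> 1 * (sqrt (real Q * mh) * z)"
      using zpos mhpos by (intro mult_right_mono) auto
    ultimately show ?thesis by (simp add: y mult_ac)
  qed
  \<comment> \<open>Y^2 is linear in \<open>mh\<close> while (\<eta> m)^2 is quadratic, so a large
    \<open>mh\<close> suffices. As D <= y <= Y, this makes D negligible against m.\<close>
  have "Y \<le> \<eta> * real m"
  proof (rule power2_le_imp_le)
    have "Y\<^sup>2 = \<rho> * mh" using Y \<rho>pos mhpos by (metis less_imp_le mult_nonneg_nonneg real_sqrt_pow2)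
    also have "\<dots> \<le> 2 * w * mh" using \<rho> mhpos by (intro mult_right_mono) auto
    also have "\<dots> \<le> (1 - \<eta>)\<^sup>2 * (8 * w) * mh"
    proof -
      have "1 / 2 \<le> 1 - \<eta>" using \<eta> by simp
      hence "(1 / 2)\<^sup>2 \<le> (1 - \<eta>)\<^sup>2" by (intro power_mono) auto
      hence "(1 / 2)\<^sup>2 * (8 * w) \<le> (1 - \<eta>)\<^sup>2 * (8 * w)" using w by (intro mult_right_mono) auto
      thus ?thesis using mhpos by (intro mult_right_mono) (auto simp: power2_eq_square)
    qed
    also have "\<dots> \<le> (1 - \<eta>)\<^sup>2 * (\<eta>\<^sup>2 * mh) * mh"
      using mh_ge \<eta> mhpos by (intro mult_right_mono mult_left_mono) (auto simp: field_simps)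
    also have "\<dots> = (\<eta> * ((1 - \<eta>) * mh))\<^sup>2" by (simp add: power2_eq_square)
    also have "\<dots> \<le> (\<eta> * real m)\<^sup>2" using m_ge \<eta> mhpos by (intro power_mono mult_left_mono) auto
    finally show "Y\<^sup>2 \<le> (\<eta> * real m)\<^sup>2" .
  qed (use \<eta> in auto)
  have y_ge: "gain_const \<eta> A * sqrt c / sqrt w * (\<rho> / u) \<le> y"
  proof -
    have "\<rho> * exp (L - 1 / 50) * mh / L \<le> real Q * mh"
      using Q(1) Lw mhpos by (simp add: field_simps)
    hence "sqrt (\<rho> * exp (L - 1 / 50) * mh / L) \<le> sqrt (real Q * mh)" by (rule real_sqrt_le_mono)
    moreover have "sqrt (\<rho> * exp (L - 1 / 50) * mh / L) = exp (L / 2 - 1 / 100) * Y / sqrt L"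
    proof -
      have "sqrt (exp (L - 1 / 50)) = exp (L / 2 - 1 / 100)"
        by (rule real_sqrt_unique) (simp_all add: field_simps flip: exp_double)
      thus ?thesis unfolding Y(1) [symmetric] by (simp add: real_sqrt_mult real_sqrt_divide)
    qed
    moreover have "exp (L / 2 - 1 / 100) * Y / sqrt ((1 + \<eta>) * w) \<le> exp (L / 2 - 1 / 100) * Y / sqrt L"
      using Lw Y w \<eta> by (intro divide_left_mono mult_pos_pos real_sqrt_le_mono) auto
    ultimately have 1: "exp (L / 2 - 1 / 100) * Y / sqrt ((1 + \<eta>) * w) \<le> sqrt (real Q * mh)" by linarith
    have "A / w * L \<le> A * (1 + \<eta>)"
      using mult_left_mono[OF Lw(2), of "A / w"] A w by (simp add: mult_ac)
    hence 2: "exp (- L / 2) * exp (- A * (1 + \<eta>)) \<le> z"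
      unfolding zL by (intro mult_left_mono) auto
    have "(1 - \<eta>)\<^sup>2 * (exp (L / 2 - 1 / 100) * Y / sqrt ((1 + \<eta>) * w)) * (exp (- L / 2) * exp (- A * (1 + \<eta>)))
       \<le> (1 - \<eta>)\<^sup>2 * sqrt (real Q * mh) * z"
      using 1 2 Y(2) w \<eta> mhpos by (intro mult_mono mult_left_mono) auto
    also have "exp (L / 2 - 1 / 100) = exp (L / 2) * exp (- 1 / 100)" by (simp flip: exp_add)
    also have "(1 - \<eta>)\<^sup>2 * (exp (L / 2) * exp (- 1 / 100) * Y / sqrt ((1 + \<eta>) * w)) * (exp (- L / 2) * exp (- A * (1 + \<eta>)))
       = (exp (L / 2) * exp (- L / 2)) * (gain_const \<eta> A * sqrt c / sqrt w * (\<rho> / u))"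
      by (simp add: gain_const_def Y_def real_sqrt_mult mult_ac)
    also have "exp (L / 2) * exp (- L / 2) = 1" by (simp flip: exp_add)
    finally show ?thesis by (simp add: y)
  qed
  have y1: "1 \<le> y"
  proof -
    have "1 \<le> gain_const \<eta> A * exp (w / 2) / w ^ 4" using large(4) w by simp
    also have "\<dots> = gain_const \<eta> A * (exp (w / 2) / w) / w * (1 / w / w)" by (simp add: eval_nat_numeral)
    also have "\<dots> \<le> gain_const \<eta> A * sqrt c / sqrt w * (\<rho> / u)"
    proof (intro mult_mono frac_le mult_left_mono)
      have "exp (w / 2) / w = sqrt (exp w / w\<^sup>2)"
        using w by (intro real_sqrt_unique [symmetric]) (simp_all add: power_divide flip: exp_double)
      also have "\<dots> \<le> sqrt c" using c by (intro real_sqrt_le_mono)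
      finally show "exp (w / 2) / w \<le> sqrt c" .
      have "sqrt w \<le> sqrt (w\<^sup>2)" using w by (intro real_sqrt_le_mono) (simp add: power2_eq_square)
      thus "sqrt w \<le> w" using w by simp
    qed (use w u uw \<rho> \<rho>pos cpos \<eta> in \<open>auto simp: gain_const_def\<close>)
    finally show ?thesis using y_ge by linarith
  qed
  hence "\<lfloor>y\<rfloor> \<ge> 1" by simp
  hence "real D = of_int \<lfloor>y\<rfloor>" by (simp add: D)
  hence D_bd: "real D \<le> y" "D \<ge> 1" using \<open>\<lfloor>y\<rfloor> \<ge> 1\<close> by linarith+
  thus "1 \<le> D" by simp
  have D\<eta>: "real D \<le> \<eta> * real m" using D_bd yY \<open>Y \<le> \<eta> * real m\<close> by linarith
  hence "real D \<le> real m" using \<eta> mult_right_mono[of \<eta> 1 "real m"] by linarith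
  thus Dm: "D \<le> m" by simp
  show "real D * L \<le> 2 * w * (sqrt c * (\<rho> / u))"
    using mult_mono[of "real D" Y L "2 * w"] D_bd yY Lw Y(2) by (simp add: Y_def mult_ac)
  show "real (Q choose m) \<le> exp (c * (1 + \<eta>) / 50 * (\<rho> / u))"
  proof -
    \<comment> \<open>Q / m is exp (u / 50) up to powers of w, and exp (\<eta> u / 50) absorbs
      those; hence the factor 1 + \<eta> in the cost.\<close>
    have "exp 1 * real Q / real m \<le> 3 * w ^ 4 * exp (u / 50)"
    proof -
      have "exp 1 * real Q / real m \<le> exp 1 * (\<rho> * exp L) / ((1 - \<eta>) * mh)"
        using Q(2) m_ge \<eta> mhpos \<rho>pos by (intro frac_le mult_left_mono mult_pos_pos) auto
      also have "\<dots> = exp 1 / (1 - \<eta>) * (exp L * u\<^sup>2 / c)"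
        using u \<rho>pos cpos by (simp add: mh)
      also have "\<dots> \<le> 3 * (exp L * w\<^sup>2 / (exp w / w\<^sup>2))"
      proof (intro mult_mono frac_le power_mono)
        have "exp 1 \<le> (2.75::real)" using e_less_272 by simp
        thus "exp 1 / (1 - \<eta>) \<le> 3" using \<eta> by (simp add: field_simps)
      qed (use u uw c w \<eta> cpos in auto)
      also have "exp L = exp w * exp (u / 50)" by (simp add: L exp_add)
      also have "3 * (exp w * exp (u / 50) * w\<^sup>2 / (exp w / w\<^sup>2)) = 3 * w ^ 4 * exp (u / 50)"
        by (simp add: eval_nat_numeral)
      finally show ?thesis .
    qed
    also have "\<dots> \<le> exp (\<eta> * u / 50) * exp (u / 50)" using large(2) by (intro mult_right_mono) auto
    also have "\<dots> = exp ((1 + \<eta>) * u / 50)" by (simp add: algebra_simps add_divide_distrib flip: exp_add)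
    finally have "(exp 1 * real Q / real m) ^ m \<le> exp ((1 + \<eta>) * u / 50) ^ m" by (intro power_mono) auto
    also have "\<dots> = exp (real m * ((1 + \<eta>) * u / 50))" by (simp only: exp_of_nat_mult)
    also have "\<dots> \<le> exp (mh * ((1 + \<eta>) * u / 50))"
      using m_bd u \<eta> by (simp add: mult_right_mono)
    also have "mh * ((1 + \<eta>) * u / 50) = c * (1 + \<eta>) / 50 * (\<rho> / u)"
      using u by (simp add: mh power2_eq_square mult_ac)
    finally show ?thesis using binomial_le_exp_power[OF m_bd(3), of Q] by linarith
  qed
  have "exp (gain_const \<eta> A * sqrt c / sqrt w * (\<rho> / u) - (w + 2)) \<le> exp (y - 2 - ln y)"
  proof -
    \<comment> \<open>Turns the loss 2 + ln y of \<open>block_gain_ge\<close> into w + 2.\<close>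
    have "y \<le> exp w"
    proof -
      have "Y \<le> sqrt (12 * exp w) * (2 * w / 1)"
        unfolding Y_def using c \<rho> u cpos w \<rho>pos by (intro mult_mono real_sqrt_le_mono frac_le) auto
      also have "sqrt (12 * exp w) \<le> 4 * exp (w / 2)"
      proof (rule real_le_lsqrt)
        show "12 * exp w \<le> (4 * exp (w / 2))\<^sup>2" by (simp add: power_mult_distrib flip: exp_double)
      qed auto
      also have "4 * exp (w / 2) * (2 * w / 1) \<le> 10 * w\<^sup>2 * exp (w / 2)"
      proof -
        have "1 * w \<le> w * w" using w by (intro mult_right_mono) auto
        hence "8 * w \<le> 10 * w\<^sup>2" using w by (simp add: power2_eq_square)
        hence "8 * w * exp (w / 2) \<le> 10 * w\<^sup>2 * exp (w / 2)" by (intro mult_right_mono) auto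
        moreover have "4 * exp (w / 2) * (2 * w / 1) = 8 * w * exp (w / 2)" by simp
        ultimately show ?thesis by (simp only:)
      qed
      finally have "Y \<le> 10 * w\<^sup>2 * exp (w / 2)" using w by (simp add: mult_right_mono)
      thus ?thesis using yY large(5) by linarith
    qed
    hence "ln y \<le> w" using ypos by (metis ln_exp ln_le_cancel_iff exp_gt_zero)
    thus ?thesis using y_ge by simp
  qed
  also have "\<dots> \<le> sqrt (real (Q choose m) / real (Q choose (m - D))) * real (m choose D) * z ^ D"
  proof (rule block_gain_ge)
    \<comment> \<open>The four factors 1 - \<eta> in y^2 pay for Q - m instead of Q, for (m - D)^2
      instead of m^2, and for m instead of \<open>mh\<close>.\<close>
    have "y\<^sup>2 = ((1 - \<eta>)\<^sup>2)\<^sup>2 * (real Q * mh) * z\<^sup>2"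
      using Qm mhpos by (simp add: y power_mult_distrib)
    also have "\<dots> = ((1 - \<eta>) * real Q) * (1 - \<eta>)\<^sup>2 * ((1 - \<eta>) * mh) * z\<^sup>2"
      by (simp add: power2_eq_square)
    also have "\<dots> \<le> ((1 - \<eta>) * real Q) * (1 - \<eta>)\<^sup>2 * real m * z\<^sup>2"
      using m_ge Qm \<eta> by (intro mult_right_mono mult_left_mono) auto
    also have "\<dots> = ((1 - \<eta>) * real Q) / real m * ((1 - \<eta>) * real m)\<^sup>2 * z\<^sup>2"
      using m_bd by (simp add: power2_eq_square)
    also have "\<dots> \<le> (real Q - real m) / real m * (real m - real D)\<^sup>2 * z\<^sup>2"
      using mQ mQ2 D\<eta> m_bd \<eta> Qm by (intro mult_right_mono mult_mono divide_right_mono power_mono) (auto simp: algebra_simps)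
    finally show "y\<^sup>2 \<le> (real Q - real m) / real m * (real m - real D)\<^sup>2 * z\<^sup>2" .
  qed (use Dm mQ2 m_bd y1 D zpos in auto)
  finally show "sqrt (real (Q choose m) / real (Q choose (m - D))) * real (m choose D) * z ^ D
           \<ge> exp (gain_const \<eta> A * sqrt c / sqrt w * (\<rho> / u) - (w + 2))" .
qed

section \<open>The prime blocks, their masses and the numerical constants\<close>

definition prime_block :: "real \<Rightarrow> nat \<Rightarrow> nat set" where
  "prime_block w j = {p. prime p \<and> exp (w + 1 / 50 * real j) < real p \<and> real p \<le> exp (w + 1 / 50 * real (Suc j))}"

definition block_mass :: "real \<Rightarrow> nat \<Rightarrow> real" where
  "block_mass w j = prime_mass (exp (w + 1 / 50 * real j)) (exp (w + 1 / 50 * real (Suc j)))"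

lemma block_mass_altdef: "block_mass w j = (\<Sum>p\<in>prime_block w j. ln (real p) / real p)"
  by (simp add: block_mass_def prime_mass_def prime_block_def)

lemma prime_block_ge_3:
  assumes "w \<ge> 1" "p \<in> prime_block w j"
  shows "p \<ge> 3"
proof -
  have "(2::real) \<le> exp 1" using exp_ge_add_one_self[of 1] by simp
  also have "\<dots> \<le> exp (w + 1 / 50 * real j)" using assms by simp
  also have "\<dots> < real p" using assms by (simp add: prime_block_def)
  finally show ?thesis by simp
qed

lemma prime_blocks_prime_block:
  assumes "finite J"
  shows "prime_blocks J (prime_block w)"
proof
  have disj: "prime_block w i \<inter> prime_block w j = {}" if "i < j" for i j
  proof (rule equals0I)
    fix p assume "p \<in> prime_block w i \<inter> prime_block w j"
    hence "real p \<le> exp (w + 1 / 50 * real (Suc i))" "exp (w + 1 / 50 * real j) < real p"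
      unfolding prime_block_def by blast+
    moreover have "exp (w + 1 / 50 * real (Suc i)) \<le> exp (w + 1 / 50 * real j)" using that by simp
    ultimately show False by linarith
  qed
  show "prime_block w i \<inter> prime_block w j = {}" if "i \<noteq> j" for i j
  proof (cases "i < j")
    case False
    hence "j < i" using that by simp
    thus ?thesis using disj[of j i] by blast
  qed (rule disj)
qed (use assms in \<open>auto simp: prime_block_def\<close>)

text \<open>On a block ln p / p lies between 1 / exp L and L / exp (L - 1/50), so mass and number of
  primes control each other up to a factor of order L. The absolute bound on the mass counts all
  integers up to exp L in place of the primes.\<close>

lemma block_mass_bounds:
  fixes w L :: real and j :: nat
  assumes w: "w \<ge> 1" and L: "L = w + real (j + 1) / 50" "L \<le> (1 + 1 / 300) * w"
  shows "block_mass w j * exp (L - 1 / 50) \<le> real (card (prime_block w j)) * L"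
    and "real (card (prime_block w j)) \<le> block_mass w j * exp L"
    and "block_mass w j \<le> 2 * w"
proof -
  define B where "B = prime_block w j"
  have B: "B = {p. prime p \<and> exp (L - 1 / 50) < real p \<and> real p \<le> exp L}"
    unfolding B_def prime_block_def L by (simp add: add_divide_distrib)
  have L1: "L - 1 / 50 \<ge> 1" "L > 0" using w by (simp_all add: L add_divide_distrib)
  have ln: "L - 1 / 50 < ln (real p)" "ln (real p) \<le> L" "real p > 0" if "p \<in> B" for p
  proof -
    show p: "real p > 0" using that by (auto simp: B dest: prime_gt_0_nat)
    have "ln (real p) \<le> ln (exp L)" using that p by (subst ln_le_cancel_iff) (auto simp: B)
    thus "ln (real p) \<le> L" by simp
    have "ln (exp (L - 1 / 50)) < ln (real p)" using that p by (subst ln_less_cancel_iff) (auto simp: B)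
    thus "L - 1 / 50 < ln (real p)" by simp
  qed
  have "block_mass w j \<le> (\<Sum>p\<in>B. L / exp (L - 1 / 50))"
    unfolding block_mass_altdef B_def [symmetric]
  proof (rule sum_mono)
    fix p assume p: "p \<in> B"
    have "exp (L - 1 / 50) \<le> real p" using p by (simp add: B)
    thus "ln (real p) / real p \<le> L / exp (L - 1 / 50)" using ln[OF p] L1 by (intro frac_le) auto
  qed
  thus 1: "block_mass w j * exp (L - 1 / 50) \<le> real (card (prime_block w j)) * L"
    by (simp add: B_def field_simps)
  have "(\<Sum>p\<in>B. 1 / exp L) \<le> block_mass w j"
    unfolding block_mass_altdef B_def [symmetric]
  proof (rule sum_mono)
    fix p assume p: "p \<in> B"
    have "real p \<le> exp L" using p by (simp add: B)
    thus "1 / exp L \<le> ln (real p) / real p" using ln[OF p] L1 by (intro frac_le) auto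
  qed
  thus "real (card (prime_block w j)) \<le> block_mass w j * exp L"
    by (simp add: B_def field_simps)
  have "card B \<le> card {1..nat \<lfloor>exp L\<rfloor>}"
    by (intro card_mono) (auto simp: B le_nat_floor dest: prime_ge_1_nat)
  hence "card B \<le> nat \<lfloor>exp L\<rfloor>" by simp
  hence "real (card B) \<le> real (nat \<lfloor>exp L\<rfloor>)" by (rule of_nat_mono)
  also have "\<dots> \<le> exp L" by (rule of_nat_floor) simp
  finally have card: "real (card B) \<le> exp L" .
  have "(1 - 1 / 50) * exp (1 / 50) \<le> exp (- (1 / 50)) * exp (1 / 50 :: real)"
    using exp_ge_add_one_self[of "- (1 / 50) :: real"] by (intro mult_right_mono) auto
  also have "\<dots> = 1" by (simp flip: exp_add)
  finally have e: "exp (1 / 50 :: real) \<le> 50 / 49" by simp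
  have "block_mass w j * exp (L - 1 / 50) \<le> exp L * L"
    using 1 card L1 by (auto simp: B_def intro: order_trans mult_right_mono)
  also have "exp L = exp (L - 1 / 50) * exp (1 / 50)" by (simp flip: exp_add)
  finally have "block_mass w j \<le> exp (1 / 50) * L" by (simp add: mult_ac)
  also have "\<dots> \<le> 50 / 49 * ((1 + 1 / 300) * w)" using e L L1 by (intro mult_mono) auto
  also have "\<dots> \<le> 2 * w" using w by simp
  finally show "block_mass w j \<le> 2 * w" .
qed

text \<open>9/40 is the exponent of the resonator size and 89/100 the share of ln w attained by the
  weighted mass. The choice of \<eta> gives (3 + A) \<eta> = 1/100, so all losses through \<eta>
  together cost at most one percent; the square roots of 1 + \<eta> here and in
  \<open>gain_const\<close> combine to 1 + \<eta>.\<close>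

lemma gain_const_ge:
  assumes A: "A > 0" and \<eta>: "\<eta> = 1 / (100 * (3 + A))"
  shows "43 / 100 * exp (- A) \<le> gain_const \<eta> A * sqrt (9 / 40 * (89 / 100) / (1 + \<eta>))"
proof -
  have \<eta>0: "0 < \<eta>" "\<eta> \<le> 1 / 300" "(3 + A) * \<eta> = 1 / 100" using A by (simp_all add: \<eta> field_simps)
  have A\<eta>: "0 \<le> A * \<eta>" using A \<eta>0 by simp
  have "99 / 100 \<le> (1 - 3 * \<eta>) * (1 - A * \<eta>)"
  proof -
    have "(1 - 3 * \<eta>) * (1 - A * \<eta>) = 1 - (3 + A) * \<eta> + 3 * \<eta> * (A * \<eta>)" by (simp add: algebra_simps)
    thus ?thesis using \<eta>0 A\<eta> by simp
  qed
  also have "\<dots> \<le> ((1 - \<eta>)\<^sup>2 / (1 + \<eta>)) * exp (- (A * \<eta>))"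
  proof (intro mult_mono)
    show "1 - 3 * \<eta> \<le> (1 - \<eta>)\<^sup>2 / (1 + \<eta>)"
      using \<eta>0 by (simp add: field_simps power2_eq_square)
    show "1 - A * \<eta> \<le> exp (- (A * \<eta>))" using exp_ge_add_one_self[of "- (A * \<eta>)"] by simp
    show "0 \<le> 1 - A * \<eta>" using \<eta>0 by (simp add: algebra_simps)
  qed (use \<eta>0 in auto)
  finally have 1: "99 / 100 \<le> (1 - \<eta>)\<^sup>2 / (1 + \<eta>) * exp (- (A * \<eta>))" .
  have 2: "99 / 100 \<le> exp (- 1 / 100 :: real)" using exp_ge_add_one_self[of "- 1 / 100 :: real"] by simp
  have 3: "447 / 1000 \<le> sqrt (9 / 40 * (89 / 100))" by (rule real_le_rsqrt) (simp add: power2_eq_square)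
  have "43 / 100 * exp (- A) \<le> (99 / 100) * (99 / 100) * (447 / 1000) * exp (- A)" by simp
  also have "\<dots> \<le> ((1 - \<eta>)\<^sup>2 / (1 + \<eta>) * exp (- (A * \<eta>))) * exp (- 1 / 100) * sqrt (9 / 40 * (89 / 100)) * exp (- A)"
    using \<eta>0 by (intro mult_right_mono mult_mono 1 2 3) auto
  also have "\<dots> = gain_const \<eta> A * sqrt (9 / 40 * (89 / 100) / (1 + \<eta>))"
  proof -
    define r where "r = sqrt (9 / 40 * (89 / 100) :: real)"
    have "sqrt (9 / 40 * (89 / 100) / (1 + \<eta>)) = r / sqrt (1 + \<eta>)"
      unfolding r_def by (rule real_sqrt_divide)
    moreover have "exp (- A * (1 + \<eta>)) = exp (- (A * \<eta>)) * exp (- A)" by (simp add: algebra_simps flip: exp_add)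
    moreover have "sqrt (1 + \<eta>) * sqrt (1 + \<eta>) = 1 + \<eta>" using \<eta>0 by simp
    ultimately have eq: "gain_const \<eta> A * sqrt (9 / 40 * (89 / 100) / (1 + \<eta>)) =
        (1 - \<eta>)\<^sup>2 * exp (- 1 / 100) * (exp (- (A * \<eta>)) * exp (- A)) * r / (1 + \<eta>)"
      by (simp add: gain_const_def)
    show ?thesis unfolding eq r_def [symmetric] by (simp add: mult_ac)
  qed
  finally show ?thesis .
qed

text \<open>The numerical gap that the proof lives on: 1 / (1.414 * 1.7) is below 42/100, and the
  blocks deliver 43/100 up to lower order terms.\<close>

lemma lambda_const_less: "lambda_const A < 42 / 100 * exp (- A)"
proof -
  have s: "(1.414::real) \<le> sqrt 2" by (rule real_le_rsqrt) (simp add: power2_eq_square)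
  have "(\<Sum>k<5. (1::real) ^ k /\<^sub>R fact k) \<le> (\<Sum>k. 1 ^ k /\<^sub>R fact k)"
    by (rule sum_le_suminf[OF summable_exp_generic]) auto
  hence "(2.7::real) \<le> exp 1" by (simp add: exp_def eval_nat_numeral)
  hence "1.414 * 1.7 \<le> sqrt 2 * (exp 1 - 1)" using s by (intro mult_mono) auto
  hence "1 / (sqrt 2 * (exp 1 - 1)) \<le> 1 / (1.414 * 1.7)" by (intro divide_left_mono) auto
  also have "\<dots> < 42 / 100" by simp
  finally have "1 / (sqrt 2 * (exp 1 - 1)) * exp (- A) < 42 / 100 * exp (- A)" by (intro mult_strict_right_mono) auto
  moreover have "lambda_const A = 1 / (sqrt 2 * (exp 1 - 1)) * exp (- A)"
    by (simp add: lambda_const_def exp_minus divide_simps)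
  ultimately show ?thesis by (simp only:)
qed

text \<open>Combines the blocks under a common budget. Blocks of mass below 1 / w are excluded
  because \<open>block_parameters\<close> would not give them a large m; only the total
  \<open>S\<close> of the remaining ones has to be large.\<close>

lemma resonator_parameters_aux:
  fixes w \<eta> A C :: real
  assumes A: "A > 0" and \<eta>: "\<eta> = 1 / (100 * (3 + A))" and w: "w \<ge> 1"
    and j1: "real j1 \<le> \<eta> * w"
    and large: "exp (real j0 / 50) \<ge> 24 * w / \<eta>" "exp (\<eta> * real j0 / 50) \<ge> 3 * w ^ 4"
      "exp w \<ge> 8 * w ^ 6 / \<eta>\<^sup>2" "gain_const \<eta> A * exp (w / 2) \<ge> w ^ 4"
      "10 * w\<^sup>2 * exp (w / 2) \<le> exp w"
    and J: "J = {j\<in>{j0..<j1}. block_mass w j \<ge> 1 / w}"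
    and S: "S = (\<Sum>j\<in>J. block_mass w j / real (j + 1))"
    and S_ge: "S \<ge> 89 / 100 / 50 * ln w" "S \<ge> 1"
    and loss: "1 / 100 * exp (- A) * sqrt (exp w * ln w / w) \<ge> w * (w + 2)"
  shows "\<exists>m D. (\<forall>j\<in>J. 1 \<le> D j \<and> D j \<le> m j \<and> m j \<le> card (prime_block w j)) \<and>
     real (\<Prod>j\<in>J. card (prime_block w j) choose m j) \<le> exp (9 / 40 * exp w) \<and>
     real (\<Prod>j\<in>J. card (prime_block w j) choose (m j - D j)) \<le> exp (9 / 40 * exp w) \<and>
     (\<Prod>j\<in>J. exp (w + 1 / 50 * real (Suc j)) ^ D j) \<le> exp (exp w) \<and>
     exp (42 / 100 * exp (- A) * sqrt (exp w * ln w / w)) \<le>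
       (\<Prod>j\<in>J. sqrt (real (card (prime_block w j) choose m j) / real (card (prime_block w j) choose (m j - D j)))
          * real (m j choose D j) * (exp (w + 1 / 50 * real (Suc j)) powr (- (1 / 2 + A / w))) ^ D j)"
proof -
  have \<eta>0: "0 < \<eta>" "\<eta> \<le> 1 / 300" using A by (simp_all add: \<eta> field_simps)
  have finJ: "finite J" by (simp add: J)
  define Q where "Q j = card (prime_block w j)" for j
  define \<rho> where "\<rho> j = block_mass w j" for j
  define u where "u j = real (j + 1)" for j
  define L where "L j = w + u j / 50" for j
  \<comment> \<open>Makes the costs c (1 + \<eta>) / 50 * (\<rho> / u) of all blocks add up to the
    budget 9/40 * exp w exactly; see \<open>cS\<close>.\<close>
  define c where "c = 9 / 40 * exp w * 50 / ((1 + \<eta>) * S)"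
  define mh where "mh j = c * \<rho> j / (u j)\<^sup>2" for j
  define m where "m j = nat \<lfloor>mh j\<rfloor>" for j
  define z where "z j = exp (- (1 / 2 + A / w) * L j)" for j
  define y where "y j = (1 - \<eta>)\<^sup>2 * sqrt (real (Q j) * mh j) * z j" for j
  define D where "D j = nat \<lfloor>y j\<rfloor>" for j
  have uj: "1 \<le> u j" "u j \<le> \<eta> * w" if "j \<in> J" for j
    using that j1 by (auto simp: J u_def)
  have Lle: "L j \<le> (1 + 1 / 300) * w" if "j \<in> J" for j
  proof -
    have "u j / 50 \<le> \<eta> * w" using uj[OF that] by simp
    also have "\<dots> \<le> 1 / 300 * w" using \<eta>0 w by (intro mult_right_mono) auto
    finally show ?thesis by (simp add: L_def algebra_simps)
  qed
  have mass: "\<rho> j * exp (L j - 1 / 50) \<le> real (Q j) * L j" "real (Q j) \<le> \<rho> j * exp (L j)" "\<rho> j \<le> 2 * w"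
    "1 / w \<le> \<rho> j" if "j \<in> J" for j
    using block_mass_bounds[OF w, of "L j" j] Lle[OF that] that
    by (simp_all add: \<rho>_def Q_def L_def u_def J)
  have S': "S = (\<Sum>j\<in>J. \<rho> j / u j)" by (simp add: S \<rho>_def u_def)
  have cardJ: "real (card J) \<le> w"
  proof -
    have "card J \<le> card {..<j1}" by (intro card_mono) (auto simp: J)
    hence "real (card J) \<le> \<eta> * w" using j1 by simp
    also have "\<dots> \<le> 1 * w" using \<eta>0 w by (intro mult_right_mono) auto
    finally show ?thesis by simp
  qed
  have S_le: "S \<le> 2 * w\<^sup>2"
  proof -
    have "S \<le> (\<Sum>j\<in>J. 2 * w / 1)"
      unfolding S' using mass uj w by (intro sum_mono frac_le) auto
    also have "\<dots> = real (card J) * (2 * w)" by simp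
    also have "\<dots> \<le> w * (2 * w)" using cardJ w by (intro mult_right_mono) auto
    finally show ?thesis by (simp add: power2_eq_square)
  qed
  have c1: "exp w / w\<^sup>2 \<le> c"
  proof -
    have "(1 + \<eta>) * S \<le> 2 * (2 * w\<^sup>2)" using S_le S_ge \<eta>0 by (intro mult_mono) auto
    hence "4 * exp w / (2 * (2 * w\<^sup>2)) \<le> 9 / 40 * exp w * 50 / ((1 + \<eta>) * S)"
      using S_ge \<eta>0 by (intro frac_le) auto
    moreover have "4 * exp w / (2 * (2 * w\<^sup>2)) = exp w / w\<^sup>2" by simp
    ultimately have "exp w / w\<^sup>2 \<le> 9 / 40 * exp w * 50 / ((1 + \<eta>) * S)" by linarith
    thus ?thesis by (simp only: c_def)
  qed
  have c2: "c \<le> 12 * exp w"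
  proof -
    have "c \<le> 9 / 40 * exp w * 50 / (1 * 1)"
      unfolding c_def using S_ge \<eta>0 by (intro divide_left_mono mult_mono) auto
    also have "\<dots> = 45 / 4 * exp w" by simp
    also have "\<dots> \<le> 12 * exp w" by (intro mult_right_mono) auto
    finally show ?thesis .
  qed
  have c0: "c > 0" using c1 w by (auto intro: less_le_trans[of 0 "exp w / w\<^sup>2"])
  have exp_j: "24 * w / \<eta> \<le> exp (u j / 50 - 1 / 50)" "3 * w ^ 4 \<le> exp (\<eta> * u j / 50)" if "j \<in> J" for j
  proof -
    have "exp (real j0 / 50) \<le> exp (u j / 50 - 1 / 50)" using that by (simp add: J u_def field_simps)
    thus "24 * w / \<eta> \<le> exp (u j / 50 - 1 / 50)" using large(1) by linarith
    have "\<eta> * real j0 / 50 \<le> \<eta> * u j / 50"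
      using that \<eta>0 by (intro divide_right_mono mult_left_mono) (auto simp: J u_def)
    hence "exp (\<eta> * real j0 / 50) \<le> exp (\<eta> * u j / 50)" by simp
    thus "3 * w ^ 4 \<le> exp (\<eta> * u j / 50)" using large(2) by linarith
  qed
  note block = block_parameters[OF \<eta>0 A w uj L_def c1 c2 mass(4,3,1,2) exp_j large(3-5) mh_def m_def z_def y_def D_def]
  have b1: "1 \<le> D j" "D j \<le> m j" "2 * m j \<le> Q j" if "j \<in> J" for j
    using block(1-3)[OF that that that that that that that that] by auto
  have b2: "real (Q j choose m j) \<le> exp (c * (1 + \<eta>) / 50 * (\<rho> j / u j))" if "j \<in> J" for j
    using block(4)[OF that that that that that that that that] .
  have b3: "real (D j) * L j \<le> 2 * w * (sqrt c * (\<rho> j / u j))" if "j \<in> J" for j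
    using block(5)[OF that that that that that that that that] .
  have b4: "exp (gain_const \<eta> A * sqrt c / sqrt w * (\<rho> j / u j) - (w + 2)) \<le>
     sqrt (real (Q j choose m j) / real (Q j choose (m j - D j))) * real (m j choose D j) * z j ^ D j" if "j \<in> J" for j
    using block(6)[OF that that that that that that that that] .
  have x: "exp (w + 1 / 50 * real (Suc j)) = exp (L j)" for j by (simp add: L_def u_def)
  have zx: "exp (w + 1 / 50 * real (Suc j)) powr (- (1 / 2 + A / w)) = z j" for j
    unfolding x by (simp add: z_def powr_def)
  have cS: "c * (1 + \<eta>) / 50 * S = 9 / 40 * exp w" using \<eta>0 S_ge by (simp add: c_def)
  \<comment> \<open>With c tied to S by the budget, the total gain grows like sqrt S, so a lower
    bound for S is enough.\<close>
  have scS: "sqrt c * S = sqrt (9 / 40 * 50 / (1 + \<eta>) * exp w * S)"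
  proof -
    have "sqrt c * S = sqrt (c * S\<^sup>2)" using S_ge by (simp add: real_sqrt_mult)
    also have "c * S\<^sup>2 = 9 / 40 * 50 / (1 + \<eta>) * exp w * S"
      using S_ge \<eta>0 by (simp add: c_def power2_eq_square)
    finally show ?thesis .
  qed
  have card1: "real (\<Prod>j\<in>J. Q j choose m j) \<le> exp (9 / 40 * exp w)"
  proof -
    have "real (\<Prod>j\<in>J. Q j choose m j) \<le> (\<Prod>j\<in>J. exp (c * (1 + \<eta>) / 50 * (\<rho> j / u j)))"
      unfolding of_nat_prod using b2 by (intro prod_mono) auto
    also have "\<dots> = exp (c * (1 + \<eta>) / 50 * S)" using finJ by (simp add: S' exp_sum sum_distrib_left)
    finally show ?thesis by (simp only: cS)
  qed
  have card2: "real (\<Prod>j\<in>J. Q j choose (m j - D j)) \<le> exp (9 / 40 * exp w)"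
  proof -
    \<comment> \<open>As 2 m <= Q, both lower indices lie on the increasing side of the binomial
      coefficients.\<close>
    have "(Q j choose (m j - D j)) \<le> (Q j choose m j)" if "j \<in> J" for j
      using b1[OF that] by (intro binomial_mono) auto
    hence "(\<Prod>j\<in>J. Q j choose (m j - D j)) \<le> (\<Prod>j\<in>J. Q j choose m j)" by (intro prod_mono) auto
    thus ?thesis using card1 by linarith
  qed
  have size: "(\<Prod>j\<in>J. exp (w + 1 / 50 * real (Suc j)) ^ D j) \<le> exp (exp w)"
  proof -
    have "(\<Prod>j\<in>J. exp (w + 1 / 50 * real (Suc j)) ^ D j) = exp (\<Sum>j\<in>J. real (D j) * L j)"
      using finJ by (simp only: x exp_sum exp_of_nat_mult)
    moreover have "(\<Sum>j\<in>J. real (D j) * L j) \<le> exp w"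
    proof -
      have "(\<Sum>j\<in>J. real (D j) * L j) \<le> (\<Sum>j\<in>J. 2 * w * (sqrt c * (\<rho> j / u j)))"
        by (intro sum_mono b3)
      also have "\<dots> = 2 * w * (sqrt c * S)" by (simp add: S' sum_distrib_left)
      also have "sqrt c * S \<le> sqrt ((5 * w * exp (w / 2))\<^sup>2)"
        unfolding scS
      proof (rule real_sqrt_le_mono)
        have "9 / 40 * 50 / (1 + \<eta>) * exp w * S \<le> 12 / 1 * exp w * (2 * w\<^sup>2)"
          using S_le S_ge \<eta>0 by (intro mult_mono frac_le) auto
        also have "\<dots> \<le> 25 * w\<^sup>2 * exp w" by simp
        also have "\<dots> = (5 * w * exp (w / 2))\<^sup>2" by (simp add: power_mult_distrib flip: exp_double)
        finally show "9 / 40 * 50 / (1 + \<eta>) * exp w * S \<le> (5 * w * exp (w / 2))\<^sup>2" .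
      qed
      also have "sqrt ((5 * w * exp (w / 2))\<^sup>2) = 5 * w * exp (w / 2)" using w by simp
      finally have "(\<Sum>j\<in>J. real (D j) * L j) \<le> 2 * w * (5 * w * exp (w / 2))"
        using w by (simp add: mult_left_mono)
      also have "\<dots> = 10 * w\<^sup>2 * exp (w / 2)" by (simp add: power2_eq_square)
      finally show ?thesis using large(5) by linarith
    qed
    ultimately show ?thesis by simp
  qed
  have gain: "exp (42 / 100 * exp (- A) * sqrt (exp w * ln w / w)) \<le>
       (\<Prod>j\<in>J. sqrt (real (Q j choose m j) / real (Q j choose (m j - D j)))
          * real (m j choose D j) * (exp (w + 1 / 50 * real (Suc j)) powr (- (1 / 2 + A / w))) ^ D j)"
  proof -
    have gc: "gain_const \<eta> A \<ge> 0" using \<eta>0 by (simp add: gain_const_def)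
    have "43 / 100 * exp (- A) * sqrt (exp w * ln w / w) \<le>
        gain_const \<eta> A * sqrt (9 / 40 * (89 / 100) / (1 + \<eta>)) * sqrt (exp w * ln w / w)"
      using w by (intro mult_right_mono gain_const_ge A \<eta>) auto
    also have "\<dots> = gain_const \<eta> A * sqrt (9 / 40 * 50 / (1 + \<eta>) * exp w * (89 / 100 / 50 * ln w)) / sqrt w"
    proof -
      have "9 / 40 * (89 / 100) / a * (e * l / b) = 9 / 40 * 50 / a * e * (89 / 100 / 50 * l) / b" for a b e l :: real
        by simp
      hence "sqrt (9 / 40 * (89 / 100) / (1 + \<eta>)) * sqrt (exp w * ln w / w) =
        sqrt (9 / 40 * 50 / (1 + \<eta>) * exp w * (89 / 100 / 50 * ln w)) / sqrt w"
        by (simp only: flip: real_sqrt_mult real_sqrt_divide)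
      thus ?thesis by (simp only: mult.assoc times_divide_eq_right)
    qed
    also have "\<dots> \<le> gain_const \<eta> A * (sqrt c * S) / sqrt w"
      unfolding scS using S_ge \<eta>0 gc w
      by (intro divide_right_mono mult_left_mono real_sqrt_le_mono) auto
    finally have 1: "43 / 100 * exp (- A) * sqrt (exp w * ln w / w) \<le> gain_const \<eta> A * (sqrt c * S) / sqrt w" .
    \<comment> \<open>There are at most w blocks, each losing w + 2 in the exponent. The assumption
      \<open>loss\<close> covers this by lowering 43/100 to 42/100.\<close>
    have "real (card J) * (w + 2) \<le> w * (w + 2)" using cardJ w by (intro mult_right_mono) auto
    moreover define q where "q = exp (- A) * sqrt (exp w * ln w / w)"
    ultimately have "42 / 100 * q \<le> gain_const \<eta> A * (sqrt c * S) / sqrt w - real (card J) * (w + 2)"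
      using 1 loss unfolding mult.assoc q_def [symmetric] by linarith
    hence "42 / 100 * exp (- A) * sqrt (exp w * ln w / w) \<le> gain_const \<eta> A * (sqrt c * S) / sqrt w - real (card J) * (w + 2)"
      unfolding mult.assoc q_def [symmetric] .
    also have "\<dots> = (\<Sum>j\<in>J. gain_const \<eta> A * sqrt c / sqrt w * (\<rho> j / u j) - (w + 2))"
      by (simp add: S' sum_subtractf sum_distrib_left sum_divide_distrib mult_ac)
    finally have "exp (42 / 100 * exp (- A) * sqrt (exp w * ln w / w)) \<le>
       (\<Prod>j\<in>J. exp (gain_const \<eta> A * sqrt c / sqrt w * (\<rho> j / u j) - (w + 2)))"
      using finJ by (simp flip: exp_sum)
    also have "\<dots> \<le> (\<Prod>j\<in>J. sqrt (real (Q j choose m j) / real (Q j choose (m j - D j)))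
          * real (m j choose D j) * z j ^ D j)"
      using b4 by (intro prod_mono) auto
    finally show ?thesis by (simp only: zx)
  qed
  have "1 \<le> D j \<and> D j \<le> m j \<and> m j \<le> Q j" if "j \<in> J" for j using b1[OF that] by simp
  thus ?thesis using card1 card2 size gain unfolding Q_def by blast
qed

text \<open>The indices run from w^(1/20) to w^(19/20): large enough for exp (\<eta> j / 50) to beat
  every power of w, small enough for L to stay below (1 + \<eta>) w. Since the weights are harmonic,
  the polynomial cutoffs retain a fixed proportion of ln w.\<close>

lemma resonator_parameters:
  assumes A: "A > 0"
  shows "\<forall>\<^sub>F w in at_top. \<exists>J m D. finite J \<and> J \<noteq> {} \<and>
     (\<forall>j\<in>J. 1 \<le> D j \<and> D j \<le> m j \<and> m j \<le> card (prime_block w j)) \<and>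
     real (\<Prod>j\<in>J. card (prime_block w j) choose m j) \<le> exp (9 / 40 * exp w) \<and>
     real (\<Prod>j\<in>J. card (prime_block w j) choose (m j - D j)) \<le> exp (9 / 40 * exp w) \<and>
     (\<Prod>j\<in>J. exp (w + 1 / 50 * real (Suc j)) ^ D j) \<le> exp (exp w) \<and>
     exp (42 / 100 * exp (- A) * sqrt (exp w * ln w / w)) \<le>
       (\<Prod>j\<in>J. sqrt (real (card (prime_block w j) choose m j) / real (card (prime_block w j) choose (m j - D j)))
          * real (m j choose D j) * (exp (w + 1 / 50 * real (Suc j)) powr (- (1 / 2 + A / w))) ^ D j)"
proof -
  define \<eta> where "\<eta> = 1 / (100 * (3 + A))"
  have \<eta>: "\<eta> > 0" using A by (simp add: \<eta>_def)
  have "\<eta> < 1" using A by (simp add: \<eta>_def)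
  hence gc: "gain_const \<eta> A > 0" "exp (- A) > 0" using \<eta> by (simp_all add: gain_const_def)
  define g where "g = gain_const \<eta> A"
  define a where "a = 1 / 100 * exp (- A)"
  have ga: "g > 0" "a > 0" using gc by (simp_all add: g_def a_def)
  obtain C where C: "C \<ge> 0" and mass: "\<And>w h j0 j1. w \<ge> 0 \<Longrightarrow> h > 0 \<Longrightarrow> j0 \<le> j1 \<Longrightarrow>
    (\<Sum>j=j0..<j1. prime_mass (exp (w + h * real j)) (exp (w + h * real (Suc j))) / real (j + 1))
      \<ge> h * (ln (real (j1 + 1)) - ln (real (j0 + 1))) - C"
    using weighted_prime_mass_ge by blast
  have "\<forall>\<^sub>F w::real in at_top. w \<ge> 1" by real_asymp
  moreover have "\<forall>\<^sub>F w::real in at_top. w powr (19 / 20) \<le> \<eta> * w" using \<eta> by real_asymp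
  moreover have "\<forall>\<^sub>F w::real in at_top. exp (w powr (1 / 20) / 50) \<ge> 24 * w / \<eta>" using \<eta> by real_asymp
  moreover have "\<forall>\<^sub>F w::real in at_top. exp (\<eta> * w powr (1 / 20) / 50) \<ge> 3 * w ^ 4" using \<eta> by real_asymp
  moreover have "\<forall>\<^sub>F w::real in at_top. exp w \<ge> 8 * w ^ 6 / \<eta>\<^sup>2" using \<eta> by real_asymp
  moreover have "\<forall>\<^sub>F w::real in at_top. g * exp (w / 2) \<ge> w ^ 4" using ga by real_asymp
  moreover have "\<forall>\<^sub>F w::real in at_top. 10 * w\<^sup>2 * exp (w / 2) \<le> exp w" by real_asymp
  moreover have "\<forall>\<^sub>F w::real in at_top. 1 / 50 * (ln (w powr (19 / 20)) - ln (w powr (1 / 20) + 2)) - C - 1 \<ge> 89 / 100 / 50 * ln w"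
    by real_asymp
  \<comment> \<open>The proportion is 19/20 - 1/20 = 9/10. It is lowered to 89/100 to absorb the
    constant C and the mass of the discarded blocks.\<close>
  moreover have "\<forall>\<^sub>F w::real in at_top. 89 / 100 / 50 * ln w \<ge> 1" by real_asymp
  moreover have "\<forall>\<^sub>F w::real in at_top. w powr (1 / 20) + 1 \<le> w powr (19 / 20) - 1" by real_asymp
  moreover have "\<forall>\<^sub>F w::real in at_top. a * sqrt (exp w * ln w / w) \<ge> w * (w + 2)" using ga by real_asymp
  ultimately show ?thesis
  proof eventually_elim
    case (elim w)
    define j0 where "j0 = nat \<lceil>w powr (1 / 20)\<rceil>"
    define j1 where "j1 = nat \<lfloor>w powr (19 / 20)\<rfloor>"
    define J where "J = {j\<in>{j0..<j1}. block_mass w j \<ge> 1 / w}"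
    define S where "S = (\<Sum>j\<in>J. block_mass w j / real (j + 1))"
    have j0: "w powr (1 / 20) \<le> real j0" "real j0 \<le> w powr (1 / 20) + 1"
      unfolding j0_def by (simp_all add: real_nat_ceiling_ge of_nat_ceiling ceiling_correct less_imp_le)
    have j1: "real j1 \<le> w powr (19 / 20)" "w powr (19 / 20) \<le> real j1 + 1"
      unfolding j1_def by (simp_all add: le_nat_floor)
    have j01: "j0 \<le> j1" using j0 j1 elim(10) by linarith
    have w1: "w \<ge> 1" and wp: "w powr (19 / 20) > 0" using elim(1) by simp_all
    have "real j1 \<le> w" 
    proof -
      have "w powr (19 / 20) \<le> w powr 1" using w1 by (intro powr_mono) auto
      thus ?thesis using j1 w1 by simp
    qed
    \<comment> \<open>At most w blocks are discarded and each has mass below 1 / w, so together they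
      contribute at most 1.\<close>
    have "(\<Sum>j=j0..<j1. block_mass w j / real (j + 1)) \<le> S + 1"
    proof -
      define J' where "J' = {j\<in>{j0..<j1}. block_mass w j < 1 / w}"
      have "J \<union> J' = {j0..<j1}" by (auto simp: J_def J'_def)
      moreover have "(\<Sum>j\<in>J \<union> J'. block_mass w j / real (j + 1)) = S + (\<Sum>j\<in>J'. block_mass w j / real (j + 1))"
        unfolding S_def by (rule sum.union_disjoint) (auto simp: J_def J'_def)
      ultimately have "(\<Sum>j=j0..<j1. block_mass w j / real (j + 1)) = S + (\<Sum>j\<in>J'. block_mass w j / real (j + 1))" by simp
      moreover have "(\<Sum>j\<in>J'. block_mass w j / real (j + 1)) \<le> (\<Sum>j\<in>J'. (1 / w) / 1)"
        using w1 by (intro sum_mono frac_le) (auto simp: J'_def)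
      moreover have "(\<Sum>j\<in>J'. (1 / w) / 1) \<le> (\<Sum>j<j1. (1 / w) / 1)"
        using w1 by (intro sum_mono2) (auto simp: J'_def)
      moreover have "(\<Sum>j<j1. (1 / w) / 1) \<le> 1" using \<open>real j1 \<le> w\<close> w1 by simp
      ultimately show ?thesis by linarith
    qed
    moreover have "(\<Sum>j=j0..<j1. block_mass w j / real (j + 1)) \<ge> 1 / 50 * (ln (real (j1 + 1)) - ln (real (j0 + 1))) - C"
      unfolding block_mass_def using w1 j01 by (intro mass) auto
    moreover have "ln (w powr (19 / 20)) \<le> ln (real (j1 + 1))" using j1 wp by (subst ln_le_cancel_iff) auto
    moreover have "ln (real (j0 + 1)) \<le> ln (w powr (1 / 20) + 2)"
      using j0 by (subst ln_le_cancel_iff) (auto intro: add_nonneg_pos)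
    \<comment> \<open>The linear combination of the preceding inequalities, stated with free
      variables in place of the sums and logarithms.\<close>
    moreover have "t \<le> S'" if "T \<le> S' + 1" "1 / 50 * (x - y) - C' \<le> T" "x' \<le> x" "y \<le> y'" "t \<le> 1 / 50 * (x' - y') - C' - 1"
      for T S' C' x y x' y' t :: real using that by (simp add: algebra_simps)
    ultimately have S: "S \<ge> 89 / 100 / 50 * ln w" using elim(8) by blast
    hence S1: "S \<ge> 1" using elim(9) by linarith
    hence "J \<noteq> {}" unfolding S_def by auto
    moreover have "finite J" by (simp add: J_def)
    moreover have "exp (real j0 / 50) \<ge> 24 * w / \<eta>"
      using elim(3) j0(1) by (elim order_trans) (simp add: divide_right_mono)
    moreover have "exp (\<eta> * real j0 / 50) \<ge> 3 * w ^ 4"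
      using elim(4) j0(1) \<eta> by (elim order_trans) (simp add: divide_right_mono mult_left_mono)
    moreover have "real j1 \<le> \<eta> * w" using j1 elim(2) by linarith
    ultimately show ?case
      using resonator_parameters_aux[OF A \<eta>_def w1 _ _ _ elim(5) _ elim(7) J_def S_def S S1] elim(6,11)
      unfolding g_def a_def by blast
  qed
qed

section \<open>The lower bound\<close>

definition dirichlet_poly :: "nat \<Rightarrow> nat \<Rightarrow> complex \<Rightarrow> complex" where
  "dirichlet_poly j M s = (\<Sum>n<M. of_real ((- ln (real (Suc n))) ^ j) / of_nat (Suc n) powr s)"

text \<open>The norm is blind to the sign (-1)^j and to complex conjugation. What remains are
  nonnegative coefficients and phases proportional to + ln n, as \<open>resonance_inequality\<close>
  requires.\<close>

lemma norm_dirichlet_poly_unit_exp: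
  "norm (\<Sum>n<M. of_real (ln (real (Suc n)) ^ j * real (Suc n) powr (- \<sigma>)) * unit_exp (l * (\<alpha> / (2 * pi) * ln (real (Suc n)))))
     = norm (dirichlet_poly j M (Complex \<sigma> (\<alpha> * l)))"
proof -
  have summand: "of_real ((- ln x) ^ j) / of_real x powr (Complex \<sigma> (\<alpha> * l)) =
     (- 1) ^ j * cnj (of_real (ln x ^ j * x powr (- \<sigma>)) * unit_exp (l * (\<alpha> / (2 * pi) * ln x)))" if x: "x > 0" for x :: real
  proof -
    have "of_real x powr (Complex \<sigma> (\<alpha> * l)) = exp (Complex \<sigma> (\<alpha> * l) * of_real (ln x))"
      using x by (simp add: powr_def Ln_of_real)
    hence "1 / of_real x powr (Complex \<sigma> (\<alpha> * l)) = exp (- (Complex \<sigma> (\<alpha> * l) * of_real (ln x)))"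
      by (simp add: exp_minus divide_inverse)
    also have "- (Complex \<sigma> (\<alpha> * l) * of_real (ln x)) = of_real (- \<sigma> * ln x) + \<i> * of_real (- (\<alpha> * l * ln x))"
      by (simp add: complex_eq_iff)
    also have "exp \<dots> = of_real (x powr (- \<sigma>)) * cis (- (\<alpha> * l * ln x))"
      using x by (simp only: exp_add exp_of_real powr_def cis_conv_exp) simp
    also have "cis (- (\<alpha> * l * ln x)) = cnj (unit_exp (l * (\<alpha> / (2 * pi) * ln x)))"
      by (simp add: unit_exp_def cis_cnj mult_ac)
    finally have "1 / of_real x powr (Complex \<sigma> (\<alpha> * l)) =
      of_real (x powr (- \<sigma>)) * cnj (unit_exp (l * (\<alpha> / (2 * pi) * ln x)))" .
    hence "of_real ((- ln x) ^ j) * (1 / of_real x powr (Complex \<sigma> (\<alpha> * l))) =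
      of_real ((- ln x) ^ j) * (of_real (x powr (- \<sigma>)) * cnj (unit_exp (l * (\<alpha> / (2 * pi) * ln x))))"
      by (simp only:)
    moreover have "(- ln x) ^ j = (- 1) ^ j * ln x ^ j" by (simp flip: power_mult_distrib)
    ultimately show ?thesis by (simp add: mult_ac)
  qed
  have "dirichlet_poly j M (Complex \<sigma> (\<alpha> * l)) =
     (- 1) ^ j * cnj (\<Sum>n<M. of_real (ln (real (Suc n)) ^ j * real (Suc n) powr (- \<sigma>)) * unit_exp (l * (\<alpha> / (2 * pi) * ln (real (Suc n)))))"
    unfolding dirichlet_poly_def cnj_sum sum_distrib_left
  proof (rule sum.cong[OF refl])
    fix n
    show "of_real ((- ln (real (Suc n))) ^ j) / of_nat (Suc n) powr (Complex \<sigma> (\<alpha> * l)) =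
     (- 1) ^ j * cnj (of_real (ln (real (Suc n)) ^ j * real (Suc n) powr (- \<sigma>)) * unit_exp (l * (\<alpha> / (2 * pi) * ln (real (Suc n)))))"
      using summand[of "real (Suc n)"] by (simp only: of_real_of_nat_eq)
  qed
  thus ?thesis by (simp only: norm_mult norm_power norm_minus_cancel norm_one power_one mult_1 complex_mod_cnj)
qed

section \<open>Pointwise errors of the Dirichlet polynomial\<close>

lemma sum_inverse_sqrt_le: "(\<Sum>n<M. 1 / sqrt (real (Suc n))) \<le> 2 * sqrt (real M)"
proof (induction M)
  case (Suc M)
  let ?a = "sqrt (real M)" and ?b = "sqrt (real (Suc M))"
  have "(?b - ?a) * (?b + ?a) = 1" by (simp add: algebra_simps)
  moreover have "(?b - ?a) * (?b + ?a) \<le> (?b - ?a) * (2 * ?b)" by (intro mult_left_mono) auto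
  ultimately have "1 / ?b \<le> 2 * (?b - ?a)" by (simp add: field_simps)
  thus ?case using Suc by simp
qed simp

lemma norm_dirichlet_poly_le:
  assumes "\<sigma> \<ge> 1 / 2" "M \<ge> 1"
  shows "norm (dirichlet_poly j M (Complex \<sigma> t)) \<le> 2 * sqrt (real M) * ln (real M) ^ j"
proof -
  have "norm (dirichlet_poly j M (Complex \<sigma> t)) \<le> (\<Sum>n<M. ln (real M) ^ j * (1 / sqrt (real (Suc n))))"
    unfolding dirichlet_poly_def
  proof (rule sum_norm_le)
    fix n assume n: "n \<in> {..<M}"
    have "norm (of_nat (Suc n) powr (Complex \<sigma> t)) = real (Suc n) powr \<sigma>"
      by (subst norm_powr_real_powr) (auto simp del: of_nat_Suc)
    hence "norm (of_real ((- ln (real (Suc n))) ^ j) / of_nat (Suc n) powr (Complex \<sigma> t)) =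
      ln (real (Suc n)) ^ j * (1 / real (Suc n) powr \<sigma>)"
      by (simp add: norm_divide norm_power power_abs del: of_nat_Suc)
    also have "\<dots> \<le> ln (real M) ^ j * (1 / sqrt (real (Suc n)))"
    proof (intro mult_mono power_mono divide_left_mono)
      have "real (Suc n) powr (1 / 2) \<le> real (Suc n) powr \<sigma>" using assms by (intro powr_mono) auto
      thus "sqrt (real (Suc n)) \<le> real (Suc n) powr \<sigma>" by (simp add: powr_half_sqrt)
    qed (use n in auto)
    finally show "norm (of_real ((- ln (real (Suc n))) ^ j) / of_nat (Suc n) powr (Complex \<sigma> t)) \<le>
       ln (real M) ^ j * (1 / sqrt (real (Suc n)))" .
  qed
  also have "\<dots> \<le> ln (real M) ^ j * (2 * sqrt (real M))"
    unfolding sum_distrib_left [symmetric] using assms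
    by (intro mult_left_mono sum_inverse_sqrt_le) auto
  finally show ?thesis by (simp add: mult_ac)
qed

lemma harmonic_le_ln: "n \<ge> 1 \<Longrightarrow> (\<Sum>l<n. 1 / real (Suc l)) \<le> 1 + ln (real n)"
proof (induction n rule: dec_induct)
  case (step n)
  have "ln (real n / real (Suc n)) \<le> real n / real (Suc n) - 1"
    using step by (intro ln_le_minus_one) auto
  hence "1 / real (Suc n) \<le> ln (real (Suc n)) - ln (real n)"
    using step by (simp add: ln_div field_simps)
  thus ?case using step by simp
qed simp

lemma card_nat_less_real: "real (card {l::nat. real l < x}) \<le> max 0 x + 1"
proof -
  have "{l::nat. real l < x} \<subseteq> {..<nat \<lceil>x\<rceil>}" by (auto simp: less_ceiling_iff zless_nat_eq_int_zless)
  hence "card {l::nat. real l < x} \<le> nat \<lceil>x\<rceil>" using card_mono[of "{..<nat \<lceil>x\<rceil>}"] by fastforce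
  hence "real (card {l::nat. real l < x}) \<le> real (nat \<lceil>x\<rceil>)" by (rule of_nat_mono)
  also have "\<dots> \<le> max 0 x + 1" by linarith
  finally show ?thesis .
qed

lemma sum_if_nat_less_real_le:
  assumes "b \<ge> 0"
  shows "(\<Sum>l<H. if real l < x then b else 0) \<le> (max 0 x + 1) * b"
proof -
  have fin: "finite {l::nat. real l < x}"
    by (rule finite_subset[of _ "{..<nat \<lceil>x\<rceil>}"]) (auto simp: less_ceiling_iff zless_nat_eq_int_zless)
  have "(\<Sum>l<H. if real l < x then b else 0) = (\<Sum>l\<in>{..<H} \<inter> {l. real l < x}. b)"
    by (simp add: sum.If_cases)
  also have "\<dots> \<le> (\<Sum>l\<in>{l::nat. real l < x}. b)" using fin assms by (intro sum_mono2) auto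
  also have "\<dots> = real (card {l::nat. real l < x}) * b" by simp
  also have "\<dots> \<le> (max 0 x + 1) * b" using assms by (intro mult_right_mono card_nat_less_real)
  finally show ?thesis .
qed

lemma ln_power_le_powr:
  fixes e :: real
  assumes "e > 0"
  shows "\<forall>\<^sub>F x::real in at_top. (2 * ln x) ^ j \<le> x powr e"
proof -
  define d where "d = e / real (Suc j)"
  have d: "d > 0" using assms by (simp add: d_def)
  have "\<forall>\<^sub>F x::real in at_top. 2 * ln x \<le> x powr d" using d by real_asymp
  moreover have "\<forall>\<^sub>F x::real in at_top. x \<ge> 1" by real_asymp
  ultimately show ?thesis
  proof eventually_elim
    case (elim x)
    have "(2 * ln x) ^ j \<le> (x powr d) ^ j" using elim by (intro power_mono) auto
    also have "\<dots> = x powr (d * real j)" using elim by (subst powr_power) (auto simp: mult.commute)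
    also have "\<dots> \<le> x powr e" using elim assms by (intro powr_mono) (auto simp: d_def field_simps)
    finally show ?case .
  qed
qed

text \<open>For l < 2 / \<alpha> the height is below 2 and the trivial bound is used; there are
  boundedly many such l. For the other l < sqrt N the trivial bound, about N^(51/100) each, would
  sum to more than N. There zeta itself is bounded through a second, shorter polynomial of length
  about N^(51/100), which leaves roughly N^(1/2 + 0.266) in total. From sqrt N on, V takes over. The
  approximation error is added in the last two ranges.\<close>

lemma dirichlet_poly_error:
  fixes \<alpha> :: real
  assumes \<alpha>: "\<alpha> > 0"
  shows "\<forall>\<^sub>F N in at_top. \<forall>\<sigma> V. 1 / 2 \<le> \<sigma> \<and> \<sigma> \<le> 1 \<and> V \<ge> 0 \<and>
     (\<forall>l::nat. sqrt N \<le> real l \<and> real l \<le> N \<longrightarrow> norm ((deriv ^^ j) zeta (Complex \<sigma> (\<alpha> * real l))) \<le> V) \<longrightarrow>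
     (\<exists>err. (\<forall>l. err l \<ge> 0) \<and>
        (\<forall>l<nat \<lfloor>N\<rfloor>. norm (dirichlet_poly j (nat \<lceil>N powr (51 / 50)\<rceil>) (Complex \<sigma> (\<alpha> * real l))) \<le> V + err l) \<and>
        (\<Sum>l<nat \<lfloor>N\<rfloor>. err l) \<le> N powr (77 / 100))"
proof -
  \<comment> \<open>The exponent 13/25 used below is 1 - 1/2 + 1/50. The power 100 fits the length N
    powr (51/50): then t / (M + 1) is at most N powr (- 1/100), with 100th power 1 / N.\<close>
  obtain C0 where C0: "\<And>M \<sigma> t. 1 / 2 \<le> \<sigma> \<Longrightarrow> \<sigma> \<le> 1 \<Longrightarrow> 2 \<le> t \<Longrightarrow> t \<le> real M \<Longrightarrow>
    norm ((deriv ^^ j) zeta (Complex \<sigma> t) - dirichlet_poly j M (Complex \<sigma> t))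
     \<le> C0 * real (Suc M) powr (1 - \<sigma> + 1 / 50) * (1 / t + (t / real (Suc M)) ^ 100)"
    using zeta_higher_deriv_approx[of "1 / 50" 100 j] unfolding dirichlet_poly_def by auto
  define C where "C = max 1 C0"
  have C: "C > 0" by (simp add: C_def)
  have approx: "norm ((deriv ^^ j) zeta (Complex \<sigma> t) - dirichlet_poly j M (Complex \<sigma> t))
     \<le> C * real (Suc M) powr (13 / 25) * (1 / t + (t / real (Suc M)) ^ 100)"
    if "1 / 2 \<le> \<sigma>" "\<sigma> \<le> 1" "2 \<le> t" "t \<le> real M" for M \<sigma> t
  proof -
    have "real (Suc M) powr (1 - \<sigma> + 1 / 50) \<le> real (Suc M) powr (13 / 25)"
      using that by (intro powr_mono) auto
    hence "C0 * real (Suc M) powr (1 - \<sigma> + 1 / 50) \<le> C * real (Suc M) powr (13 / 25)"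
      by (intro mult_mono) (auto simp: C_def)
    hence "C0 * real (Suc M) powr (1 - \<sigma> + 1 / 50) * (1 / t + (t / real (Suc M)) ^ 100)
      \<le> C * real (Suc M) powr (13 / 25) * (1 / t + (t / real (Suc M)) ^ 100)"
      using that by (intro mult_right_mono) auto
    thus ?thesis using C0[OF that] by linarith
  qed
  \<comment> \<open>\<open>ax\<close> and \<open>ay\<close> bound the long and the short polynomial,
    \<open>bz\<close> the approximation error of the short one, and \<open>bx\<close> the factor in
    front of the error of the long one. The factor N powr (1/1000) swallows the logarithms.\<close>
  define ax where "ax = (\<lambda>N::real. 2 * sqrt (N powr (51 / 50) + 1) * N powr (1 / 1000))"
  define ay where "ay = (\<lambda>N::real. 2 * sqrt (N powr (51 / 100) + 1) * N powr (1 / 1000))"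
  define bz where "bz = (\<lambda>N::real. 2 * C * (N powr (51 / 100) + 2) powr (13 / 25))"
  define bx where "bx = (\<lambda>N::real. C * (N powr (51 / 50) + 2) powr (13 / 25))"
  have "\<forall>\<^sub>F N::real in at_top. (2 * ln N) ^ j \<le> N powr (1 / 1000)" by (rule ln_power_le_powr) simp
  moreover have "\<forall>\<^sub>F N::real in at_top. N \<ge> 4" by real_asymp
  moreover have "\<forall>\<^sub>F N::real in at_top. N powr (51 / 50) + 1 \<le> N\<^sup>2" by real_asymp
  moreover have "\<forall>\<^sub>F N::real in at_top. N powr (51 / 100) + 1 \<le> N\<^sup>2" by real_asymp
  moreover have "\<forall>\<^sub>F N::real in at_top. \<alpha> * N \<le> N powr (51 / 50)" using \<alpha> by real_asymp
  moreover have "\<forall>\<^sub>F N::real in at_top. \<alpha> * sqrt N \<le> N powr (51 / 100)" using \<alpha> by real_asymp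
  moreover have "\<forall>\<^sub>F N::real in at_top. \<alpha> * N / N powr (51 / 50) \<le> N powr (- (1 / 100))" using \<alpha> by real_asymp
  moreover have "\<forall>\<^sub>F N::real in at_top. (2 / \<alpha> + 1) * ax N + (sqrt N + 1) * (ay N + bz N) +
      bx N * (2 / \<alpha> * (1 + ln N) + 1) \<le> N powr (77 / 100)"
    unfolding ax_def ay_def bz_def bx_def using \<alpha> C by real_asymp
  ultimately show ?thesis
  proof eventually_elim
    case (elim N)
    define X where "X = nat \<lceil>N powr (51 / 50)\<rceil>"
    define Y where "Y = nat \<lceil>N powr (51 / 100)\<rceil>"
    define H where "H = nat \<lfloor>N\<rfloor>"
    have N: "N > 0" "N \<ge> 1" using elim(2) by auto
    have X: "N powr (51 / 50) \<le> real X" "real X \<le> N powr (51 / 50) + 1"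
      unfolding X_def by (simp_all add: real_nat_ceiling_ge of_nat_ceiling)
    have Y: "N powr (51 / 100) \<le> real Y" "real Y \<le> N powr (51 / 100) + 1"
      unfolding Y_def by (simp_all add: real_nat_ceiling_ge of_nat_ceiling)
    have XY1: "X \<ge> 1" "Y \<ge> 1"
    proof -
      have "N powr (51 / 50) > 0" "N powr (51 / 100) > 0" using N by simp_all
      hence "real X > 0" "real Y > 0" using X(1) Y(1) by linarith+
      thus "X \<ge> 1" "Y \<ge> 1" by simp_all
    qed
    have H: "real H \<le> N" "real l < N" "real l \<le> N" if "l < H" for l :: nat
    proof -
      show "real H \<le> N" unfolding H_def using N by (intro of_nat_floor) auto
      thus "real l < N" "real l \<le> N" using that by linarith+
    qed
    have lnpow: "ln (real M) ^ j \<le> N powr (1 / 1000)" if "M \<ge> 1" "real M \<le> N\<^sup>2" for M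
    proof -
      have "ln (real M) \<le> ln (N\<^sup>2)" using that N by (subst ln_le_cancel_iff) auto
      also have "\<dots> = 2 * ln N" using N by (simp add: ln_realpow)
      finally have "ln (real M) ^ j \<le> (2 * ln N) ^ j" using that by (intro power_mono) auto
      thus ?thesis using elim(1) by linarith
    qed
    have bX: "norm (dirichlet_poly j X (Complex \<sigma> t)) \<le> ax N" if "\<sigma> \<ge> 1 / 2" for \<sigma> t
    proof -
      have "2 * sqrt (real X) * ln (real X) ^ j \<le> ax N"
        unfolding ax_def using X XY1 elim(3) by (intro mult_mono real_sqrt_le_mono lnpow) auto
      thus ?thesis using norm_dirichlet_poly_le[OF that XY1(1), of j t] by linarith
    qed
    have bY: "norm (dirichlet_poly j Y (Complex \<sigma> t)) \<le> ay N" if "\<sigma> \<ge> 1 / 2" for \<sigma> t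
    proof -
      have "2 * sqrt (real Y) * ln (real Y) ^ j \<le> ay N"
        unfolding ay_def using Y XY1 elim(4) by (intro mult_mono real_sqrt_le_mono lnpow) auto
      thus ?thesis using norm_dirichlet_poly_le[OF that XY1(2), of j t] by linarith
    qed
    have eX: "norm ((deriv ^^ j) zeta (Complex \<sigma> (\<alpha> * real l)) - dirichlet_poly j X (Complex \<sigma> (\<alpha> * real l)))
       \<le> bx N * (2 / \<alpha> * (1 / real (Suc l)) + 1 / N)"
      if \<sigma>: "1 / 2 \<le> \<sigma>" "\<sigma> \<le> 1" and l: "2 \<le> \<alpha> * real l" "l < H" for \<sigma> l
    proof -
      have lp: "real l > 0" using l \<alpha> by (auto intro: Nat.gr0I)
      have aN: "\<alpha> * real l \<le> \<alpha> * N" using H(3)[OF l(2)] \<alpha> by (intro mult_left_mono) auto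
      have "norm ((deriv ^^ j) zeta (Complex \<sigma> (\<alpha> * real l)) - dirichlet_poly j X (Complex \<sigma> (\<alpha> * real l)))
        \<le> C * real (Suc X) powr (13 / 25) * (1 / (\<alpha> * real l) + (\<alpha> * real l / real (Suc X)) ^ 100)"
        using aN elim(5) X by (intro approx \<sigma> l) linarith
      also have "\<dots> \<le> bx N * (2 / \<alpha> * (1 / real (Suc l)) + 1 / N)"
      proof (intro mult_mono add_mono)
        show "C * real (Suc X) powr (13 / 25) \<le> bx N"
          unfolding bx_def using C X by (intro mult_left_mono powr_mono2) auto
        have "1 / (\<alpha> * real l) = 2 / (\<alpha> * (2 * real l))" using lp \<alpha> by simp
        also have "\<dots> \<le> 2 / (\<alpha> * real (Suc l))"
          using lp \<alpha> by (intro divide_left_mono mult_left_mono mult_pos_pos) auto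
        finally show "1 / (\<alpha> * real l) \<le> 2 / \<alpha> * (1 / real (Suc l))" by simp
        have "\<alpha> * real l / real (Suc X) \<le> \<alpha> * N / N powr (51 / 50)"
          using aN X N \<alpha> by (intro frac_le) auto
        hence "(\<alpha> * real l / real (Suc X)) ^ 100 \<le> (\<alpha> * N / N powr (51 / 50)) ^ 100"
          using \<alpha> by (intro power_mono) auto
        also have "\<dots> \<le> (N powr (- (1 / 100))) ^ 100"
          using elim(7) N \<alpha> by (intro power_mono) auto
        also have "(N powr (- (1 / 100))) ^ 100 = N powr (real 100 * (- (1 / 100)))"
          using N by (intro powr_power) auto
        also have "real 100 * (- (1 / 100)) = - 1" by simp
        also have "N powr (- 1) = 1 / N" using N by (simp only: powr_minus_divide powr_one less_imp_le)
        finally show "(\<alpha> * real l / real (Suc X)) ^ 100 \<le> 1 / N" .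
      qed (use C \<alpha> lp in \<open>auto simp: bx_def\<close>)
      finally show ?thesis .
    qed
    have eY: "norm ((deriv ^^ j) zeta (Complex \<sigma> (\<alpha> * real l)) - dirichlet_poly j Y (Complex \<sigma> (\<alpha> * real l))) \<le> bz N"
      if \<sigma>: "1 / 2 \<le> \<sigma>" "\<sigma> \<le> 1" and l: "2 \<le> \<alpha> * real l" "real l < sqrt N" for \<sigma> l
    proof -
      have aN: "\<alpha> * real l \<le> \<alpha> * sqrt N" using l \<alpha> by (intro mult_left_mono) auto
      hence tY: "\<alpha> * real l \<le> real Y" using elim(6) Y by linarith
      have "norm ((deriv ^^ j) zeta (Complex \<sigma> (\<alpha> * real l)) - dirichlet_poly j Y (Complex \<sigma> (\<alpha> * real l)))
        \<le> C * real (Suc Y) powr (13 / 25) * (1 / (\<alpha> * real l) + (\<alpha> * real l / real (Suc Y)) ^ 100)"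
        by (intro approx \<sigma> l tY)
      also have "\<dots> \<le> (C * (N powr (51 / 100) + 2) powr (13 / 25)) * (1 + 1)"
      proof (intro mult_mono add_mono mult_left_mono powr_mono2)
        show "1 / (\<alpha> * real l) \<le> 1" using l by (simp add: divide_le_eq)
        show "(\<alpha> * real l / real (Suc Y)) ^ 100 \<le> 1" using tY l by (intro power_le_one) (auto simp: divide_le_eq)
      qed (use C Y l in auto)
      also have "\<dots> = bz N" by (simp add: bz_def)
      finally show ?thesis .
    qed
    have nonneg: "ax N \<ge> 0" "ay N \<ge> 0" "bz N \<ge> 0" "bx N \<ge> 0"
      using C N by (simp_all add: ax_def ay_def bz_def bx_def)
    define err where "err l = (if real l < 2 / \<alpha> then ax N else 0) + (if real l < sqrt N then ay N + bz N else 0)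
       + bx N * (2 / \<alpha> * (1 / real (Suc l)) + 1 / N)" for l :: nat
    have last: "bx N * (2 / \<alpha> * (1 / real (Suc l)) + 1 / N) \<ge> 0" for l
      using nonneg \<alpha> N by (intro mult_nonneg_nonneg add_nonneg_nonneg) auto
    have err0: "err l \<ge> 0" for l
      unfolding err_def using nonneg by (intro add_nonneg_nonneg last) auto
    have err_sum: "(\<Sum>l<H. err l) \<le> N powr (77 / 100)"
    proof -
      have H1: "H \<ge> 1" unfolding H_def using N by (simp add: le_nat_iff)
      have HN: "real H \<le> N" unfolding H_def using N by (intro of_nat_floor) auto
      have "(\<Sum>l<H. bx N * (2 / \<alpha> * (1 / real (Suc l)) + 1 / N)) =
         bx N * (2 / \<alpha> * (\<Sum>l<H. 1 / real (Suc l)) + real H * (1 / N))"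
        by (simp only: sum_distrib_left [symmetric] sum.distrib sum_constant card_lessThan)
      hence "(\<Sum>l<H. err l) = (\<Sum>l<H. if real l < 2 / \<alpha> then ax N else 0) +
         (\<Sum>l<H. if real l < sqrt N then ay N + bz N else 0) +
         bx N * (2 / \<alpha> * (\<Sum>l<H. 1 / real (Suc l)) + real H * (1 / N))"
        unfolding err_def sum.distrib by simp
      also have "\<dots> \<le> (2 / \<alpha> + 1) * ax N + (sqrt N + 1) * (ay N + bz N) + bx N * (2 / \<alpha> * (1 + ln N) + 1)"
      proof (intro add_mono mult_left_mono)
        show "(\<Sum>l<H. if real l < 2 / \<alpha> then ax N else 0) \<le> (2 / \<alpha> + 1) * ax N"
          using sum_if_nat_less_real_le[of "ax N" "2 / \<alpha>" H] nonneg \<alpha> by simp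
        show "(\<Sum>l<H. if real l < sqrt N then ay N + bz N else 0) \<le> (sqrt N + 1) * (ay N + bz N)"
          using sum_if_nat_less_real_le[of "ay N + bz N" "sqrt N" H] nonneg N by simp
        have "ln (real H) \<le> ln N" using H1 HN by (subst ln_le_cancel_iff) auto
        thus "(\<Sum>l<H. 1 / real (Suc l)) \<le> 1 + ln N" using harmonic_le_ln[OF H1] by linarith
        show "real H * (1 / N) \<le> 1" using HN N by simp
      qed (use nonneg \<alpha> in auto)
      also have "\<dots> \<le> N powr (77 / 100)" by (rule elim(8))
      finally show ?thesis .
    qed
    show ?case
    proof (intro allI impI, elim conjE)
      fix \<sigma> V
      assume \<sigma>: "1 / 2 \<le> \<sigma>" "\<sigma> \<le> 1" and V: "V \<ge> 0"
        and zV: "\<forall>l::nat. sqrt N \<le> real l \<and> real l \<le> N \<longrightarrow> norm ((deriv ^^ j) zeta (Complex \<sigma> (\<alpha> * real l))) \<le> V"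
      have "norm (dirichlet_poly j X (Complex \<sigma> (\<alpha> * real l))) \<le> V + err l" if l: "l < H" for l
      proof (cases "real l < 2 / \<alpha>")
        case True
        have "ax N \<le> err l" unfolding err_def using True nonneg last[of l] by simp
        thus ?thesis using bX[OF \<sigma>(1), of "\<alpha> * real l"] V by linarith
      next
        case False
        hence l2: "2 \<le> \<alpha> * real l" using \<alpha> by (simp add: field_simps)
        let ?z = "(deriv ^^ j) zeta (Complex \<sigma> (\<alpha> * real l))"
        have tri: "norm (dirichlet_poly j X (Complex \<sigma> (\<alpha> * real l))) \<le>
            norm ?z + bx N * (2 / \<alpha> * (1 / real (Suc l)) + 1 / N)"
          using eX[OF \<sigma> l2 l] norm_triangle_ineq4[of ?z "?z - dirichlet_poly j X (Complex \<sigma> (\<alpha> * real l))"] by simp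
        show ?thesis
        proof (cases "real l < sqrt N")
          case True
          have "norm ?z \<le> ay N + bz N"
            using eY[OF \<sigma> l2 True] bY[OF \<sigma>(1), of "\<alpha> * real l"]
              norm_triangle_ineq2[of ?z "dirichlet_poly j Y (Complex \<sigma> (\<alpha> * real l))"] by linarith
          thus ?thesis using tri True False V by (simp add: err_def)
        next
          case ge: False
          have "norm ?z \<le> V" using zV ge H(3)[OF l] by simp
          thus ?thesis using tri ge False by (simp add: err_def)
        qed
      qed
      thus "\<exists>err. (\<forall>l. err l \<ge> 0) \<and>
        (\<forall>l<nat \<lfloor>N\<rfloor>. norm (dirichlet_poly j (nat \<lceil>N powr (51 / 50)\<rceil>) (Complex \<sigma> (\<alpha> * real l))) \<le> V + err l) \<and>
        (\<Sum>l<nat \<lfloor>N\<rfloor>. err l) \<le> N powr (77 / 100)"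
        using err0 err_sum unfolding H_def X_def by (intro exI[of _ err]) auto
    qed
  qed
qed

section \<open>From the resonance inequality to the maximum\<close>

lemma prod_powr_power:
  assumes "finite J" "\<And>j. j \<in> J \<Longrightarrow> f j > (0::real)"
  shows "(\<Prod>j\<in>J. (f j powr b) ^ D j) = (\<Prod>j\<in>J. f j ^ D j) powr b"
  using assms
proof (induction J rule: finite_induct)
  case (insert i J)
  have "(f i powr b) ^ D i = (f i ^ D i) powr b"
    using insert.prems[of i] by (simp add: powr_power powr_powr mult.commute flip: powr_realpow)
  thus ?case using insert by (simp add: powr_mult prod_nonneg less_imp_le)
qed simp

lemma prod_sqrt: "(\<Prod>j\<in>J. sqrt (f j)) = sqrt (\<Prod>j\<in>J. f j)"
  by (induction J rule: infinite_finite_induct) (simp_all add: real_sqrt_mult)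

text \<open>The resonance inequality divided by \<open>W\<close>, the geometric mean of the two
  resonator sizes. Because card V1 / W = sqrt (card V1 / card V0), the main term becomes the product
  of the block gains; in the error term one factor W <= B survives.\<close>

lemma resonance_lower_bound:
  fixes \<alpha> \<sigma> w N V :: real and J :: "nat set" and m D :: "nat \<Rightarrow> nat" and err :: "nat \<Rightarrow> real"
  assumes w: "w \<ge> 1" and N: "N = exp (exp w)" "N \<le> real X"
    and J: "finite J" "J \<noteq> {}"
    and mD: "\<forall>j\<in>J. 1 \<le> D j \<and> D j \<le> m j \<and> m j \<le> card (prime_block w j)"
    and size: "(\<Prod>j\<in>J. exp (w + 1 / 50 * real (Suc j)) ^ D j) \<le> N" and \<sigma>: "\<sigma> \<ge> 0"
    and U1: "real (\<Prod>j\<in>J. card (prime_block w j) choose m j) \<le> B"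
    and U0: "real (\<Prod>j\<in>J. card (prime_block w j) choose (m j - D j)) \<le> B"
    and gain: "G \<le> (\<Prod>j\<in>J. sqrt (real (card (prime_block w j) choose m j) / real (card (prime_block w j) choose (m j - D j)))
          * real (m j choose D j) * (exp (w + 1 / 50 * real (Suc j)) powr (- \<sigma>)) ^ D j)"
    and H: "H > 0" and V: "V \<ge> 0" and err: "\<forall>l. err l \<ge> 0"
    and bound: "\<forall>l<H. norm (dirichlet_poly k X (Complex \<sigma> (\<alpha> * real l))) \<le> V + err l"
  shows "real H / 4 * G \<le> 8 * real H * V + 2 * B * (\<Sum>l<H. err l)"
proof -
  interpret prime_blocks J "prime_block w" by (rule prime_blocks_prime_block[OF J(1)])
  define P where "P = prime_block w"
  define x where "x j = exp (w + 1 / 50 * real (Suc j))" for j :: nat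
  define a where "a n = ln (real (Suc n)) ^ k * real (Suc n) powr (- \<sigma>)" for n
  define U where "U m = block_sets J P m" for m
  define V0 where "V0 = U (\<lambda>j. m j - D j)"
  define V1 where "V1 = U m"
  define c where "c = (\<Prod>j\<in>J. x j ^ D j) powr (- \<sigma>)"
  define \<phi> where "\<phi> S = \<alpha> / (2 * pi) * ln (real (block_prod J S))" for S :: "nat \<Rightarrow> nat set"
  have finU: "finite (U m)" for m unfolding U_def P_def by (intro finite_block_sets finite_J finite_P)
  have cardU: "card (U m) = (\<Prod>j\<in>J. card (P j) choose m j)" for m
    unfolding U_def P_def by (intro card_block_sets finite_J finite_P)
  have pos: "card V0 > 0" "card V1 > 0"
    unfolding V0_def V1_def cardU P_def using mD by (auto intro!: prod_pos simp: zero_less_binomial_iff le_diff_conv intro: le_trans)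
  have xpos: "x j > 0" for j by (simp add: x_def)
  have count: "c * real (card V1) * real (\<Prod>j\<in>J. m j choose D j)
     \<le> (\<Sum>n<X. a n * real (card (quotient_pairs m D (Suc n))))"
    unfolding V1_def U_def P_def
  proof (rule quotient_pairs_count)
    fix T assume T: "T \<in> block_sets J (prime_block w) D"
    define q where "q = block_prod J T"
    obtain i where i: "i \<in> J" using J by blast
    have q3: "q \<ge> 3" unfolding q_def
      by (rule block_prod_ge_3[OF T i]) (use i mD prime_block_ge_3[OF w] in auto)
    have qle: "real q \<le> (\<Prod>j\<in>J. x j ^ D j)"
      unfolding q_def by (rule block_prod_le[OF T]) (auto simp: prime_block_def x_def)
    have "real q \<le> real X" using qle size N by (simp add: x_def)
    moreover have "c \<le> a (q - 1)"
    proof -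
      have "ln (exp 1) \<le> ln (real q)" using q3 e_less_272 by (subst ln_le_cancel_iff) auto
      hence "1 \<le> ln (real q) ^ k" by (intro one_le_power) simp
      hence "1 * real q powr (- \<sigma>) \<le> ln (real q) ^ k * real q powr (- \<sigma>)" by (intro mult_right_mono) auto
      moreover have "c \<le> real q powr (- \<sigma>)" unfolding c_def using q3 qle \<sigma> by (intro powr_mono2') auto
      moreover have "a (q - 1) = ln (real q) ^ k * real q powr (- \<sigma>)" using q3 by (simp add: a_def of_nat_diff)
      ultimately show ?thesis by simp
    qed
    ultimately show "block_prod J T \<le> X \<and> c \<le> a (block_prod J T - 1)" by (simp add: q_def)
  qed (use mD in \<open>auto simp: a_def c_def\<close>)
  have res: "real H / 4 * (\<Sum>n<X. a n * real (card (quotient_pairs m D (Suc n)))) \<le>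
     8 * real H * V * sqrt (real (card V0) * real (card V1))
       + 2 * real (card V0) * real (card V1) * (\<Sum>l<H. err l)"
  proof (rule resonance_inequality[where K = "{..<X}" and U = V0 and W = V1 and H = H and a = a
        and E = "\<lambda>n. quotient_pairs m D (Suc n)" and V = V and err = err
        and \<phi> = \<phi> and \<psi> = \<phi> and \<omega> = "\<lambda>n. \<alpha> / (2 * pi) * ln (real (Suc n))"])
    show "\<phi> v = \<phi> u + \<alpha> / (2 * pi) * ln (real (Suc n))" if "(u, v) \<in> quotient_pairs m D (Suc n)" for n u v
    proof -
      have u: "u \<in> block_sets J (prime_block w) (\<lambda>j. m j - D j)" and v: "block_prod J v = block_prod J u * Suc n"
        using that by (auto simp: quotient_pairs_def)
      have "ln (real (block_prod J v)) = ln (real (block_prod J u)) + ln (real (Suc n))"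
        unfolding v of_nat_mult using block_prod_pos[OF u] by (subst ln_mult) auto
      thus ?thesis by (simp add: \<phi>_def distrib_left)
    qed
    show "norm (\<Sum>n<X. of_real (a n) * unit_exp (real l * (\<alpha> / (2 * pi) * ln (real (Suc n))))) \<le> V + err l" if "l < H" for l
      using bound that unfolding a_def norm_dirichlet_poly_unit_exp by blast
    show "quotient_pairs m D (Suc n) \<subseteq> V0 \<times> V1" for n
      by (auto simp: quotient_pairs_def V0_def V1_def U_def P_def)
    show "inj_on fst (quotient_pairs m D (Suc n))" "inj_on snd (quotient_pairs m D (Suc n))" for n
      by (rule inj_on_quotient_pairs, simp)+
  qed (use finU H V err in \<open>auto simp: V0_def V1_def a_def\<close>)
  define W where "W = sqrt (real (card V0) * real (card V1))"
  have W: "W > 0" using pos by (simp add: W_def)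
  have W2: "real (card V0) * real (card V1) = W * W" by (simp add: W_def)
  have VB: "real (card V0) \<le> B" "real (card V1) \<le> B"
    using U0 U1 by (simp_all only: V0_def V1_def cardU P_def)
  hence "W \<le> sqrt (B * B)" unfolding W_def by (intro real_sqrt_le_mono mult_mono) auto
  moreover have "B \<ge> 0" using VB(1) of_nat_0_le_iff[of "card V0"] by linarith
  ultimately have WB: "W \<le> B" by simp
  have "W * G \<le> W * (sqrt (real (card V1) / real (card V0)) * real (\<Prod>j\<in>J. m j choose D j) * c)"
  proof (rule mult_left_mono)
    have "(\<Prod>j\<in>J. sqrt (real (card (P j) choose m j) / real (card (P j) choose (m j - D j)))) =
      sqrt (\<Prod>j\<in>J. real (card (P j) choose m j) / real (card (P j) choose (m j - D j)))"
      by (rule prod_sqrt)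
    also have "(\<Prod>j\<in>J. real (card (P j) choose m j) / real (card (P j) choose (m j - D j))) = real (card V1) / real (card V0)"
      by (simp add: prod_dividef V0_def V1_def cardU)
    finally have 1: "(\<Prod>j\<in>J. sqrt (real (card (P j) choose m j) / real (card (P j) choose (m j - D j)))) =
      sqrt (real (card V1) / real (card V0))" .
    have 2: "(\<Prod>j\<in>J. (x j powr (- \<sigma>)) ^ D j) = c"
      unfolding c_def by (rule prod_powr_power[OF J(1) xpos])
    show "G \<le> sqrt (real (card V1) / real (card V0)) * real (\<Prod>j\<in>J. m j choose D j) * c"
      using gain unfolding x_def [symmetric] P_def [symmetric] prod.distrib 1 2 by simp
  qed (use W in auto)
  also have "\<dots> = c * real (card V1) * real (\<Prod>j\<in>J. m j choose D j)"
  proof -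
    have "W * sqrt (real (card V1) / real (card V0)) = sqrt (real (card V1) * real (card V1))"
      unfolding W_def using pos by (subst real_sqrt_mult [symmetric]) simp
    hence eq: "W * sqrt (real (card V1) / real (card V0)) = real (card V1)" by simp
    have "W * (r * p * c) = c * (W * r) * p" for r p by simp
    thus ?thesis by (simp only: eq)
  qed
  finally have "W * G \<le> (\<Sum>n<X. a n * real (card (quotient_pairs m D (Suc n))))" using count by linarith
  hence "real H / 4 * (W * G) \<le> real H / 4 * (\<Sum>n<X. a n * real (card (quotient_pairs m D (Suc n))))"
    by (intro mult_left_mono) auto
  also note res
  also have "8 * real H * V * sqrt (real (card V0) * real (card V1)) + 2 * real (card V0) * real (card V1) * (\<Sum>l<H. err l)
     = W * (8 * real H * V + 2 * W * (\<Sum>l<H. err l))"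
    using W2 by (simp add: W_def algebra_simps)
  finally have "W * (real H / 4 * G) \<le> W * (8 * real H * V + 2 * W * (\<Sum>l<H. err l))" by (simp add: mult_ac)
  hence "real H / 4 * G \<le> 8 * real H * V + 2 * W * (\<Sum>l<H. err l)" using W by simp
  also have "\<dots> \<le> 8 * real H * V + 2 * B * (\<Sum>l<H. err l)"
    using WB err by (intro add_left_mono mult_right_mono sum_nonneg) auto
  finally show ?thesis .
qed

theorem theorem1:
  fixes j :: nat and \<alpha> A :: real
  assumes "\<alpha> > 0" and "A > 0"
  shows "\<exists>\<epsilon> :: real \<Rightarrow> real. (\<epsilon> \<longlongrightarrow> 0) at_top \<and>
    (\<forall>\<^sub>F N in at_top.
      Max ((\<lambda>l :: int. norm ((deriv ^^ j) zeta (Complex (sigma_pt A N) (\<alpha> * of_int l))))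
             ` {l :: int. sqrt N \<le> of_int l \<and> of_int l \<le> N})
      \<ge> exp ((lambda_const A + \<epsilon> N) * sqrt (ln N * iter_ln 3 N / iter_ln 2 N)))"
proof -
  have lnln: "filterlim (\<lambda>N::real. ln (ln N)) at_top at_top" by real_asymp
  define \<mu> where "\<mu> = lambda_const A"
  define \<mu>' where "\<mu>' = 42 / 100 * exp (- A)"
  have \<mu>: "\<mu> < \<mu>'" "\<mu> > 0" using lambda_const_less[of A] by (simp_all add: \<mu>_def \<mu>'_def lambda_const_def)
  note ev1 = eventually_compose_filterlim[OF resonator_parameters[OF assms(2)] lnln]
  note ev2 = dirichlet_poly_error[OF assms(1), of j]
  have "\<forall>\<^sub>F N::real in at_top. N \<ge> 4" by real_asymp
  moreover have "\<forall>\<^sub>F N::real in at_top. ln (ln N) \<ge> 1" by real_asymp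
  moreover have "\<forall>\<^sub>F N::real in at_top. ln (ln N) \<ge> 2 * A" using assms by real_asymp
  \<comment> \<open>Here 9/40 + 77/100 = 199/200 < 1 decides: the pointwise errors, multiplied by
    the resonator size, stay below N.\<close>
  moreover have "\<forall>\<^sub>F N::real in at_top. 4 * (N powr (9 / 40) * N powr (77 / 100)) \<le> N" by real_asymp
  moreover have "\<forall>\<^sub>F N::real in at_top. N \<le> N powr (51 / 50)" by real_asymp
  \<comment> \<open>The gap between \<mu> and \<mu>' absorbs the constants 32 and 4 that remain
    after the resonance argument.\<close>
  moreover have "\<forall>\<^sub>F N::real in at_top. 32 * exp (\<mu> * sqrt (ln N * ln (ln (ln N)) / ln (ln N))) + 4 \<le> exp (\<mu>' * sqrt (ln N * ln (ln (ln N)) / ln (ln N)))"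
    using \<mu> by real_asymp
  ultimately have "\<forall>\<^sub>F N in at_top.
      Max ((\<lambda>l :: int. norm ((deriv ^^ j) zeta (Complex (sigma_pt A N) (\<alpha> * of_int l))))
             ` {l :: int. sqrt N \<le> of_int l \<and> of_int l \<le> N})
      \<ge> exp ((lambda_const A + 0) * sqrt (ln N * iter_ln 3 N / iter_ln 2 N))"
    using ev1 ev2
  proof eventually_elim
    case (elim N)
    define w where "w = ln (ln N)"
    have N: "N \<ge> 4" "N > 0" using elim(1) by auto
    have "ln N > 0" using N by simp
    hence expw: "exp w = ln N" "exp (exp w) = N" using N by (simp_all add: w_def)
    have iter: "iter_ln 2 N = w" "iter_ln 3 N = ln w" by (simp_all add: iter_ln_def w_def numeral_eq_Suc)
    have w: "w \<ge> 1" "w \<ge> 2 * A" using elim(2,3) by (simp_all add: w_def)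
    define \<sigma> where "\<sigma> = sigma_pt A N"
    have \<sigma>: "\<sigma> = 1 / 2 + A / w" "1 / 2 \<le> \<sigma>" "\<sigma> \<le> 1"
      using w assms by (simp_all add: \<sigma>_def sigma_pt_def iter field_simps)
    define I where "I = {l :: int. sqrt N \<le> of_int l \<and> of_int l \<le> N}"
    define f where "f = (\<lambda>l :: int. norm ((deriv ^^ j) zeta (Complex \<sigma> (\<alpha> * of_int l))))"
    define V where "V = Max (f ` I)"
    have finI: "finite I"
    proof (rule finite_subset)
      show "I \<subseteq> {0..\<lfloor>N\<rfloor>}"
      proof
        fix l assume "l \<in> I"
        hence "sqrt N \<le> of_int l" "of_int l \<le> N" by (simp_all add: I_def)
        moreover have "0 \<le> sqrt N" using N by simp
        ultimately have "0 \<le> real_of_int l" "l \<le> \<lfloor>N\<rfloor>" by (linarith, simp add: le_floor_iff)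
        thus "l \<in> {0..\<lfloor>N\<rfloor>}" by simp
      qed
    qed simp
    have fV: "f l \<le> V" if "l \<in> I" for l unfolding V_def using that finI by simp
    define H where "H = nat \<lfloor>N\<rfloor>"
    have H: "real H \<le> N" "N < real H + 1" unfolding H_def using N by (simp_all add: of_nat_floor)
    have sqN: "sqrt N + 1 \<le> N"
    proof -
      have "2 * sqrt N \<le> sqrt N * sqrt N" using N by (intro mult_right_mono real_le_rsqrt) auto
      moreover have "2 \<le> sqrt N" using N by (intro real_le_rsqrt) auto
      ultimately show ?thesis using N by simp
    qed
    \<comment> \<open>Exhibits a member of the range, so the maximum is taken over a nonempty set of
      norms and V is nonnegative.\<close>
    have "int H \<in> I" using H sqN by (simp add: I_def)
    hence V0: "V \<ge> 0" using fV[of "int H"] by (simp add: f_def order_trans[OF norm_ge_zero])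
    have "norm ((deriv ^^ j) zeta (Complex \<sigma> (\<alpha> * real l))) \<le> V" if "sqrt N \<le> real l \<and> real l \<le> N" for l :: nat
      using fV[of "int l"] that by (simp add: I_def f_def)
    with elim(8) \<sigma> V0 obtain err where err: "\<forall>l. err l \<ge> 0"
      "\<forall>l<H. norm (dirichlet_poly j (nat \<lceil>N powr (51 / 50)\<rceil>) (Complex \<sigma> (\<alpha> * real l))) \<le> V + err l"
      "(\<Sum>l<H. err l) \<le> N powr (77 / 100)"
      unfolding H_def by blast
    obtain J m D where J: "finite J" "J \<noteq> {}"
      and mD: "\<forall>j\<in>J. 1 \<le> D j \<and> D j \<le> m j \<and> m j \<le> card (prime_block w j)"
      and U1: "real (\<Prod>j\<in>J. card (prime_block w j) choose m j) \<le> exp (9 / 40 * exp w)"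
      and U0: "real (\<Prod>j\<in>J. card (prime_block w j) choose (m j - D j)) \<le> exp (9 / 40 * exp w)"
      and size: "(\<Prod>j\<in>J. exp (w + 1 / 50 * real (Suc j)) ^ D j) \<le> exp (exp w)"
      and gain: "exp (\<mu>' * sqrt (exp w * ln w / w)) \<le>
       (\<Prod>j\<in>J. sqrt (real (card (prime_block w j) choose m j) / real (card (prime_block w j) choose (m j - D j)))
          * real (m j choose D j) * (exp (w + 1 / 50 * real (Suc j)) powr (- (1 / 2 + A / w))) ^ D j)"
      using elim(7) unfolding w_def [symmetric] \<mu>'_def by blast
    define q where "q = sqrt (ln N * ln w / w)"
    have "real H / 4 * exp (\<mu>' * q) \<le> 8 * real H * V + 2 * exp (9 / 40 * exp w) * (\<Sum>l<H. err l)"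
    proof (rule resonance_lower_bound[OF w(1) expw(2)[symmetric] _ J mD _ _ U1 U0 _ _ V0 err(1,2)])
      show "N \<le> real (nat \<lceil>N powr (51 / 50)\<rceil>)" using elim(5) real_nat_ceiling_ge[of "N powr (51 / 50)"] by linarith
    qed (use size gain \<sigma> expw H N in \<open>auto simp: q_def\<close>)
    also have "\<dots> \<le> 8 * real H * V + 2 * N powr (9 / 40) * N powr (77 / 100)"
    proof -
      have "exp (9 / 40 * exp w) = N powr (9 / 40)" using N by (simp add: expw powr_def)
      thus ?thesis using err(3) by (simp add: mult_left_mono)
    qed
    also have "\<dots> \<le> 8 * real H * V + N / 2" using elim(4) by simp
    also have "N / 2 \<le> real H" using H N by linarith
    finally have "real H * exp (\<mu>' * q) \<le> real H * (32 * V + 4)" by (simp add: algebra_simps)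
    moreover have "real H > 0" using H N by linarith
    ultimately have "exp (\<mu>' * q) \<le> 32 * V + 4" by simp
    hence "exp (\<mu> * q) \<le> V" using elim(6) unfolding w_def [symmetric] q_def [symmetric] by linarith
    thus ?case by (simp add: V_def f_def I_def \<sigma>_def q_def iter \<mu>_def)
  qed
  thus ?thesis by (intro exI[of _ "\<lambda>_. 0"]) auto
qed

end
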